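(* Let $j:\mathbb{R}^3\to[0,+\infty]$ be a Borel-measurable kernel such that (i) $j(-z)=j(z)$ for all $z\in\mathbb{R}^3$; (ii) $\int_{\mathbb{R}^3}\min\{1,|z|^2\}\,j(z)\,dz<+\infty$; (iii) $j\notin L^1(B_R)$ for every $R>0$. Then there exists a critical radius $R^{**}=R^{**}(j)>0$ such that, for every $R\ge R^{**}$, every minimizer $m_*\in\mathcal X^j(B_R;\mathbb{S}^2)$ of the energy $$\mathcal E_{B_R}(m):=\iint_{B_R\times B_R}j(x-y)|m(x)-m(y)|^2\,dx\,dy-\int_{B_R}h_d[m](x)\cdot m(x)\,dx$$ is non-constant.
   Context: $B_R\subseteq\mathbb{R}^3$ is the ball of radius $R$ centered at the origin. $\mathbb{S}^2$ is the unit sphere of $\mathbb{R}^3$, $L^2(B_R;\mathbb{S}^2):=\{m\in L^2(B_R;\mathbb{R}^3):|m|=1\text{ a.e. in }B_R\}$, and $$\mathcal X^j(B_R;\mathbb{S}^2):=\Big\{m\in L^2(B_R;\mathbb{S}^2):\iint_{B_R\times B_R}j(x-y)|m(x)-m(y)|^2\,dx\,dy<+\infty\Big\}.$$ "Minimizer" means minimizer of $\mathcal E_{B_R}$ over $\mathcal X^j(B_R;\mathbb{S}^2)$; "non-constant" means not almost everywhere equal to a constant. For $m\in L^2(B_R;\mathbb{R}^3)$, the demagnetizing field $h_d[m]\in L^2(\mathbb{R}^3;\mathbb{R}^3)$ is the unique $L^2(\mathbb{R}^3;\mathbb{R}^3)$ solution (in the sense of distributions) of $$\operatorname{div}(m\chi_{B_R}+h_d[m])=0,\qquad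 \operatorname{curl}h_d[m]=0\qquad\text{in }\mathbb{R}^3,$$ where $m\chi_{B_R}$ is the extension of $m$ by zero outside $B_R$. *)

theory Defs
  imports "HOL-Analysis.Analysis"
begin

definition L2_space :: "'a measure \<Rightarrow> ('a \<Rightarrow> real^3) set" where
  "L2_space M = {f \<in> borel_measurable M. integrable M (\<lambda>x. (norm (f x))\<^sup>2)}"

definition L2_sphere :: "(real^3) set \<Rightarrow> (real^3 \<Rightarrow> real^3) set" where
  "L2_sphere \<Omega> = {m \<in> L2_space (lebesgue_on \<Omega>). AE x in lebesgue_on \<Omega>. m x \<in> sphere 0 1}"

definition nonlocal_energy :: "(real^3 \<Rightarrow> ennreal) \<Rightarrow> (real^3) set \<Rightarrow> (real^3 \<Rightarrow> real^3) \<Rightarrow> ennreal" where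
  "nonlocal_energy j \<Omega> m =
     (\<integral>\<^sup>+ (x, y). j (x - y) * ennreal ((norm (m x - m y))\<^sup>2)
        \<partial>(lebesgue_on \<Omega> \<Otimes>\<^sub>M lebesgue_on \<Omega>))"

definition X_space :: "(real^3 \<Rightarrow> ennreal) \<Rightarrow> (real^3) set \<Rightarrow> (real^3 \<Rightarrow> real^3) set" where
  "X_space j \<Omega> = {m \<in> L2_sphere \<Omega>. nonlocal_energy j \<Omega> m < \<infinity>}"

text \<open>Every iterated directional derivative up to order \<open>k\<close> exists and is continuous;
  in finite dimension this is the class of \<open>k\<close> times continuously differentiable functions.\<close>

primrec C_order :: "nat \<Rightarrow> ('a::euclidean_space \<Rightarrow> 'b::euclidean_space) \<Rightarrow> bool" where
  "C_order 0 f \<longleftrightarrow> continuous_on UNIV f"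
| "C_order (Suc k) f \<longleftrightarrow> (\<forall>x. f differentiable (at x)) \<and>
     (\<forall>v. C_order k (\<lambda>x. frechet_derivative f (at x) v))"

definition test_function :: "('a::euclidean_space \<Rightarrow> 'b::euclidean_space) \<Rightarrow> bool" where
  "test_function f \<longleftrightarrow> (\<forall>k. C_order k f) \<and> compact (closure (support_on UNIV f))"

definition gradient :: "(real^3 \<Rightarrow> real) \<Rightarrow> real^3 \<Rightarrow> real^3" where
  "gradient \<phi> x = (\<chi> i. frechet_derivative \<phi> (at x) (axis i 1))"

text \<open>The entry \<open>J $ i $ k\<close> of the Jacobian is the derivative of the \<open>i\<close>-th component
  in the direction of the \<open>k\<close>-th coordinate.\<close>

definition curl :: "(real^3 \<Rightarrow> real^3) \<Rightarrow> real^3 \<Rightarrow> real^3" where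
  "curl \<psi> x = (let J = jacobian \<psi> (at x) in
     vector [J $ 3 $ 2 - J $ 2 $ 3, J $ 1 $ 3 - J $ 3 $ 1, J $ 2 $ 1 - J $ 1 $ 2])"

definition distr_div_zero :: "(real^3 \<Rightarrow> real^3) \<Rightarrow> bool" where
  "distr_div_zero u \<longleftrightarrow>
     (\<forall>\<phi>. test_function \<phi> \<longrightarrow> (LINT x|lebesgue. u x \<bullet> gradient \<phi> x) = 0)"

definition distr_curl_zero :: "(real^3 \<Rightarrow> real^3) \<Rightarrow> bool" where
  "distr_curl_zero u \<longleftrightarrow>
     (\<forall>\<psi>. test_function \<psi> \<longrightarrow> (LINT x|lebesgue. u x \<bullet> curl \<psi> x) = 0)"

definition is_demag_field :: "(real^3) set \<Rightarrow> (real^3 \<Rightarrow> real^3) \<Rightarrow> (real^3 \<Rightarrow> real^3) \<Rightarrow> bool" where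
  "is_demag_field \<Omega> m h \<longleftrightarrow> h \<in> L2_space lebesgue \<and>
     distr_div_zero (\<lambda>x. indicat_real \<Omega> x *\<^sub>R m x + h x) \<and> distr_curl_zero h"

text \<open>The field is unique only up to null sets, so a representative has to be selected; integrals
  involving it do not depend on the selection.\<close>

definition demag_field :: "(real^3) set \<Rightarrow> (real^3 \<Rightarrow> real^3) \<Rightarrow> real^3 \<Rightarrow> real^3" where
  "demag_field \<Omega> m = (SOME h. is_demag_field \<Omega> m h)"

definition energy :: "(real^3 \<Rightarrow> ennreal) \<Rightarrow> (real^3) set \<Rightarrow> (real^3 \<Rightarrow> real^3) \<Rightarrow> ereal" where
  "energy j \<Omega> m = enn2ereal (nonlocal_energy j \<Omega> m)
     - ereal (LINT x|lebesgue_on \<Omega>. demag_field \<Omega> m x \<bullet> m x)"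

definition minimizer :: "(real^3 \<Rightarrow> ennreal) \<Rightarrow> (real^3) set \<Rightarrow> (real^3 \<Rightarrow> real^3) \<Rightarrow> bool" where
  "minimizer j \<Omega> m \<longleftrightarrow> m \<in> X_space j \<Omega> \<and> (\<forall>m' \<in> X_space j \<Omega>. energy j \<Omega> m \<le> energy j \<Omega> m')"

definition non_constant :: "(real^3) set \<Rightarrow> (real^3 \<Rightarrow> real^3) \<Rightarrow> bool" where
  "non_constant \<Omega> m \<longleftrightarrow> \<not> (\<exists>c. AE x in lebesgue_on \<Omega>. m x = c)"

end

theory Submission
  imports Defs
begin

text \<open>A constant magnetization \<open>c\<close> has \<open>h\<^sub>d = -c/3\<close> in the ball, hence energy at least \<open>|B\<^sub>R|/3\<close>.
  It is beaten by the unit field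
  \<open>m(x) = (1 - s) c + (x \<cdot> c) x / R\<^sup>2 + sqrt (2 - s) (c \<times> x) / R\<close> with \<open>s = |x|\<^sup>2 / R\<^sup>2\<close>:
  its azimuthal part is divergence free and tangential and does not contribute to the field, and the
  remaining part is a polynomial with an explicit potential, \<open>(x \<cdot> c) s / 5\<close> inside the ball and
  a dipole outside. Averaged over the three choices \<open>c = e\<^sub>1, e\<^sub>2, e\<^sub>3\<close>, its magnetostatic energy is
  at most \<open>|B\<^sub>R|/5\<close>. As \<open>m\<close> is Lipschitz with constant \<open>K/R\<close>, its nonlocal energy is at most
  \<open>|B\<^sub>R| \<integral> j(z) min(4, K\<^sup>2|z|\<^sup>2/R\<^sup>2) dz = o(|B\<^sub>R|)\<close> by dominated convergence.

  For the selected demagnetizing field to be the explicit one, an \<open>L\<^sup>2\<close> field \<open>w\<close> that is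
  divergence and curl free must vanish. Testing the divergence with \<open>H(|y|\<^sup>2) (y \<cdot> e)\<close> and the curl with
  \<open>H(|y|\<^sup>2) (y \<times> e)\<close>, where \<open>y = x - a\<close>, and letting \<open>H(t)\<close> tend to \<open>(t + \<epsilon>\<^sup>2)powr (-3/2)\<close> makes
  \<open>w \<cdot> e\<close> orthogonal to \<open>\<epsilon>\<^sup>2 (|y|\<^sup>2 + \<epsilon>\<^sup>2)powr (-5/2)\<close>, an approximate identity.\<close>

section \<open>Smooth test functions\<close>

text \<open>The competitor keeps the surface charge of the constant: on |x| = R its normal component
  is still (x . c)/R. The gain comes from the interior, where -div m = -2 (x . c)/R^2 has the
  opposite sign and partly screens that charge. The azimuthal term supplies the missing length. The
  gap between 1/3 and 1/5 leaves room for a nonlocal cost of |B_R|/10.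

  Two obstacles shape the rest. The explicit potentials have a kink on the sphere |x| = R, so their
  gradients and curls have to be understood weakly; this is done for locally Lipschitz functions
  with a derivative almost everywhere, through difference quotients and translation invariance of
  the integral. And the kernel behind uniqueness has unbounded support, hence the smooth cutoff. The
  identity that drives the uniqueness argument is grad div - curl curl = Laplacian, applied to
  \<open>-(|y|^2 + eps^2) powr (-1/2)\<close> times e, a smoothed Newtonian potential.\<close>

lemma C_order_SucI:
  assumes "\<And>x. (f has_derivative f' x) (at x)" "\<And>v. C_order k (\<lambda>x. f' x v)"
  shows "C_order (Suc k) f"
proof -
  have "frechet_derivative f (at x) = f' x" for x
    using frechet_derivative_at[OF assms(1)] by simp
  then show ?thesis using assms by (auto simp: differentiable_def)
qed

lemma C_order_SucD:
  assumes "C_order (Suc k) f"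
  shows "(f has_derivative frechet_derivative f (at x)) (at x)"
    and "C_order k (\<lambda>x. frechet_derivative f (at x) v)"
  using assms by (simp_all add: frechet_derivative_works[symmetric])

lemma C_order_lower: "C_order (Suc k) f \<Longrightarrow> C_order k f"
proof (induction k arbitrary: f)
  case 0
  have "isCont f x" for x
    using has_derivative_continuous[OF C_order_SucD(1)[OF 0]] .
  then show ?case by (simp add: continuous_at_imp_continuous_on)
next
  case (Suc k)
  show ?case
    by (rule C_order_SucI[OF C_order_SucD(1)[OF Suc.prems]])
       (rule Suc.IH[OF C_order_SucD(2)[OF Suc.prems]])
qed

lemma C_order_const: "C_order k (\<lambda>x. c)"
proof (induction k arbitrary: c)
  case (Suc k)
  show ?case by (rule C_order_SucI[OF has_derivative_const Suc])
qed simp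

lemma C_order_add: "C_order k f \<Longrightarrow> C_order k g \<Longrightarrow> C_order k (\<lambda>x. f x + g x)"
proof (induction k arbitrary: f g)
  case 0 then show ?case by (simp add: continuous_on_add)
next
  case (Suc k)
  show ?case
    by (rule C_order_SucI[OF has_derivative_add[OF C_order_SucD(1) C_order_SucD(1)]
          Suc.IH[OF C_order_SucD(2) C_order_SucD(2)]]) (rule Suc.prems)+
qed

lemma C_order_linear: "bounded_linear L \<Longrightarrow> C_order k f \<Longrightarrow> C_order k (\<lambda>x. L (f x))"
proof (induction k arbitrary: f)
  case 0 then show ?case by (simp add: bounded_linear.continuous_on)
next
  case (Suc k)
  show ?case
    by (rule C_order_SucI[OF bounded_linear.has_derivative[OF Suc.prems(1) C_order_SucD(1)]
          Suc.IH[OF Suc.prems(1) C_order_SucD(2)]]) (rule Suc.prems)+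
qed

text \<open>Each term of the product rule pairs an undifferentiated factor with a differentiated
  one. The former is still of order k + 1 and is lowered to order k so that the induction hypothesis
  applies to both.\<close>

lemma C_order_bilinear:
  assumes "bounded_bilinear B"
  shows "C_order k f \<Longrightarrow> C_order k g \<Longrightarrow> C_order k (\<lambda>x. B (f x) (g x))"
proof (induction k arbitrary: f g)
  case 0 then show ?case by (simp add: bounded_bilinear.continuous_on[OF assms])
next
  case (Suc k)
  show ?case
    by (rule C_order_SucI[OF bounded_bilinear.FDERIV[OF assms C_order_SucD(1) C_order_SucD(1)]
          C_order_add[OF Suc.IH[OF C_order_lower C_order_SucD(2)] Suc.IH[OF C_order_SucD(2) C_order_lower]]])
       (rule Suc.prems)+
qed

lemma C_order_shift: "C_order k (\<lambda>x. x - a)"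
proof (cases k)
  case 0 then show ?thesis by (simp add: continuous_on_diff)
next
  case (Suc n)
  have "((\<lambda>x. x - a) has_derivative (\<lambda>v. v)) (at x)" for x
    by (auto intro!: derivative_eq_intros)
  from C_order_SucI[OF this C_order_const] show ?thesis unfolding Suc .
qed

text \<open>Smoothness of a real function enters as membership in a family closed under differentiation up to
  linear combinations of two members.\<close>

lemma C_order_compose_family:
  assumes F: "\<And>i s. s \<in> S \<Longrightarrow> (F i has_real_derivative a i * F (p i) s + b i * F (q i) s) (at s)"
    and g: "\<And>x. g x \<in> S"
  shows "C_order k g \<Longrightarrow> C_order k (\<lambda>x. F i (g x))"
proof (induction k arbitrary: i)
  case 0
  have "isCont (F i) (g x)" for x using DERIV_isCont[OF F[OF g]] .
  moreover have "isCont g x" for x using 0 by (simp add: continuous_on_eq_continuous_at)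
  ultimately have "isCont (\<lambda>x. F i (g x)) x" for x by (rule isCont_o2[rotated])
  then show ?case by (simp add: continuous_on_eq_continuous_at)
next
  case (Suc k)
  let ?D = "\<lambda>x v. (a i * F (p i) (g x) + b i * F (q i) (g x)) * frechet_derivative g (at x) v"
  show ?case
  proof (rule C_order_SucI[where f'="?D"])
    fix x
    have "(g has_derivative frechet_derivative g (at x)) (at x)"
      by (rule C_order_SucD(1)[OF Suc.prems])
    from has_derivative_compose[OF this F[OF g, unfolded has_field_derivative_def]]
    show "((\<lambda>x. F i (g x)) has_derivative ?D x) (at x)" .
  next
    fix v
    have gk: "C_order k g" using Suc.prems C_order_lower by blast
    have g': "C_order k (\<lambda>x. frechet_derivative g (at x) v)" by (rule C_order_SucD(2)[OF Suc.prems])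
    have "C_order k (\<lambda>x. a i * F (p i) (g x))" "C_order k (\<lambda>x. b i * F (q i) (g x))"
      by (rule C_order_linear[OF bounded_linear_mult_right Suc.IH[OF gk]])+
    then have "C_order k (\<lambda>x. a i * F (p i) (g x) + b i * F (q i) (g x))"
      by (rule C_order_add)
    then show "C_order k (\<lambda>x. ?D x v)"
      by (rule C_order_bilinear[OF bounded_bilinear_mult _ g'])
  qed
qed

section \<open>The flat exponential and smooth cutoffs\<close>

text \<open>\<open>flat 0\<close> is the classical smooth function exp(-1/u) continued by zero. The
  powers of 1/u are those produced by differentiating it, so that the family as a whole is closed
  under derivatives.\<close>

definition flat :: "nat \<Rightarrow> real \<Rightarrow> real" where
  "flat k u = (if u > 0 then exp (- inverse u) * inverse u ^ k else 0)"

lemma flat_tendsto_0: "(flat k \<longlongrightarrow> 0) (at 0)"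
proof -
  have "((\<lambda>s::real. s ^ k / exp s) \<longlongrightarrow> 0) at_top" by (rule tendsto_power_div_exp_0)
  then have "((\<lambda>u::real. inverse u ^ k / exp (inverse u)) \<longlongrightarrow> 0) (at_right 0)"
    by (rule filterlim_compose[OF _ filterlim_inverse_at_top_right])
  then have "(flat k \<longlongrightarrow> 0) (at_right 0)"
    by (rule Lim_transform_eventually)
       (rule eventually_at_rightI[of 0 1], simp_all add: flat_def exp_minus divide_inverse mult.commute)
  moreover have "(flat k \<longlongrightarrow> 0) (at_left 0)"
    by (rule tendsto_eventually, rule eventually_at_leftI[of "-1"]) (simp_all add: flat_def)
  ultimately show ?thesis by (simp add: filterlim_split_at)
qed

lemma DERIV_flat: "(flat k has_real_derivative (- real k) * flat (Suc k) u + 1 * flat (Suc (Suc k)) u) (at u)"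
proof (cases u "0::real" rule: linorder_cases)
  case less
  have "((\<lambda>_. 0) has_real_derivative 0) (at u)" by simp
  then have "(flat k has_real_derivative 0) (at u)"
    by (rule has_field_derivative_transform_within_open[where S="{..<0}"]) (use less in \<open>auto simp: flat_def\<close>)
  then show ?thesis using less by (simp add: flat_def)
next
  case equal
  \<comment> \<open>At the junction the difference quotient of \<open>flat k\<close> is
    \<open>flat (Suc k)\<close> itself, so differentiability there is the limit already known for
    the next member.\<close>
  have "((\<lambda>h. (flat k (0 + h) - flat k 0) / h) \<longlongrightarrow> 0) (at 0)"
    by (rule Lim_transform_eventually[OF flat_tendsto_0[of "Suc k"]])
       (simp add: flat_def divide_inverse eventually_at_filter mult_ac)
  then show ?thesis using equal by (simp add: DERIV_def flat_def)
next
  case greater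
  have "((\<lambda>u. exp (- inverse u) * inverse u ^ k) has_real_derivative
      (- real k) * flat (Suc k) u + 1 * flat (Suc (Suc k)) u) (at u)"
  proof -
    have "inverse u * (real k * inverse u ^ (k - Suc 0)) = real k * inverse u ^ k" by (cases k) auto
    then show ?thesis using greater by (auto intro!: derivative_eq_intros simp: flat_def)
  qed
  then show ?thesis
    by (rule has_field_derivative_transform_within_open[where S="{0<..}"]) (use greater in \<open>auto simp: flat_def\<close>)
qed

lemma C_order_flat: "C_order k g \<Longrightarrow> C_order k (\<lambda>x. flat i (g x))"
  using C_order_compose_family[of UNIV flat "\<lambda>k. - real k" Suc "\<lambda>_. 1" "\<lambda>k. Suc (Suc k)" g k i] DERIV_flat
  by blast

lemma C_order_powr:
  fixes g :: "'a::euclidean_space \<Rightarrow> real"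
  assumes "\<And>x. g x > 0" "C_order k g"
  shows "C_order k (\<lambda>x. g x powr c)"
proof -
  \<comment> \<open>On the positive reals the powers with exponents c - i form a family closed under
    differentiation; the unreduced application at index 0 exhibits the given power as a member of
    it.\<close>
  have "C_order k (\<lambda>x. (\<lambda>i s. s powr (c - real i)) 0 (g x))"
    by (rule C_order_compose_family[where S="{0<..}" and a="\<lambda>i. c - real i" and b="\<lambda>i. 0" and p=Suc])
       (use assms in \<open>auto intro!: derivative_eq_intros simp: algebra_simps\<close>)
  then show ?thesis by simp
qed

lemma C_order_inner_shift: "C_order k (\<lambda>x::'a::euclidean_space. (x - a) \<bullet> (x - a))"
  by (intro C_order_bilinear[OF bounded_bilinear_inner] C_order_shift)

lemma test_functionI:
  assumes "\<And>k. C_order k f" "\<And>x. norm x > r \<Longrightarrow> f x = 0"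
  shows "test_function f"
proof -
  have "support_on UNIV f \<subseteq> cball 0 r"
    using assms(2) by (force simp: support_on_def not_less[symmetric])
  then have "closure (support_on UNIV f) \<subseteq> cball 0 r" by (simp add: closure_minimal)
  then have "compact (closure (support_on UNIV f))"
    by (meson bounded_cball bounded_subset closed_closure compact_eq_bounded_closed)
  then show ?thesis using assms by (simp add: test_function_def)
qed

section \<open>Weak derivatives of locally Lipschitz functions\<close>

lemma lborel_integral_translate:
  fixes f :: "'a::euclidean_space \<Rightarrow> 'b::{banach, second_countable_topology}"
  assumes [measurable]: "f \<in> borel_measurable borel"
  shows "(LINT x|lborel. f (x + a)) = (LINT x|lborel. f x)"
proof -
  have "(LINT x|lborel. f x) = (LINT x|distr lborel borel (\<lambda>x. a + x). f x)"
    by (subst lborel_distr_plus) simp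
  also have "\<dots> = (LINT x|lborel. f (a + x))" by (rule integral_distr) auto
  finally show ?thesis by (simp add: add.commute)
qed

lemma lborel_integrable_translate:
  fixes f :: "'a::euclidean_space \<Rightarrow> 'b::{banach, second_countable_topology}"
  assumes "integrable lborel f"
  shows "integrable lborel (\<lambda>x. f (x + a))"
proof -
  have "integrable (distr lborel borel (\<lambda>x. a + x)) f"
    by (subst lborel_distr_plus) (rule assms)
  then have "integrable lborel (\<lambda>x. f (a + x))" by (rule integrable_distr[rotated]) auto
  then show ?thesis by (simp add: add.commute)
qed

lemma integrable_continuous_bounded_support:
  fixes f :: "'a::euclidean_space \<Rightarrow> 'b::{banach, second_countable_topology}"
  assumes "continuous_on UNIV f" "\<And>x. norm x > r \<Longrightarrow> f x = 0"
  shows "integrable lborel f"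
proof -
  have "integrable lborel (\<lambda>x. indicator (cball 0 r) x *\<^sub>R f x)"
    by (rule borel_integrable_compact) (auto intro: continuous_on_subset[OF assms(1)])
  moreover have "(\<lambda>x. indicator (cball 0 r) x *\<^sub>R f x) = f"
    using assms(2) by (auto simp: fun_eq_iff indicator_def dist_norm)
  ultimately show ?thesis by simp
qed

lemma bounded_continuous_bounded_support:
  fixes f :: "'a::euclidean_space \<Rightarrow> 'b::real_normed_vector"
  assumes "continuous_on UNIV f" "\<And>x. norm x > r \<Longrightarrow> f x = 0"
  obtains B where "B > 0" "\<And>x. norm (f x) \<le> B"
proof -
  have "bounded (f ` cball 0 r)"
    by (intro compact_imp_bounded compact_continuous_image continuous_on_subset[OF assms(1)]) auto
  then obtain B where "B > 0" and B: "\<And>x. x \<in> cball 0 r \<Longrightarrow> norm (f x) \<le> B"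
    unfolding bounded_pos by blast
  show thesis
  proof (rule that[OF \<open>B > 0\<close>])
    show "norm (f x) \<le> B" for x
      using B[of x] assms(2)[of x] \<open>B > 0\<close> by (cases "norm x > r") auto
  qed
qed

lemma directional_quotient_tendsto:
  fixes H :: "'a::real_normed_vector \<Rightarrow> real"
  assumes "((\<lambda>t. H (x + t *\<^sub>R v)) has_real_derivative d) (at 0)"
  shows "(\<lambda>n. (H (x + inverse (real (Suc n)) *\<^sub>R v) - H x) * real (Suc n)) \<longlonglongrightarrow> d"
proof -
  have "((\<lambda>h. (H (x + h *\<^sub>R v) - H x) / h) \<longlongrightarrow> d) (at 0)"
    using assms by (simp add: DERIV_def)
  then have "(\<lambda>n. (H (x + inverse (real (Suc n)) *\<^sub>R v) - H x) / inverse (real (Suc n))) \<longlonglongrightarrow> d"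
    by (rule filterlim_compose) (auto simp: filterlim_at LIMSEQ_inverse_real_of_nat simp del: of_nat_Suc)
  then show ?thesis by (simp add: field_simps)
qed

text \<open>Every difference quotient of H has integral zero by translation invariance, and the
  Lipschitz bound together with the bounded support lets dominated convergence carry this to the
  derivative.\<close>

lemma integral_directional_derivative_zero:
  fixes H :: "'a::euclidean_space \<Rightarrow> real"
  assumes cont: "continuous_on UNIV H"
    and supp: "\<And>x. norm x > r \<Longrightarrow> H x = 0"
    and lip: "\<And>x t. 0 \<le> t \<Longrightarrow> t \<le> 1 \<Longrightarrow> \<bar>H (x + t *\<^sub>R v) - H x\<bar> \<le> L * t"
    and deriv: "AE x in lborel. ((\<lambda>t. H (x + t *\<^sub>R v)) has_real_derivative D x) (at 0)"
    and D[measurable]: "D \<in> borel_measurable borel"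
  shows "integrable lborel D" and "(LINT x|lborel. D x) = 0"
proof -
  have [measurable]: "H \<in> borel_measurable borel"
    using cont by (rule borel_measurable_continuous_onI)
  define q where "q n x = (H (x + inverse (real (Suc n)) *\<^sub>R v) - H x) * real (Suc n)" for n x
  have [measurable]: "q n \<in> borel_measurable borel" for n unfolding q_def by measurable
  have H: "integrable lborel H" by (rule integrable_continuous_bounded_support[OF cont supp])
  have q0: "(LINT x|lborel. q n x) = 0" for n
    unfolding q_def
    by (simp add: Bochner_Integration.integral_diff lborel_integrable_translate[OF H] H lborel_integral_translate)
  have lim: "AE x in lborel. (\<lambda>n. q n x) \<longlonglongrightarrow> D x"
    using deriv by eventually_elim (simp add: q_def directional_quotient_tendsto del: of_nat_Suc)
  \<comment> \<open>Steps have length at most \<open>norm v\<close>, so beyond radius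
    \<open>r + norm v\<close> both points of the quotient lie outside the support.\<close>
  let ?w = "\<lambda>x. L * indicator (cball 0 (r + norm v)) x :: real"
  have w: "integrable lborel ?w"
    by (intro integrable_mult_right integrable_real_indicator) (auto simp: emeasure_lborel_cball_finite[unfolded infinity_ennreal_def])
  have bound: "AE x in lborel. norm (q n x) \<le> ?w x" for n
  proof (rule AE_I2)
    fix x
    let ?t = "inverse (real (Suc n))"
    have t: "0 \<le> ?t" "?t \<le> 1" by (auto simp: inverse_eq_divide)
    show "norm (q n x) \<le> ?w x"
    proof (cases "norm x \<le> r + norm v")
      case True
      have "\<bar>H (x + ?t *\<^sub>R v) - H x\<bar> * real (Suc n) \<le> L * ?t * real (Suc n)"
        by (intro mult_right_mono lip t) simp
      also have "\<dots> = L" by simp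
      finally show ?thesis using True by (simp add: q_def abs_mult dist_norm)
    next
      case False
      have "norm (?t *\<^sub>R v) \<le> norm v" using mult_right_mono[OF t(2), of "norm v"] by simp
      then have "norm (x + ?t *\<^sub>R v) > r"
        using False norm_triangle_ineq4[of "x + ?t *\<^sub>R v" "?t *\<^sub>R v"] by (simp del: of_nat_Suc)
      moreover have "norm x > r" using False by (smt (verit) norm_ge_zero)
      ultimately show ?thesis using False by (simp add: q_def supp dist_norm)
    qed
  qed
  show "integrable lborel D"
    by (rule integrable_dominated_convergence[OF _ _ w lim bound]) auto
  have "(\<lambda>n. LINT x|lborel. q n x) \<longlonglongrightarrow> (LINT x|lborel. D x)"
    by (rule integral_dominated_convergence[OF _ _ w lim bound]) auto
  then show "(LINT x|lborel. D x) = 0" by (simp add: q0 LIMSEQ_const_iff)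
qed

lemma bounded_support_derivative:
  fixes g :: "'a::euclidean_space \<Rightarrow> 'b::real_normed_vector"
  assumes "\<And>x. (g has_derivative g' x) (at x)" "\<And>x. norm x > r \<Longrightarrow> g x = 0" "norm x > r"
  shows "g' x v = 0"
proof -
  have "open {x::'a. norm x > r}" by (intro open_Collect_less continuous_intros)
  moreover have "((\<lambda>_. 0) has_derivative (\<lambda>_. 0)) (at x)" by simp
  ultimately have "(g has_derivative (\<lambda>_. 0)) (at x)"
    using has_derivative_transform_within_open[of "\<lambda>_. 0" "\<lambda>_. 0" x UNIV "{x. norm x > r}" g] assms(2,3)
    by auto
  then show ?thesis using has_derivative_unique[OF assms(1)] by metis
qed

lemma directional_has_real_derivative:
  fixes g :: "'a::real_normed_vector \<Rightarrow> real"
  assumes "(g has_derivative g') (at (x + s *\<^sub>R v))"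
  shows "((\<lambda>t. g (x + t *\<^sub>R v)) has_real_derivative g' v) (at s)"
proof -
  interpret bounded_linear g' using assms by (rule has_derivative_bounded_linear)
  have "((\<lambda>t. x + t *\<^sub>R v) has_derivative (\<lambda>t. t *\<^sub>R v)) (at s)"
    by (auto intro!: derivative_eq_intros)
  from has_derivative_compose[OF this assms]
  show ?thesis by (simp add: has_field_derivative_def scaleR mult_commute_abs)
qed

lemma directional_lipschitz:
  fixes g :: "'a::euclidean_space \<Rightarrow> real"
  assumes "\<And>x. (g has_derivative g' x) (at x)" "\<And>x. \<bar>g' x v\<bar> \<le> B"
  shows "\<bar>g (x + t *\<^sub>R v) - g x\<bar> \<le> B * \<bar>t\<bar>"
  using field_differentiable_bound[of UNIV "\<lambda>t. g (x + t *\<^sub>R v)" "\<lambda>s. g' (x + s *\<^sub>R v) v" B t 0]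
    directional_has_real_derivative[OF assms(1)] assms(2) by simp

text \<open>One constant per ball around the origin, rather than one per small neighbourhood: the
  integrands below have bounded support, and dominated convergence asks for a bound uniform on that
  support.\<close>

definition loc_lipschitz :: "('a::real_normed_vector \<Rightarrow> 'b::real_normed_vector) \<Rightarrow> bool" where
  "loc_lipschitz F \<longleftrightarrow> (\<forall>r. \<exists>L. L-lipschitz_on (cball 0 r) F)"

lemma loc_lipschitz_continuous:
  assumes "loc_lipschitz F" shows "continuous_on UNIV F"
proof -
  have "isCont F x" for x
  proof -
    obtain L where "L-lipschitz_on (cball 0 (norm x + 1)) F"
      using assms unfolding loc_lipschitz_def by blast
    then have "continuous_on (ball 0 (norm x + 1)) F"
      by (meson ball_subset_cball continuous_on_subset lipschitz_on_continuous_on)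
    then show ?thesis by (simp add: continuous_on_eq_continuous_at)
  qed
  then show ?thesis by (simp add: continuous_at_imp_continuous_on)
qed

text \<open>The product of F with g is continuous, of bounded support and Lipschitz in direction v,
  so its directional derivative integrates to zero. Differentiability of F almost everywhere is the
  form that fits potentials with a kink on a sphere.\<close>

lemma loc_lipschitz_integration_by_parts:
  fixes F :: "'a::euclidean_space \<Rightarrow> real"
  assumes F: "loc_lipschitz F" and F'[measurable]: "F' \<in> borel_measurable borel"
    and dF: "AE x in lborel. (F has_derivative (\<lambda>u. F' x \<bullet> u)) (at x)"
    and dg: "\<And>x. (g has_derivative g' x) (at x)"
    and g': "continuous_on UNIV (\<lambda>x. g' x v)"
    and supp: "\<And>x. norm x > r \<Longrightarrow> g x = 0"
  shows "integrable lborel (\<lambda>x. (F' x \<bullet> v) * g x)"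
    and "integrable lborel (\<lambda>x. F x * g' x v)"
    and "(LINT x|lborel. (F' x \<bullet> v) * g x) = - (LINT x|lborel. F x * g' x v)"
proof -
  have cF: "continuous_on UNIV F" by (rule loc_lipschitz_continuous[OF F])
  have cg: "continuous_on UNIV g"
    by (intro continuous_at_imp_continuous_on ballI has_derivative_continuous[OF dg])
  have supp': "g' x v = 0" if "norm x > r" for x
    by (rule bounded_support_derivative[OF dg supp that])
  have [measurable]: "F \<in> borel_measurable borel" "g \<in> borel_measurable borel" "(\<lambda>x. g' x v) \<in> borel_measurable borel"
    using cF cg g' by (auto intro: borel_measurable_continuous_onI)
  obtain B where B: "B > 0" "\<And>x. norm (g x) \<le> B"
    by (rule bounded_continuous_bounded_support[OF cg supp]) auto
  obtain B' where B': "B' > 0" "\<And>x. norm (g' x v) \<le> B'"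
    by (rule bounded_continuous_bounded_support[OF g' supp']) auto
  \<comment> \<open>An increment can be nonzero only if \<open>norm x \<le> r + norm v\<close>, and
    the shifted point may lie another \<open>norm v\<close> further out; on this ball one Lipschitz
    constant and one bound for F serve all t in [0, 1].\<close>
  let ?\<rho> = "max 0 (r + 2 * norm v)"
  obtain L where L: "L-lipschitz_on (cball 0 ?\<rho>) F"
    using F unfolding loc_lipschitz_def by blast
  have "bounded (F ` cball 0 ?\<rho>)"
    by (intro compact_imp_bounded compact_continuous_image continuous_on_subset[OF cF]) auto
  then obtain C where "C > 0" and C: "\<And>x. x \<in> cball 0 ?\<rho> \<Longrightarrow> \<bar>F x\<bar> \<le> C"
    unfolding bounded_pos by auto
  let ?H = "\<lambda>x. F x * g x" and ?D = "\<lambda>x. (F' x \<bullet> v) * g x + F x * g' x v"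
  have lip: "\<bar>?H (x + t *\<^sub>R v) - ?H x\<bar> \<le> (C * B' + B * (L * norm v)) * t" if t: "0 \<le> t" "t \<le> 1" for x t
  proof -
    have tv: "norm (t *\<^sub>R v) \<le> norm v" using mult_right_mono[OF t(2), of "norm v"] t by simp
    show ?thesis
    proof (cases "norm x \<le> r + norm v")
      case True
      then have "norm x \<le> r + 2 * norm v" "norm (x + t *\<^sub>R v) \<le> r + 2 * norm v"
        using norm_triangle_ineq[of x "t *\<^sub>R v"] tv norm_ge_zero[of v] by linarith+
      then have in1: "x \<in> cball 0 ?\<rho>" "x + t *\<^sub>R v \<in> cball 0 ?\<rho>" by simp_all
      have "?H (x + t *\<^sub>R v) - ?H x = F (x + t *\<^sub>R v) * (g (x + t *\<^sub>R v) - g x) + g x * (F (x + t *\<^sub>R v) - F x)"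
        by (simp add: algebra_simps)
      also have "\<bar>\<dots>\<bar> \<le> C * (B' * \<bar>t\<bar>) + B * (L * norm (t *\<^sub>R v))"
      proof (rule order_trans[OF abs_triangle_ineq], unfold abs_mult, intro add_mono mult_mono)
        show "\<bar>F (x + t *\<^sub>R v)\<bar> \<le> C" using C in1 by blast
        show "\<bar>g (x + t *\<^sub>R v) - g x\<bar> \<le> B' * \<bar>t\<bar>"
          using directional_lipschitz[OF dg] B' by simp
        show "\<bar>g x\<bar> \<le> B" using B by simp
        show "\<bar>F (x + t *\<^sub>R v) - F x\<bar> \<le> L * norm (t *\<^sub>R v)"
          using lipschitz_onD[OF L in1(2) in1(1)] by (simp add: dist_norm)
      qed (use \<open>C > 0\<close> B in auto)
      also have "\<dots> = (C * B' + B * (L * norm v)) * t" using t by (simp add: algebra_simps)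
      finally show ?thesis .
    next
      case False
      then have "norm (x + t *\<^sub>R v) > r"
        using tv norm_triangle_ineq4[of "x + t *\<^sub>R v" "t *\<^sub>R v"] by simp
      moreover have "norm x > r" using False by (smt (verit) norm_ge_zero)
      ultimately show ?thesis
        using t \<open>C > 0\<close> B B' lipschitz_on_nonneg[OF L] by (simp add: supp)
    qed
  qed
  have d: "AE x in lborel. ((\<lambda>t. ?H (x + t *\<^sub>R v)) has_real_derivative ?D x) (at 0)"
    using dF
  proof eventually_elim
    case (elim x)
    then have "((\<lambda>t. F (x + t *\<^sub>R v)) has_real_derivative F' x \<bullet> v) (at 0)"
      by (intro directional_has_real_derivative) simp
    moreover have "((\<lambda>t. g (x + t *\<^sub>R v)) has_real_derivative g' x v) (at 0)"
      using dg[of x] by (intro directional_has_real_derivative) simp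
    ultimately show ?case by (rule DERIV_mult'[THEN DERIV_cong]) simp
  qed
  have D: "integrable lborel ?D" "(LINT x|lborel. ?D x) = 0"
    by (rule integral_directional_derivative_zero[OF _ _ lip d, where r=r];
        use supp cF cg in \<open>simp add: continuous_on_mult\<close>)+
  show I2: "integrable lborel (\<lambda>x. F x * g' x v)"
    by (rule integrable_continuous_bounded_support[where r=r]) (use supp' cF g' in \<open>auto intro: continuous_on_mult\<close>)
  show I1: "integrable lborel (\<lambda>x. (F' x \<bullet> v) * g x)"
    using Bochner_Integration.integrable_diff[OF D(1) I2] by simp
  show "(LINT x|lborel. (F' x \<bullet> v) * g x) = - (LINT x|lborel. F x * g' x v)"
    using D(2) I1 I2 by simp
qed

text \<open>The directional derivative is a limit of difference quotients with steps at most
  \<open>norm v\<close>, each bounded by the Lipschitz constant of the ball enlarged by that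
  length.\<close>

lemma loc_lipschitz_gradient_bound:
  fixes F :: "'a::euclidean_space \<Rightarrow> real"
  assumes "loc_lipschitz F" "AE x in lborel. (F has_derivative (\<lambda>u. F' x \<bullet> u)) (at x)"
  obtains C where "C \<ge> 0" "AE x in lborel. norm x \<le> r \<longrightarrow> \<bar>F' x \<bullet> v\<bar> \<le> C"
proof -
  obtain L where L: "L-lipschitz_on (cball 0 (r + norm v)) F"
    using assms(1) unfolding loc_lipschitz_def by blast
  show thesis
  proof (rule that[of "L * norm v"])
    show "L * norm v \<ge> 0" using lipschitz_on_nonneg[OF L] by simp
    show "AE x in lborel. norm x \<le> r \<longrightarrow> \<bar>F' x \<bullet> v\<bar> \<le> L * norm v"
      using assms(2)
    proof eventually_elim
      case (elim x)
      show ?case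
      proof
        assume x: "norm x \<le> r"
        have "(\<lambda>n. \<bar>(F (x + inverse (real (Suc n)) *\<^sub>R v) - F x) * real (Suc n)\<bar>) \<longlonglongrightarrow> \<bar>F' x \<bullet> v\<bar>"
          by (intro tendsto_rabs directional_quotient_tendsto directional_has_real_derivative)
             (use elim in simp)
        moreover have "\<bar>(F (x + inverse (real (Suc n)) *\<^sub>R v) - F x) * real (Suc n)\<bar> \<le> L * norm v" for n
        proof -
          let ?t = "inverse (real (Suc n))"
          have t: "0 \<le> ?t" "?t \<le> 1" by (auto simp: inverse_eq_divide)
          have "norm (?t *\<^sub>R v) \<le> norm v" using mult_right_mono[OF t(2), of "norm v"] by simp
          then have "x + ?t *\<^sub>R v \<in> cball 0 (r + norm v)" "x \<in> cball 0 (r + norm v)"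
            using x norm_triangle_ineq[of x "?t *\<^sub>R v"] by (auto simp del: of_nat_Suc) (smt (verit) norm_ge_zero)
          from lipschitz_onD[OF L this] have "\<bar>F (x + ?t *\<^sub>R v) - F x\<bar> \<le> L * norm (?t *\<^sub>R v)"
            by (simp add: dist_norm del: of_nat_Suc)
          then have "\<bar>F (x + ?t *\<^sub>R v) - F x\<bar> * real (Suc n) \<le> L * norm (?t *\<^sub>R v) * real (Suc n)"
            by (rule mult_right_mono) simp
          also have "\<dots> = (L * norm v) * (?t * real (Suc n))" by simp
          also have "\<dots> = L * norm v" by simp
          finally show ?thesis by (simp add: abs_mult)
        qed
        ultimately show "\<bar>F' x \<bullet> v\<bar> \<le> L * norm v"
          by (intro Lim_bounded[where M=0]) auto
      qed
    qed
  qed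
qed

text \<open>Moving a difference quotient of \<open>F\<close> in direction \<open>v\<close> onto \<open>g\<close> before integrating by parts in
  direction \<open>w\<close> avoids the symmetry of second derivatives.\<close>

lemma loc_lipschitz_gradient_commute:
  fixes F :: "'a::euclidean_space \<Rightarrow> real"
  assumes F: "loc_lipschitz F" and F'[measurable]: "F' \<in> borel_measurable borel"
    and dF: "AE x in lborel. (F has_derivative (\<lambda>u. F' x \<bullet> u)) (at x)"
    and dg: "\<And>x. (g has_derivative g' x) (at x)"
    and g': "\<And>v. continuous_on UNIV (\<lambda>x. g' x v)"
    and supp: "\<And>x. norm x > r \<Longrightarrow> g x = 0"
  shows "(LINT x|lborel. (F' x \<bullet> v) * g' x w) = (LINT x|lborel. (F' x \<bullet> w) * g' x v)"
proof -
  define \<rho> where "\<rho> = max 0 r + norm v"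
  have \<rho>: "norm v \<le> \<rho>" "0 \<le> \<rho>" "r \<le> \<rho>" unfolding \<rho>_def using norm_ge_zero[of v] by linarith+
  have cF: "continuous_on UNIV F" by (rule loc_lipschitz_continuous[OF F])
  have cg: "continuous_on UNIV g"
    by (intro continuous_at_imp_continuous_on ballI has_derivative_continuous[OF dg])
  have supp': "g' x u = 0" if "norm x > r" for x u
    by (rule bounded_support_derivative[OF dg supp that])
  have [measurable]: "F \<in> borel_measurable borel" "g \<in> borel_measurable borel" "(\<lambda>x. g' x u) \<in> borel_measurable borel" for u
    using cF cg g' by (auto intro: borel_measurable_continuous_onI)
  have g'_minus: "g' x (- u) = - g' x u" for x u
    using linear_neg[OF has_derivative_linear[OF dg]] .
  obtain Bv where Bv: "Bv > 0" "\<And>x. norm (g' x v) \<le> Bv"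
    by (rule bounded_continuous_bounded_support[OF g' supp']) auto
  obtain Bw where Bw: "Bw > 0" "\<And>x. norm (g' x w) \<le> Bw"
    by (rule bounded_continuous_bounded_support[OF g' supp']) auto
  obtain L where L: "L-lipschitz_on (cball 0 (\<rho> + norm v)) F"
    using F unfolding loc_lipschitz_def by blast
  have L0: "0 \<le> L" by (rule lipschitz_on_nonneg[OF L])
  obtain C where C: "C \<ge> 0" "AE x in lborel. norm x \<le> \<rho> \<longrightarrow> \<bar>F' x \<bullet> w\<bar> \<le> C"
    by (rule loc_lipschitz_gradient_bound[OF F dF])
  define t where "t n = inverse (real (Suc n))" for n
  have t: "0 < t n" "t n \<le> 1" "t n * real (Suc n) = 1" for n unfolding t_def by (auto simp: inverse_eq_divide)
  have tv: "norm (t n *\<^sub>R v) \<le> norm v" for n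
    using mult_right_mono[OF t(2), of "norm v"] t(1)[of n] by simp
  define q where "q n x = (F (x + t n *\<^sub>R v) - F x) * real (Suc n) * g' x w" for n x
  \<comment> \<open>The quotient of g for the backward step. It tends to minus the v-derivative, and
    this sign cancels the one from integrating by parts in direction w.\<close>
  define p where "p n x = (g (x - t n *\<^sub>R v) - g x) * real (Suc n)" for n x
  have [measurable]: "q n \<in> borel_measurable borel" "p n \<in> borel_measurable borel" for n
    unfolding q_def p_def by measurable
  have suppp: "p n x = 0" if "norm x > \<rho>" for n x
  proof -
    have "norm (x - t n *\<^sub>R v) > r"
      using norm_triangle_sub[of x "t n *\<^sub>R v"] tv[of n] that unfolding \<rho>_def by linarith
    moreover have "norm x > r" using that \<rho> by linarith
    ultimately show ?thesis by (simp add: p_def supp)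
  qed
  have int_ind: "integrable lborel (\<lambda>x::'a. K * indicator (cball 0 \<rho>) x :: real)" for K
    by (intro integrable_mult_right integrable_real_indicator) (auto simp: emeasure_lborel_cball_finite[unfolded infinity_ennreal_def])
  have limq: "AE x in lborel. (\<lambda>n. q n x) \<longlonglongrightarrow> (F' x \<bullet> v) * g' x w"
    using dF
  proof eventually_elim
    case (elim x)
    show ?case unfolding q_def t_def
      by (intro tendsto_mult_right directional_quotient_tendsto directional_has_real_derivative)
         (use elim in simp)
  qed
  have boundq: "AE x in lborel. norm (q n x) \<le> (L * norm v * Bw) * indicator (cball 0 \<rho>) x" for n
  proof (rule AE_I2)
    fix x
    show "norm (q n x) \<le> (L * norm v * Bw) * indicator (cball 0 \<rho>) x"
    proof (cases "norm x \<le> \<rho>")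
      case True
      then have "norm (x + t n *\<^sub>R v) \<le> \<rho> + norm v" "norm x \<le> \<rho> + norm v"
        using norm_triangle_ineq[of x "t n *\<^sub>R v"] tv[of n] norm_ge_zero[of v] by linarith+
      then have "x + t n *\<^sub>R v \<in> cball 0 (\<rho> + norm v)" "x \<in> cball 0 (\<rho> + norm v)" by simp_all
      from lipschitz_onD[OF L this] have "\<bar>F (x + t n *\<^sub>R v) - F x\<bar> \<le> L * norm (t n *\<^sub>R v)"
        by (simp add: dist_norm)
      then have "\<bar>F (x + t n *\<^sub>R v) - F x\<bar> * real (Suc n) \<le> L * norm (t n *\<^sub>R v) * real (Suc n)"
        by (rule mult_right_mono) simp
      also have "\<dots> = (L * norm v) * (t n * real (Suc n))"
        using t(1)[of n] by simp
      also have "\<dots> = L * norm v" by (simp only: t(3) mult_1_right)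
      finally have "\<bar>F (x + t n *\<^sub>R v) - F x\<bar> * real (Suc n) * \<bar>g' x w\<bar> \<le> L * norm v * Bw"
        using Bw(2)[of x] L0 by (intro mult_mono[of "_ * _"]) auto
      then show ?thesis using True by (simp add: q_def abs_mult)
    next
      case False
      then show ?thesis using \<rho> by (simp add: q_def supp')
    qed
  qed
  have limp: "(\<lambda>n. p n x) \<longlonglongrightarrow> - g' x v" for x
  proof -
    have "(\<lambda>n. (g (x + t n *\<^sub>R - v) - g x) * real (Suc n)) \<longlonglongrightarrow> g' x (- v)"
      unfolding t_def
      by (intro directional_quotient_tendsto directional_has_real_derivative) (use dg[of x] in simp)
    then show ?thesis by (simp add: p_def g'_minus)
  qed
  have boundp: "\<bar>p n x\<bar> \<le> Bv" for n x
  proof -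
    have "\<bar>g (x + t n *\<^sub>R - v) - g x\<bar> \<le> Bv * \<bar>t n\<bar>"
      by (rule directional_lipschitz[OF dg]) (use Bv in \<open>simp add: g'_minus\<close>)
    then have "\<bar>g (x - t n *\<^sub>R v) - g x\<bar> * real (Suc n) \<le> Bv * t n * real (Suc n)"
      using t(1)[of n] by (intro mult_right_mono) auto
    also have "\<dots> = Bv" using t(3)[of n] by (simp only: mult.assoc mult_1_right)
    finally show ?thesis by (simp add: p_def abs_mult)
  qed
  have dp: "(p n has_derivative (\<lambda>u. (g' (x - t n *\<^sub>R v) u - g' x u) * real (Suc n))) (at x)" for n x
  proof -
    have "((\<lambda>x. x - t n *\<^sub>R v) has_derivative (\<lambda>u. u)) (at x)"
      by (auto intro!: derivative_eq_intros)
    from has_derivative_compose[OF this dg]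
    have "((\<lambda>x. g (x - t n *\<^sub>R v)) has_derivative g' (x - t n *\<^sub>R v)) (at x)" .
    then show ?thesis unfolding p_def by (intro has_derivative_mult_left has_derivative_diff dg)
  qed
  have cshift: "continuous_on UNIV (\<lambda>x. g' (x - t n *\<^sub>R v) u)" for n u
    by (rule continuous_on_compose2[OF g']) (auto intro: continuous_intros)
  \<comment> \<open>Translation carries the quotient from F to the w-derivative of g. Quotients
    commute with derivatives, so the result is the w-derivative of \<open>p n\<close>, ready for
    integration by parts.\<close>
  have eq: "(LINT x|lborel. q n x) = - (LINT x|lborel. (F' x \<bullet> w) * p n x)" for n
  proof -
    let ?s = "t n *\<^sub>R v"
    have i1: "integrable lborel (\<lambda>x. F x * g' x w)"
      by (rule integrable_continuous_bounded_support[where r=r])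
         (use supp' cF g' in \<open>auto intro: continuous_on_mult\<close>)
    have i2: "integrable lborel (\<lambda>x. F x * g' (x - ?s) w)"
    proof (rule integrable_continuous_bounded_support[where r=\<rho>])
      show "F x * g' (x - ?s) w = 0" if "norm x > \<rho>" for x
      proof -
        have "norm (x - ?s) > r"
          using norm_triangle_sub[of x ?s] tv[of n] that unfolding \<rho>_def by linarith
        then show ?thesis by (simp add: supp')
      qed
    qed (intro continuous_on_mult cF cshift)
    have i3: "integrable lborel (\<lambda>x. F (x + ?s) * g' x w)"
      using lborel_integrable_translate[OF i2, of ?s] by simp
    have e: "(LINT x|lborel. F (x + ?s) * g' x w) = (LINT x|lborel. F x * g' (x - ?s) w)"
      using lborel_integral_translate[of "\<lambda>x. F x * g' (x - ?s) w" ?s] by simp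
    have "(LINT x|lborel. q n x) = (LINT x|lborel. (F (x + ?s) * g' x w - F x * g' x w) * real (Suc n))"
      unfolding q_def by (simp add: algebra_simps)
    also have "\<dots> = (LINT x|lborel. (F x * g' (x - ?s) w - F x * g' x w) * real (Suc n))"
      by (simp only: Bochner_Integration.integral_diff[OF i3 i1] Bochner_Integration.integral_diff[OF i2 i1] e
          integral_mult_left_zero)
    also have "\<dots> = (LINT x|lborel. F x * ((g' (x - ?s) w - g' x w) * real (Suc n)))"
      by (simp add: algebra_simps)
    also have "\<dots> = - (LINT x|lborel. (F' x \<bullet> w) * p n x)"
      using loc_lipschitz_integration_by_parts(3)[OF F F' dF dp _ suppp, of n w]
      by (simp add: continuous_on_mult continuous_on_diff g' cshift)
    finally show ?thesis .
  qed
  have "(\<lambda>n. LINT x|lborel. q n x) \<longlonglongrightarrow> (LINT x|lborel. (F' x \<bullet> v) * g' x w)"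
    by (rule integral_dominated_convergence[OF _ _ int_ind limq boundq]) auto
  moreover have "(\<lambda>n. LINT x|lborel. (F' x \<bullet> w) * p n x) \<longlonglongrightarrow> (LINT x|lborel. (F' x \<bullet> w) * - g' x v)"
  proof (rule integral_dominated_convergence[OF _ _ int_ind[of "C * Bv"]])
    show "AE x in lborel. (\<lambda>n. (F' x \<bullet> w) * p n x) \<longlonglongrightarrow> (F' x \<bullet> w) * - g' x v"
      by (intro AE_I2 tendsto_mult_left limp)
    show "AE x in lborel. norm ((F' x \<bullet> w) * p n x) \<le> C * Bv * indicator (cball 0 \<rho>) x" for n
      using C(2)
    proof eventually_elim
      case (elim x)
      show ?case
      proof (cases "norm x \<le> \<rho>")
        case True
        then have "\<bar>F' x \<bullet> w\<bar> * \<bar>p n x\<bar> \<le> C * Bv"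
          using elim boundp C(1) by (intro mult_mono) auto
        then show ?thesis using True by (simp add: abs_mult)
      qed (simp add: suppp)
    qed
  qed auto
  ultimately have "(LINT x|lborel. (F' x \<bullet> v) * g' x w) = - (LINT x|lborel. (F' x \<bullet> w) * - g' x v)"
    unfolding eq using LIMSEQ_unique tendsto_minus by blast
  then show ?thesis by simp
qed

section \<open>Closure properties of locally Lipschitz functions\<close>

lemma loc_lipschitz_const: "loc_lipschitz (\<lambda>x. c)"
  unfolding loc_lipschitz_def using lipschitz_on_constant by blast

lemma loc_lipschitz_linear: "bounded_linear f \<Longrightarrow> loc_lipschitz f"
  unfolding loc_lipschitz_def by (metis bounded_linear.lipschitz_boundE lipschitz_on_subset subset_UNIV)

lemma loc_lipschitz_add: "loc_lipschitz f \<Longrightarrow> loc_lipschitz g \<Longrightarrow> loc_lipschitz (\<lambda>x. f x + g x)"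
  unfolding loc_lipschitz_def by (metis lipschitz_on_add)

lemma loc_lipschitz_bounded_image:
  fixes f :: "'a::real_normed_vector \<Rightarrow> 'b::real_normed_vector"
  assumes "loc_lipschitz f"
  obtains B where "B \<ge> 0" "f ` cball 0 r \<subseteq> cball 0 B"
proof -
  obtain L where L: "L-lipschitz_on (cball 0 r) f" using assms unfolding loc_lipschitz_def by blast
  show thesis
  proof (rule that[of "norm (f 0) + L * \<bar>r\<bar>"])
    show "norm (f 0) + L * \<bar>r\<bar> \<ge> 0" using lipschitz_on_nonneg[OF L] by simp
    show "f ` cball 0 r \<subseteq> cball 0 (norm (f 0) + L * \<bar>r\<bar>)"
    proof clarify
      fix x :: 'a assume x: "x \<in> cball 0 r"
      then have "0 \<le> r" using norm_ge_zero[of x] by (simp add: dist_norm) (meson norm_ge_zero order_trans)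
      then have "0 \<in> cball (0::'a) r" by simp
      from lipschitz_onD[OF L x this] have "norm (f x - f 0) \<le> L * norm x" by (simp add: dist_norm)
      also have "\<dots> \<le> L * \<bar>r\<bar>" using x lipschitz_on_nonneg[OF L] by (intro mult_left_mono) auto
      finally show "f x \<in> cball 0 (norm (f 0) + L * \<bar>r\<bar>)"
        using norm_triangle_sub[of "f x" "f 0"] by simp
    qed
  qed
qed

text \<open>The inner function maps a ball into some larger ball, on which the outer function has a
  single constant; this is where having constants on arbitrarily large balls pays off.\<close>

lemma loc_lipschitz_compose:
  fixes f :: "'b::real_normed_vector \<Rightarrow> 'c::real_normed_vector" and g :: "'a::real_normed_vector \<Rightarrow> 'b::real_normed_vector"
  assumes "loc_lipschitz f" "loc_lipschitz g"
  shows "loc_lipschitz (\<lambda>x. f (g x))"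
  unfolding loc_lipschitz_def
proof
  fix r
  obtain B where "g ` cball 0 r \<subseteq> cball 0 B" by (rule loc_lipschitz_bounded_image[OF assms(2)])
  moreover obtain L where "L-lipschitz_on (cball 0 B) f" using assms(1) unfolding loc_lipschitz_def by blast
  ultimately have "L-lipschitz_on (g ` cball 0 r) f" by (rule lipschitz_on_subset[rotated])
  moreover obtain M where "M-lipschitz_on (cball 0 r) g" using assms(2) unfolding loc_lipschitz_def by blast
  ultimately show "\<exists>L. L-lipschitz_on (cball 0 r) (\<lambda>x. f (g x))"
    using lipschitz_on_compose2 by blast
qed

lemma loc_lipschitz_mult:
  fixes f g :: "'a::real_normed_vector \<Rightarrow> real"
  assumes "loc_lipschitz f" "loc_lipschitz g"
  shows "loc_lipschitz (\<lambda>x. f x * g x)"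
  unfolding loc_lipschitz_def
proof
  fix r
  obtain A where A: "A \<ge> 0" "f ` cball 0 r \<subseteq> cball 0 A" by (rule loc_lipschitz_bounded_image[OF assms(1)])
  obtain B where B: "B \<ge> 0" "g ` cball 0 r \<subseteq> cball 0 B" by (rule loc_lipschitz_bounded_image[OF assms(2)])
  obtain L where L: "L-lipschitz_on (cball 0 r) f" using assms(1) unfolding loc_lipschitz_def by blast
  obtain M where M: "M-lipschitz_on (cball 0 r) g" using assms(2) unfolding loc_lipschitz_def by blast
  have "(A * M + B * L)-lipschitz_on (cball 0 r) (\<lambda>x. f x * g x)"
  proof (rule lipschitz_onI)
    show "0 \<le> A * M + B * L" using A B lipschitz_on_nonneg[OF L] lipschitz_on_nonneg[OF M] by simp
    fix x y :: 'a assume xy: "x \<in> cball 0 r" "y \<in> cball 0 r"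
    have "f x * g x - f y * g y = f x * (g x - g y) + g y * (f x - f y)" by (simp add: algebra_simps)
    also have "\<bar>\<dots>\<bar> \<le> A * (M * dist x y) + B * (L * dist x y)"
    proof (rule order_trans[OF abs_triangle_ineq], unfold abs_mult, intro add_mono mult_mono)
      have "f x \<in> cball 0 A" "g y \<in> cball 0 B" using A(2) B(2) xy by blast+
      then show "\<bar>f x\<bar> \<le> A" "\<bar>g y\<bar> \<le> B" by simp_all
      show "\<bar>g x - g y\<bar> \<le> M * dist x y" using lipschitz_onD[OF M xy] by (simp add: dist_real_def)
      show "\<bar>f x - f y\<bar> \<le> L * dist x y" using lipschitz_onD[OF L xy] by (simp add: dist_real_def)
    qed (use A B in auto)
    finally show "dist (f x * g x) (f y * g y) \<le> (A * M + B * L) * dist x y"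
      by (simp add: dist_real_def algebra_simps)
  qed
  then show "\<exists>L. L-lipschitz_on (cball 0 r) (\<lambda>x. f x * g x)" by blast
qed

lemma loc_lipschitz_sum:
  assumes "finite A" "\<And>i. i \<in> A \<Longrightarrow> loc_lipschitz (f i)"
  shows "loc_lipschitz (\<lambda>x. \<Sum>i\<in>A. f i x)"
  using assms by (induction rule: finite_induct) (auto intro!: loc_lipschitz_const loc_lipschitz_add)

lemma loc_lipschitz_inner_self: "loc_lipschitz (\<lambda>x::'a::euclidean_space. x \<bullet> x)"
  by (subst euclidean_inner)
     (intro loc_lipschitz_sum loc_lipschitz_mult loc_lipschitz_linear bounded_linear_inner_left finite_Basis)

lemma lipschitz_on_interval_C1:
  fixes p :: "real \<Rightarrow> real"
  assumes "\<And>s. s \<in> {a..b} \<Longrightarrow> (p has_real_derivative p' s) (at s)" "continuous_on {a..b} p'"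
  shows "\<exists>L. L-lipschitz_on {a..b} p"
proof -
  have "bounded (p' ` {a..b})" by (intro compact_imp_bounded compact_continuous_image assms compact_Icc)
  then obtain L where "L > 0" and L: "\<And>s. s \<in> {a..b} \<Longrightarrow> \<bar>p' s\<bar> \<le> L" unfolding bounded_pos by auto
  have "L-lipschitz_on {a..b} p"
  proof (rule lipschitz_onI)
    show "dist (p x) (p y) \<le> L * dist x y" if "x \<in> {a..b}" "y \<in> {a..b}" for x y
      unfolding dist_norm
      by (rule field_differentiable_bound[OF _ _ _ that])
         (use L assms(1) in \<open>auto intro: has_field_derivative_at_within\<close>)
  qed (use \<open>L > 0\<close> in simp)
  then show ?thesis by blast
qed

text \<open>Each piece is continuously differentiable up to and including the junction, hence
  Lipschitz on compact intervals on its own side. Since the values match at S, the larger constant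
  works across it, whatever the two slopes are.\<close>

lemma loc_lipschitz_piecewise_C1:
  fixes p q :: "real \<Rightarrow> real"
  assumes p: "\<And>s. s \<le> S \<Longrightarrow> (p has_real_derivative p' s) (at s)" "continuous_on {..S} p'"
    and q: "\<And>s. s \<ge> S \<Longrightarrow> (q has_real_derivative q' s) (at s)" "continuous_on {S..} q'"
    and "p S = q S"
  shows "loc_lipschitz (\<lambda>s. if s \<le> S then p s else q s)"
  unfolding loc_lipschitz_def
proof
  fix r :: real
  define a where "a = min S (- r)"
  define b where "b = max S r"
  obtain L where L: "L-lipschitz_on {a..S} p"
    using lipschitz_on_interval_C1[of a S p p'] p continuous_on_subset[OF p(2), of "{a..S}"] by auto
  obtain M where M: "M-lipschitz_on {S..b} q"
    using lipschitz_on_interval_C1[of S b q q'] q continuous_on_subset[OF q(2), of "{S..b}"] by auto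
  have "(max L M)-lipschitz_on {a..b} (\<lambda>s. if s \<le> S then p s else q s)"
    by (rule lipschitz_on_concat_max[OF L M]) (use assms in auto)
  moreover have "cball 0 r \<subseteq> {a..b}" by (auto simp: a_def b_def)
  ultimately show "\<exists>L. L-lipschitz_on (cball 0 r) (\<lambda>s. if s \<le> S then p s else q s)"
    using lipschitz_on_subset by blast
qed

section \<open>Distributional curl of gradients and divergence of curls\<close>

lemma loc_lipschitz_gradient_integrable:
  fixes F :: "'a::euclidean_space \<Rightarrow> real"
  assumes F: "loc_lipschitz F" and [measurable]: "F' \<in> borel_measurable borel"
    and dF: "AE x in lborel. (F has_derivative (\<lambda>u. F' x \<bullet> u)) (at x)"
    and k: "continuous_on UNIV k" and supp: "\<And>x. norm x > r \<Longrightarrow> k x = 0"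
  shows "integrable lborel (\<lambda>x. (F' x \<bullet> v) * k x)"
proof -
  obtain C where C: "C \<ge> 0" "AE x in lborel. norm x \<le> r \<longrightarrow> \<bar>F' x \<bullet> v\<bar> \<le> C"
    by (rule loc_lipschitz_gradient_bound[OF F dF])
  have [measurable]: "k \<in> borel_measurable borel" by (rule borel_measurable_continuous_onI[OF k])
  have i: "integrable lborel (\<lambda>x. C * k x)"
    by (intro integrable_mult_right integrable_continuous_bounded_support[OF k supp])
  have ae: "AE x in lborel. norm ((F' x \<bullet> v) * k x) \<le> norm (C * k x)"
    using C(2)
  proof eventually_elim
    case (elim x)
    show ?case
    proof (cases "norm x \<le> r")
      case True
      then show ?thesis using elim C(1) by (simp add: abs_mult mult_right_mono)
    qed (simp add: supp)
  qed
  have "(\<lambda>x. (F' x \<bullet> v) * k x) \<in> borel_measurable lborel" by measurable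
  then show ?thesis by (rule Bochner_Integration.integrable_bound[OF i _ ae])
qed

lemma test_functionD:
  assumes "test_function f"
  obtains r where "\<And>x. (f has_derivative frechet_derivative f (at x)) (at x)"
    "\<And>v. continuous_on UNIV (\<lambda>x. frechet_derivative f (at x) v)"
    "\<And>x. norm x > r \<Longrightarrow> f x = 0"
proof -
  have C: "C_order (Suc 0) f" using assms unfolding test_function_def by blast
  have "bounded (closure (support_on UNIV f))"
    using assms unfolding test_function_def by (blast intro: compact_imp_bounded)
  then have "bounded (support_on UNIV f)" by (rule bounded_subset) (rule closure_subset)
  then obtain r where r: "\<And>x. x \<in> support_on UNIV f \<Longrightarrow> norm x \<le> r" unfolding bounded_iff by blast
  show thesis
  proof (rule that)
    show "(f has_derivative frechet_derivative f (at x)) (at x)" for x by (rule C_order_SucD(1)[OF C])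
    show "continuous_on UNIV (\<lambda>x. frechet_derivative f (at x) v)" for v
      using C_order_SucD(2)[OF C, of v] by simp
    show "f x = 0" if "norm x > r" for x using r[of x] that by (force simp: support_on_def)
  qed
qed

lemma loc_lipschitz_gradient_commute_vanish:
  fixes F :: "'a::euclidean_space \<Rightarrow> real"
  assumes F: "loc_lipschitz F" and F': "F' \<in> borel_measurable borel"
    and dF: "AE x in lborel. (F has_derivative (\<lambda>u. F' x \<bullet> u)) (at x)"
    and dg: "\<And>x. (g has_derivative g' x) (at x)"
    and g': "\<And>v. continuous_on UNIV (\<lambda>x. g' x v)"
    and supp: "\<And>x. norm x > r \<Longrightarrow> g x = 0"
  shows "has_bochner_integral lborel (\<lambda>x. (F' x \<bullet> v) * g' x w - (F' x \<bullet> w) * g' x v) 0"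
proof -
  note I = loc_lipschitz_gradient_integrable[OF F F' dF g' bounded_support_derivative[OF dg supp]]
  have "(LINT x|lborel. (F' x \<bullet> v) * g' x w - (F' x \<bullet> w) * g' x v) = 0"
    by (subst Bochner_Integration.integral_diff[OF I I])
       (simp_all add: loc_lipschitz_gradient_commute[OF F F' dF dg g' supp])
  moreover have "integrable lborel (\<lambda>x. (F' x \<bullet> v) * g' x w - (F' x \<bullet> w) * g' x v)"
    by (intro Bochner_Integration.integrable_diff I)
  ultimately show ?thesis by (simp add: has_bochner_integral_iff)
qed

text \<open>The field equations integrate against \<open>lebesgue\<close>, whereas the calculus
  above lives in \<open>lborel\<close>. Completeness makes any almost everywhere modification of a
  Borel function measurable, so f needs no measurability assumption of its own.\<close>

lemma integral_lebesgue_AE_lborel: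
  fixes f :: "'a::euclidean_space \<Rightarrow> real"
  assumes "has_bochner_integral lborel g i" "AE x in lborel. f x = g x"
  shows "(LINT x|lebesgue. f x) = i"
proof -
  have g[measurable]: "g \<in> borel_measurable lborel" using assms(1) by (rule borel_measurable_has_bochner_integral)
  have ae: "AE x in lebesgue. g x = f x"
    using AE_completion[OF assms(2)] by eventually_elim simp
  have gm: "g \<in> borel_measurable lebesgue" by (rule measurable_completion[OF g])
  then have f: "f \<in> borel_measurable lebesgue"
    using ae by (rule borel_measurable_AE)
  have "(LINT x|lebesgue. f x) = (LINT x|lebesgue. g x)"
    by (rule integral_cong_AE[OF f gm], use ae in eventually_elim) simp
  also have "\<dots> = i" using assms(1) by (simp add: integral_completion[OF g] has_bochner_integral_iff)
  finally show ?thesis .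
qed

text \<open>The pairing with curl \<psi> regroups, for each component of \<psi>, into a difference
  of two products of first derivatives with the directions interchanged. Each difference integrates
  to zero because weak mixed derivatives commute.\<close>

lemma distr_curl_zero_gradient:
  fixes F :: "real^3 \<Rightarrow> real"
  assumes F: "loc_lipschitz F" and F': "F' \<in> borel_measurable borel"
    and dF: "AE x in lborel. (F has_derivative (\<lambda>u. F' x \<bullet> u)) (at x)"
  shows "distr_curl_zero F'"
  unfolding distr_curl_zero_def
proof (intro allI impI)
  fix \<psi> :: "real^3 \<Rightarrow> real^3" assume "test_function \<psi>"
  then obtain r where \<psi>: "\<And>x. (\<psi> has_derivative frechet_derivative \<psi> (at x)) (at x)"
    "\<And>v. continuous_on UNIV (\<lambda>x. frechet_derivative \<psi> (at x) v)" "\<And>x. norm x > r \<Longrightarrow> \<psi> x = 0"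
    by (rule test_functionD) (rule that)
  let ?d = "\<lambda>k x v. frechet_derivative \<psi> (at x) v $ k"
  have *: "has_bochner_integral lborel (\<lambda>x. (F' x \<bullet> v) * ?d k x w - (F' x \<bullet> w) * ?d k x v) 0" for k v w
  proof (rule loc_lipschitz_gradient_commute_vanish[OF F F' dF])
    show "((\<lambda>x. \<psi> x $ k) has_derivative (\<lambda>v. ?d k x v)) (at x)" for x
      by (rule bounded_linear.has_derivative[OF bounded_linear_vec_nth \<psi>(1)])
    show "continuous_on UNIV (\<lambda>x. ?d k x v)" for v
      by (intro continuous_intros \<psi>(2))
    show "\<psi> x $ k = 0" if "norm x > r" for x using \<psi>(3)[OF that] by simp
  qed
  then have *: "has_bochner_integral lborel (\<lambda>x. F' x $ i * ?d k x (axis j 1) - F' x $ j * ?d k x (axis i 1)) 0" for i j k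
    by (simp add: cart_eq_inner_axis)
  have "F' x \<bullet> curl \<psi> x =
       (F' x $ 1 * ?d 3 x (axis 2 1) - F' x $ 2 * ?d 3 x (axis 1 1))
     + (F' x $ 3 * ?d 2 x (axis 1 1) - F' x $ 1 * ?d 2 x (axis 3 1))
     + (F' x $ 2 * ?d 1 x (axis 3 1) - F' x $ 3 * ?d 1 x (axis 2 1))" for x
    by (simp add: curl_def Let_def jacobian_def matrix_def inner_vec_def sum_3 algebra_simps)
  moreover have "has_bochner_integral lborel (\<lambda>x.
       (F' x $ 1 * ?d 3 x (axis 2 1) - F' x $ 2 * ?d 3 x (axis 1 1))
     + (F' x $ 3 * ?d 2 x (axis 1 1) - F' x $ 1 * ?d 2 x (axis 3 1))
     + (F' x $ 2 * ?d 1 x (axis 3 1) - F' x $ 3 * ?d 1 x (axis 2 1))) (0 + 0 + 0)"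
    by (intro has_bochner_integral_add *)
  ultimately have "has_bochner_integral lborel (\<lambda>x. F' x \<bullet> curl \<psi> x) (0 + 0 + 0)"
    by presburger
  then show "(LINT x|lebesgue. F' x \<bullet> curl \<psi> x) = 0"
    using integral_lebesgue_AE_lborel[of "\<lambda>x. F' x \<bullet> curl \<psi> x" 0] by simp
qed

text \<open>The same antisymmetric grouping, now one difference for each component of the vector
  potential. The identity for V is demanded only almost everywhere, since the potentials used later
  have no derivative on a sphere.\<close>

lemma distr_div_zero_curl:
  fixes A :: "3 \<Rightarrow> real^3 \<Rightarrow> real"
  assumes A: "\<And>i. loc_lipschitz (A i)" and A': "\<And>i. A' i \<in> borel_measurable borel"
    and dA: "\<And>i. AE x in lborel. (A i has_derivative (\<lambda>u. A' i x \<bullet> u)) (at x)"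
    and V: "AE x in lborel. V x = vector [A' 3 x $ 2 - A' 2 x $ 3, A' 1 x $ 3 - A' 3 x $ 1, A' 2 x $ 1 - A' 1 x $ 2]"
  shows "distr_div_zero V"
  unfolding distr_div_zero_def
proof (intro allI impI)
  fix \<phi> :: "real^3 \<Rightarrow> real" assume "test_function \<phi>"
  then obtain r where \<phi>: "\<And>x. (\<phi> has_derivative frechet_derivative \<phi> (at x)) (at x)"
    "\<And>v. continuous_on UNIV (\<lambda>x. frechet_derivative \<phi> (at x) v)" "\<And>x. norm x > r \<Longrightarrow> \<phi> x = 0"
    by (rule test_functionD) (rule that)
  let ?d = "\<lambda>x i. frechet_derivative \<phi> (at x) (axis i 1)"
  have "has_bochner_integral lborel (\<lambda>x. (A' k x \<bullet> axis i 1) * ?d x j - (A' k x \<bullet> axis j 1) * ?d x i) 0" for i j k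
    by (rule loc_lipschitz_gradient_commute_vanish[OF A A' dA \<phi>])
  then have *: "has_bochner_integral lborel (\<lambda>x. A' k x $ i * ?d x j - A' k x $ j * ?d x i) 0" for i j k
    by (simp add: cart_eq_inner_axis)
  have "has_bochner_integral lborel (\<lambda>x.
       (A' 3 x $ 2 * ?d x 1 - A' 3 x $ 1 * ?d x 2)
     + (A' 2 x $ 1 * ?d x 3 - A' 2 x $ 3 * ?d x 1)
     + (A' 1 x $ 3 * ?d x 2 - A' 1 x $ 2 * ?d x 3)) (0 + 0 + 0)"
    by (intro has_bochner_integral_add *)
  moreover have "AE x in lborel. V x \<bullet> gradient \<phi> x = 
       (A' 3 x $ 2 * ?d x 1 - A' 3 x $ 1 * ?d x 2)
     + (A' 2 x $ 1 * ?d x 3 - A' 2 x $ 3 * ?d x 1)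
     + (A' 1 x $ 3 * ?d x 2 - A' 1 x $ 2 * ?d x 3)"
    using V by eventually_elim (simp add: gradient_def inner_vec_def sum_3 algebra_simps)
  ultimately show "(LINT x|lebesgue. V x \<bullet> gradient \<phi> x) = 0"
    by (simp add: integral_lebesgue_AE_lborel)
qed

unbundle cross3_syntax

section \<open>Explicit demagnetizing fields\<close>

text \<open>Dyadic comparison: with n least such that |x| < 2^n, the function is at most 16 / 16^n,
  while the ball of radius 2^n has volume proportional to 8^n, which leaves a geometric series of
  ratio 1/2. The factor 16 = 2^4 pays for the lower bound on |x| being 2^(n-1) instead of
  2^n.\<close>

lemma integrable_inverse_quartic:
  "integrable lborel (\<lambda>x::real^3. 1 / (1 + x \<bullet> x)\<^sup>2)"
proof (rule integrableI_nonneg)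
  let ?c = "\<lambda>n. ennreal (16 * (1/16) ^ n)"
  have "ennreal (1 / (1 + x \<bullet> x)\<^sup>2) \<le> (\<Sum>n. ?c n * indicator (ball 0 (2 ^ n)) x)" for x :: "real^3"
  proof -
    have ex: "\<exists>n. norm x < 2 ^ n" using real_arch_pow[of 2 "norm x"] by simp
    define n where "n = (LEAST n. norm x < 2 ^ n)"
    have n: "norm x < 2 ^ n" unfolding n_def using ex by (rule LeastI_ex)
    have "1 / (1 + x \<bullet> x)\<^sup>2 \<le> 16 * (1/16) ^ n"
    proof (cases n)
      case 0
      have "1 \<le> (1 + x \<bullet> x)\<^sup>2" by (simp add: one_le_power)
      then have "1 / (1 + x \<bullet> x)\<^sup>2 \<le> 1 / 1" by (intro divide_left_mono) (auto simp: add_pos_nonneg less_imp_neq[symmetric])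
      then show ?thesis using 0 by simp
    next
      case (Suc m)
      then have "2 ^ m \<le> norm x" using not_less_Least[of m "\<lambda>n. norm x < 2 ^ n"] unfolding n_def by simp
      then have "((2 ^ m)\<^sup>2)\<^sup>2 \<le> ((norm x)\<^sup>2)\<^sup>2" by (intro power_mono) auto
      also have "\<dots> \<le> (1 + x \<bullet> x)\<^sup>2" by (intro power_mono) (auto simp: power2_norm_eq_inner)
      also have "((2 ^ m)\<^sup>2)\<^sup>2 = (16::real) ^ m" by (induction m) (auto simp: power_mult_distrib)
      finally have "16 ^ m \<le> (1 + x \<bullet> x)\<^sup>2" .
      then have "1 / (1 + x \<bullet> x)\<^sup>2 \<le> 1 / 16 ^ m" by (intro divide_left_mono) (auto simp: add_pos_nonneg less_imp_neq[symmetric])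
      then show ?thesis using Suc by (simp add: power_one_over)
    qed
    then have "ennreal (1 / (1 + x \<bullet> x)\<^sup>2) \<le> ?c n * indicator (ball 0 (2 ^ n)) x"
      using n by (simp add: ennreal_leI)
    also have "\<dots> \<le> (\<Sum>n. ?c n * indicator (ball 0 (2 ^ n)) x)"
      using sum_le_suminf[of "\<lambda>n. ?c n * indicator (ball 0 (2 ^ n)) x" "{n}"]
      by (simp del: sum_mult_indicator)
    finally show ?thesis .
  qed
  then have "(\<integral>\<^sup>+x. ennreal (1 / (1 + x \<bullet> (x::real^3))\<^sup>2) \<partial>lborel) \<le> (\<integral>\<^sup>+x. (\<Sum>n. ?c n * indicator (ball (0::real^3) (2 ^ n)) x) \<partial>lborel)"
    by (intro nn_integral_mono)
  also have "\<dots> = (\<Sum>n. \<integral>\<^sup>+x. ?c n * indicator (ball (0::real^3) (2 ^ n)) x \<partial>lborel)"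
  proof (rule nn_integral_suminf)
    fix n
    have [measurable]: "ball (0::real^3) (2 ^ n) \<in> sets borel" by simp
    show "(\<lambda>x. ?c n * indicator (ball (0::real^3) (2 ^ n)) x) \<in> borel_measurable lborel" by measurable
  qed
  also have "\<dots> = (\<Sum>n. ennreal (16 * unit_ball_vol 3 * (1/2) ^ n))"
  proof (intro suminf_cong)
    fix n
    have "(\<integral>\<^sup>+x. ?c n * indicator (ball (0::real^3) (2 ^ n)) x \<partial>lborel) = ?c n * emeasure lborel (ball (0::real^3) (2 ^ n))"
      by (intro nn_integral_cmult_indicator) auto
    also have "\<dots> = ennreal (16 * (1/16) ^ n * (unit_ball_vol 3 * (2 ^ n) ^ 3))"
      by (simp add: emeasure_ball ennreal_mult)
    also have "(2 ^ n) ^ 3 = (8::real) ^ n" by (induction n) (auto simp: power_mult_distrib)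
    also have "16 * (1/16) ^ n * (unit_ball_vol 3 * 8 ^ n) = 16 * unit_ball_vol 3 * ((1/16) * 8 :: real) ^ n"
      by (simp only: power_mult_distrib mult_ac)
    finally show "(\<integral>\<^sup>+x. ?c n * indicator (ball (0::real^3) (2 ^ n)) x \<partial>lborel) = ennreal (16 * unit_ball_vol 3 * (1/2) ^ n)"
      by simp
  qed
  also have "\<dots> = ennreal (\<Sum>n. 16 * unit_ball_vol 3 * (1/2) ^ n)"
    by (intro suminf_ennreal2 summable_mult summable_geometric) auto
  also have "\<dots> < \<infinity>" by simp
  finally show "(\<integral>\<^sup>+x. ennreal (1 / (1 + x \<bullet> (x::real^3))\<^sup>2) \<partial>lborel) < \<infinity>" .
qed auto

section \<open>Radial potentials glued along a sphere\<close>

text \<open>The value of P' at S is left free: the profiles are evaluated at |x|^2, and the sphere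
  |x|^2 = S is a null set.\<close>

definition piecewise_C1 :: "real \<Rightarrow> (real \<Rightarrow> real) \<Rightarrow> (real \<Rightarrow> real) \<Rightarrow> bool" where
  "piecewise_C1 S P P' \<longleftrightarrow> loc_lipschitz P \<and> P' \<in> borel_measurable borel \<and>
     (\<forall>s. s \<noteq> S \<longrightarrow> (P has_real_derivative P' s) (at s))"

lemma piecewise_C1_glue:
  fixes p q :: "real \<Rightarrow> real"
  assumes p: "\<And>s. s \<le> S \<Longrightarrow> (p has_real_derivative p' s) (at s)" "continuous_on {..S} p'"
    and q: "\<And>s. s \<ge> S \<Longrightarrow> (q has_real_derivative q' s) (at s)" "continuous_on {S..} q'"
    and eq: "p S = q S"
  shows "piecewise_C1 S (\<lambda>s. if s \<le> S then p s else q s) (\<lambda>s. if s \<le> S then p' s else q' s)"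
  unfolding piecewise_C1_def
proof (intro conjI allI impI)
  show "loc_lipschitz (\<lambda>s. if s \<le> S then p s else q s)" by (rule loc_lipschitz_piecewise_C1[OF p q eq])
  have "(\<lambda>s. if s \<in> {..S} then p' s else q' s) \<in> borel_measurable borel"
    by (rule borel_measurable_continuous_on_if) (auto intro: p(2) continuous_on_subset[OF q(2)])
  then show "(\<lambda>s. if s \<le> S then p' s else q' s) \<in> borel_measurable borel" by simp
  fix s assume "s \<noteq> S"
  then consider "s < S" | "s > S" by linarith
  then show "((\<lambda>s. if s \<le> S then p s else q s) has_real_derivative (if s \<le> S then p' s else q' s)) (at s)"
  proof cases
    case 1
    have "((\<lambda>s. if s \<le> S then p s else q s) has_real_derivative p' s) (at s)"
      by (rule has_field_derivative_transform_within_open[where S="{..<S}"]) (use 1 p in auto)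
    then show ?thesis using 1 by simp
  next
    case 2
    have "((\<lambda>s. if s \<le> S then p s else q s) has_real_derivative q' s) (at s)"
      by (rule has_field_derivative_transform_within_open[where S="{S<..}"]) (use 2 q in auto)
    then show ?thesis using 2 by simp
  qed
qed

lemma AE_lborel_not_sphere: "AE x::'a::euclidean_space in lborel. x \<notin> sphere 0 r"
proof -
  have "negligible (sphere (0::'a) r)" by (rule negligible_sphere)
  then have "sphere (0::'a) r \<in> null_sets lborel"
    by (auto simp: null_sets_completion_iff negligible_iff_null_sets)
  then show ?thesis by (rule AE_not_in)
qed

lemma AE_lborel_inner_self_neq: "S > 0 \<Longrightarrow> AE x::'a::euclidean_space in lborel. x \<bullet> x \<noteq> S"
  using AE_lborel_not_sphere[of "sqrt S"] by eventually_elim (auto simp: norm_eq_sqrt_inner)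

text \<open>The affine factor covers both kinds of potential at once: d = 0 gives the scalar
  potential and the components of the azimuthal vector potential, b = 0 the components of the axial
  one.\<close>

lemma radial_linear:
  fixes b :: "'a::euclidean_space"
  assumes P: "piecewise_C1 S P P'" and S: "S > 0"
  shows "loc_lipschitz (\<lambda>x. P (x \<bullet> x) * (x \<bullet> b + d))"
    and "(\<lambda>x. (2 * P' (x \<bullet> x) * (x \<bullet> b + d)) *\<^sub>R x + P (x \<bullet> x) *\<^sub>R b) \<in> borel_measurable borel"
    and "AE x in lborel. ((\<lambda>x. P (x \<bullet> x) * (x \<bullet> b + d)) has_derivative
          (\<lambda>u. ((2 * P' (x \<bullet> x) * (x \<bullet> b + d)) *\<^sub>R x + P (x \<bullet> x) *\<^sub>R b) \<bullet> u)) (at x)"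
proof -
  have lP: "loc_lipschitz P" using P unfolding piecewise_C1_def by blast
  have mP[measurable]: "P \<in> borel_measurable borel" "P' \<in> borel_measurable borel"
    using P borel_measurable_continuous_onI[OF loc_lipschitz_continuous[OF lP]] unfolding piecewise_C1_def by blast+
  show "loc_lipschitz (\<lambda>x. P (x \<bullet> x) * (x \<bullet> b + d))"
    by (intro loc_lipschitz_mult loc_lipschitz_compose[OF lP] loc_lipschitz_inner_self loc_lipschitz_add
        loc_lipschitz_linear bounded_linear_inner_left loc_lipschitz_const)
  show "(\<lambda>x. (2 * P' (x \<bullet> x) * (x \<bullet> b + d)) *\<^sub>R x + P (x \<bullet> x) *\<^sub>R b) \<in> borel_measurable borel"
    by measurable
  show "AE x in lborel. ((\<lambda>x. P (x \<bullet> x) * (x \<bullet> b + d)) has_derivative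
          (\<lambda>u. ((2 * P' (x \<bullet> x) * (x \<bullet> b + d)) *\<^sub>R x + P (x \<bullet> x) *\<^sub>R b) \<bullet> u)) (at x)"
    using AE_lborel_inner_self_neq[OF S]
  proof eventually_elim
    case (elim x)
    then have "(P has_real_derivative P' (x \<bullet> x)) (at (x \<bullet> x))" using P unfolding piecewise_C1_def by blast
    then have "(P has_derivative (\<lambda>u. P' (x \<bullet> x) * u)) (at (x \<bullet> x))" by (simp add: has_field_derivative_def)
    moreover have "((\<lambda>x. x \<bullet> x) has_derivative (\<lambda>u. x \<bullet> u + u \<bullet> x)) (at x)"
      by (auto intro!: derivative_eq_intros)
    ultimately have "((\<lambda>x. P (x \<bullet> x)) has_derivative (\<lambda>u. P' (x \<bullet> x) * (x \<bullet> u + u \<bullet> x))) (at x)"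
      using has_derivative_compose by blast
    moreover have "((\<lambda>x. x \<bullet> b + d) has_derivative (\<lambda>u. u \<bullet> b)) (at x)"
      by (auto intro!: derivative_eq_intros)
    ultimately have "((\<lambda>x. P (x \<bullet> x) * (x \<bullet> b + d)) has_derivative
       (\<lambda>u. P (x \<bullet> x) * (u \<bullet> b) + P' (x \<bullet> x) * (x \<bullet> u + u \<bullet> x) * (x \<bullet> b + d))) (at x)"
      by (rule has_derivative_mult)
    then show ?case
      by (rule has_derivative_eq_rhs) (auto simp: fun_eq_iff inner_add_left inner_commute algebra_simps)
  qed
qed

lemma radial_potential_curl_free:
  assumes "piecewise_C1 S P P'" "S > 0"
  shows "distr_curl_zero (\<lambda>x. - ((2 * P' (x \<bullet> x) * (x \<bullet> c)) *\<^sub>R x + P (x \<bullet> x) *\<^sub>R c))"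
proof -
  note R = radial_linear[OF assms, of "- c" 0]
  have "distr_curl_zero (\<lambda>x. (2 * P' (x \<bullet> x) * (x \<bullet> - c + 0)) *\<^sub>R x + P (x \<bullet> x) *\<^sub>R (- c))"
    by (rule distr_curl_zero_gradient[OF R])
  then show ?thesis by simp
qed

text \<open>The vector potential is \<open>Q(|x|\<^sup>2) c \<times> x + G(|x|\<^sup>2) c\<close>.\<close>

lemma radial_vector_potential_div_free:
  fixes c :: "real^3"
  assumes Q: "piecewise_C1 S Q Q'" and G: "piecewise_C1 S G G'" and S: "S > 0"
    and V: "AE x in lborel. V x = (2 * Q (x \<bullet> x)) *\<^sub>R c
      + (2 * Q' (x \<bullet> x)) *\<^sub>R ((x \<bullet> x) *\<^sub>R c - (x \<bullet> c) *\<^sub>R x) - (2 * G' (x \<bullet> x)) *\<^sub>R (c \<times> x)"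
  shows "distr_div_zero V"
proof -
  \<comment> \<open>By the cyclic symmetry of the triple product, the i-th component of c \<times> x
    is the inner product of x with \<open>b i\<close>, which puts the vector potential into radial
    times affine form.\<close>
  define b :: "3 \<Rightarrow> real^3" where "b i = axis i 1 \<times> c" for i
  define A where "A i x = Q (x \<bullet> x) * (x \<bullet> b i + 0) + G (x \<bullet> x) * (x \<bullet> 0 + c $ i)" for i and x :: "real^3"
  define A' where "A' i x = ((2 * Q' (x \<bullet> x) * (x \<bullet> b i + 0)) *\<^sub>R x + Q (x \<bullet> x) *\<^sub>R b i)
      + ((2 * G' (x \<bullet> x) * (x \<bullet> 0 + c $ i)) *\<^sub>R x + G (x \<bullet> x) *\<^sub>R 0)" for i and x :: "real^3"
  show ?thesis
  proof (rule distr_div_zero_curl[of A A'])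
    fix i
    show "loc_lipschitz (A i)"
      unfolding A_def by (intro loc_lipschitz_add radial_linear(1)[OF Q S] radial_linear(1)[OF G S])
    show "A' i \<in> borel_measurable borel"
      unfolding A'_def by (intro borel_measurable_add radial_linear(2)[OF Q S] radial_linear(2)[OF G S])
    show "AE x in lborel. (A i has_derivative (\<lambda>u. A' i x \<bullet> u)) (at x)"
      using radial_linear(3)[OF Q S, of "b i" 0] radial_linear(3)[OF G S, of 0 "c $ i"]
    proof eventually_elim
      case (elim x)
      show ?case unfolding A_def A'_def inner_add_left[of _ _ "_::real^3"]
        using has_derivative_add[OF elim] by (simp add: A_def inner_add_left)
    qed
  next
    show "AE x in lborel. V x = vector [A' 3 x $ 2 - A' 2 x $ 3, A' 1 x $ 3 - A' 3 x $ 1, A' 2 x $ 1 - A' 1 x $ 2]"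
      using V
    proof eventually_elim
      case (elim x)
      have b: "b 1 = vector [0, - c $ 3, c $ 2]" "b 2 = vector [c $ 3, 0, - c $ 1]" "b 3 = vector [- c $ 2, c $ 1, 0]"
        by (simp_all add: b_def cross3_def vec_eq_iff forall_3 axis_def)
      show ?case unfolding elim A'_def b
        by (simp add: vec_eq_iff forall_3 cross_components inner_vec_def sum_3) (simp add: algebra_simps)
    qed
  qed
qed

lemma L2_space_decay:
  fixes h :: "real^3 \<Rightarrow> real^3"
  assumes [measurable]: "h \<in> borel_measurable borel" and "\<And>x. norm (h x) \<le> C / (1 + x \<bullet> x)"
  shows "h \<in> L2_space lebesgue"
proof -
  have "integrable lborel (\<lambda>x. (norm (h x))\<^sup>2)"
  proof (rule Bochner_Integration.integrable_bound)
    show "integrable lborel (\<lambda>x::real^3. C\<^sup>2 * (1 / (1 + x \<bullet> x)\<^sup>2))"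
      by (intro integrable_mult_right integrable_inverse_quartic)
    show "AE x in lborel. norm ((norm (h x))\<^sup>2) \<le> norm (C\<^sup>2 * (1 / (1 + x \<bullet> x)\<^sup>2))"
      using power_mono[OF assms(2), of _ 2] by (auto simp: power_divide)
  qed auto
  then have "integrable lebesgue (\<lambda>x. (norm (h x))\<^sup>2)"
    by (subst integrable_completion) auto
  moreover have "h \<in> borel_measurable lebesgue" by (intro measurable_completion) simp
  ultimately show ?thesis unfolding L2_space_def by blast
qed

text \<open>The potential is \<open>f(|x|\<^sup>2) (x \<cdot> c)\<close> and the vector potential of \<open>m \<chi> + h\<close> is
  \<open>q(|x|\<^sup>2) (c \<times> x) + g(|x|\<^sup>2) c\<close>. Outside the ball \<open>f\<close> and \<open>q\<close> are both continued by the dipole profile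
  \<open>\<kappa> (R / |x|)\<^sup>3\<close> and \<open>g\<close> by zero, which makes \<open>h\<close> and \<open>m \<chi> + h\<close> agree there.\<close>

lemma explicit_demag_field:
  fixes c :: "real^3" and \<kappa> R :: real
  defines "S \<equiv> R\<^sup>2"
  assumes R: "R > 0" and c: "norm c = 1" and \<kappa>: "0 \<le> \<kappa>" "\<kappa> \<le> 1/3"
    and f: "\<And>s. s \<le> S \<Longrightarrow> (f has_real_derivative f' s) (at s)" "continuous_on {..S} f'" "f S = \<kappa>"
    and q: "\<And>s. s \<le> S \<Longrightarrow> (q has_real_derivative q' s) (at s)" "continuous_on {..S} q'" "q S = \<kappa>"
    and g: "\<And>s. s \<le> S \<Longrightarrow> (g has_real_derivative g' s) (at s)" "continuous_on {..S} g'" "g S = 0"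
    and bound: "\<And>x. x \<bullet> x \<le> S \<Longrightarrow> norm ((2 * f' (x \<bullet> x) * (x \<bullet> c)) *\<^sub>R x + f (x \<bullet> x) *\<^sub>R c) \<le> 1"
    and M: "\<And>x. x \<bullet> x < S \<Longrightarrow> M x = (2 * q (x \<bullet> x)) *\<^sub>R c
      + (2 * q' (x \<bullet> x)) *\<^sub>R ((x \<bullet> x) *\<^sub>R c - (x \<bullet> c) *\<^sub>R x) - (2 * g' (x \<bullet> x)) *\<^sub>R (c \<times> x)
      + ((2 * f' (x \<bullet> x) * (x \<bullet> c)) *\<^sub>R x + f (x \<bullet> x) *\<^sub>R c)"
  obtains h where "is_demag_field (ball 0 R) M h"
    "\<And>x. x \<in> ball 0 R \<Longrightarrow> h x = - ((2 * f' (x \<bullet> x) * (x \<bullet> c)) *\<^sub>R x + f (x \<bullet> x) *\<^sub>R c)"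
proof -
  have S: "S > 0" using R by (simp add: S_def)
  define e where "e s = \<kappa> * (s / S) powr (-3/2)" for s
  define e' where "e' s = - (3 * \<kappa> / (2 * S)) * (s / S) powr (-5/2)" for s
  have e: "(e has_real_derivative e' s) (at s)" if "s \<ge> S" for s
    unfolding e_def[abs_def] e'_def using that S by (auto intro!: derivative_eq_intros simp: field_simps)
  have ce': "continuous_on {S..} e'"
    unfolding e'_def[abs_def] using S by (auto intro!: continuous_intros)
  have eS: "e S = \<kappa>" using S by (simp add: e_def)
  define P where "P s = (if s \<le> S then f s else e s)" for s
  define P' where "P' s = (if s \<le> S then f' s else e' s)" for s
  define Q where "Q s = (if s \<le> S then q s else e s)" for s
  define Q' where "Q' s = (if s \<le> S then q' s else e' s)" for s
  define G where "G s = (if s \<le> S then g s else 0)" for s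
  define G' where "G' s = (if s \<le> S then g' s else 0)" for s
  have PP: "piecewise_C1 S P P'"
    unfolding P_def[abs_def] P'_def[abs_def] by (rule piecewise_C1_glue) (use f e ce' eS in auto)
  have QQ: "piecewise_C1 S Q Q'"
    unfolding Q_def[abs_def] Q'_def[abs_def] by (rule piecewise_C1_glue) (use q e ce' eS in auto)
  have GG: "piecewise_C1 S G G'"
    unfolding G_def[abs_def] G'_def[abs_def] by (rule piecewise_C1_glue) (use g in auto)
  define h where "h x = - ((2 * P' (x \<bullet> x) * (x \<bullet> c)) *\<^sub>R x + P (x \<bullet> x) *\<^sub>R c)" for x
  have ball: "x \<in> ball 0 R \<longleftrightarrow> x \<bullet> x < S" for x :: "real^3"
    using R by (simp add: norm_lt_square S_def)
  have curl: "distr_curl_zero h"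
    unfolding h_def[abs_def] by (rule radial_potential_curl_free[OF PP S])
  have "distr_div_zero (\<lambda>x. indicat_real (ball 0 R) x *\<^sub>R M x + h x)"
  proof (rule radial_vector_potential_div_free[OF QQ GG S, of _ c])
    show "AE x in lborel. indicat_real (ball 0 R) x *\<^sub>R M x + h x = (2 * Q (x \<bullet> x)) *\<^sub>R c
      + (2 * Q' (x \<bullet> x)) *\<^sub>R ((x \<bullet> x) *\<^sub>R c - (x \<bullet> c) *\<^sub>R x) - (2 * G' (x \<bullet> x)) *\<^sub>R (c \<times> x)"
      using AE_lborel_inner_self_neq[OF S]
    proof eventually_elim
      case (elim x)
      then consider "x \<bullet> x < S" | "x \<bullet> x > S" by linarith
      then show ?case
      proof cases
        case 1
        then have "indicat_real (ball 0 R) x = 1" using ball[of x] by (simp add: indicator_def)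
        then show ?thesis using 1 M[OF 1] by (simp add: h_def P_def P'_def Q_def Q'_def G'_def)
      next
        case 2
        then have i: "indicat_real (ball 0 R) x = 0" using ball[of x] by (simp add: indicator_def)
        have u: "(x \<bullet> x / S) powr (-3/2) = (x \<bullet> x / S) * (x \<bullet> x / S) powr (-5/2)"
          using 2 S powr_add[of "x \<bullet> x / S" 1 "-5/2"] by simp
        \<comment> \<open>Homogeneity of the dipole profile: s e'(s) = -(3/2) e(s). This is exactly
          what makes the gradient form of the outer field coincide with its curl form.\<close>
        have "e' (x \<bullet> x) * (x \<bullet> x) = - (3/2) * e (x \<bullet> x)"
          unfolding e_def e'_def u using S by (simp add: field_simps)
        then have k: "2 * (e' (x \<bullet> x) * (x \<bullet> x)) = - 3 * e (x \<bullet> x)" by simp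
        have "h x = - ((2 * e' (x \<bullet> x) * (x \<bullet> c)) *\<^sub>R x) - e (x \<bullet> x) *\<^sub>R c"
          using 2 by (simp add: h_def P_def P'_def)
        also have "\<dots> = (2 * e (x \<bullet> x) + 2 * (e' (x \<bullet> x) * (x \<bullet> x))) *\<^sub>R c - (2 * e' (x \<bullet> x) * (x \<bullet> c)) *\<^sub>R x"
          unfolding k by (simp add: algebra_simps flip: scaleR_left.add)
        also have "\<dots> = (2 * e (x \<bullet> x)) *\<^sub>R c + (2 * e' (x \<bullet> x)) *\<^sub>R ((x \<bullet> x) *\<^sub>R c - (x \<bullet> c) *\<^sub>R x)"
          by (simp add: algebra_simps)
        finally show ?thesis using 2 by (simp add: i Q_def Q'_def G'_def)
      qed
    qed
  qed
  moreover have "h \<in> L2_space lebesgue"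
  proof (rule L2_space_decay)
    have "(\<lambda>x. (2 * P' (x \<bullet> x) * (x \<bullet> c + 0)) *\<^sub>R x + P (x \<bullet> x) *\<^sub>R c) \<in> borel_measurable borel"
      by (rule radial_linear(2)[OF PP S])
    then show "h \<in> borel_measurable borel" unfolding h_def[abs_def] by (intro borel_measurable_uminus) simp
    fix x :: "real^3"
    \<comment> \<open>Outside the ball the field is at most 4 \<kappa> (R/|x|)^3, and \<kappa> \<le>
      1/3 turns this into the factor 4/3. One power of R/|x| is given up, and S / |x|^2 \<le> (1 +
      S) / (1 + |x|^2) yields a majorant that is also valid inside.\<close>
    show "norm (h x) \<le> (4/3) * (1 + S) / (1 + x \<bullet> x)"
    proof (cases "x \<bullet> x \<le> S")
      case True
      have "norm (h x) \<le> 1"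
        unfolding h_def norm_minus_cancel using bound[OF True] True by (simp add: P_def P'_def)
      also have "\<dots> \<le> (4/3) * (1 + S) / (1 + x \<bullet> x)"
        using True S by (simp add: le_divide_eq add_pos_nonneg)
      finally show ?thesis .
    next
      case False
      define u where "u = x \<bullet> x / S"
      have u: "u > 1" "u * S = x \<bullet> x" using False S by (simp_all add: u_def field_simps)
      have up: "u powr (-3/2) = u * u powr (-5/2)"
        using u(1) powr_add[of u 1 "-5/2"] by simp
      have "\<bar>x \<bullet> c\<bar> * norm x \<le> norm x * norm x"
        using Cauchy_Schwarz_ineq2[of x c] c by (intro mult_right_mono) auto
      then have tx: "\<bar>x \<bullet> c\<bar> * norm x \<le> u * S" unfolding u(2) by (simp add: power2_norm_eq_inner flip: power2_eq_square)
      have "norm (h x) \<le> norm ((2 * e' (x \<bullet> x) * (x \<bullet> c)) *\<^sub>R x) + norm (e (x \<bullet> x) *\<^sub>R c)"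
        unfolding h_def norm_minus_cancel using False norm_triangle_ineq by (simp add: P_def P'_def del: norm_scaleR)
      also have "\<dots> = (3 * \<kappa> / S) * u powr (-5/2) * (\<bar>x \<bullet> c\<bar> * norm x) + \<kappa> * u powr (-3/2)"
        using c \<kappa> S by (simp add: e_def e'_def u_def abs_mult)
      also have "\<dots> \<le> (3 * \<kappa> / S) * u powr (-5/2) * (u * S) + \<kappa> * u powr (-3/2)"
        using \<kappa> S by (intro add_right_mono mult_left_mono tx) auto
      also have "\<dots> = 4 * \<kappa> * u powr (-3/2)" unfolding up using S by (simp add: field_simps)
      also have "\<dots> \<le> (4/3) * u powr (-1)"
        using \<kappa> u(1) by (intro mult_mono powr_mono) auto
      also have "\<dots> = (4/3) * (S / (x \<bullet> x))" using u(1) S by (simp add: powr_minus u_def)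
      also have "S / (x \<bullet> x) \<le> (1 + S) / (1 + x \<bullet> x)"
      proof -
        have "0 < x \<bullet> x" "0 < 1 + x \<bullet> x" using False S by linarith+
        moreover have "S * (1 + x \<bullet> x) \<le> (1 + S) * (x \<bullet> x)"
          using False S by (simp add: algebra_simps)
        ultimately show ?thesis by (simp add: pos_divide_le_eq pos_le_divide_eq)
      qed
      finally show ?thesis by simp
    qed
  qed
  ultimately have "is_demag_field (ball 0 R) M h" using curl by (simp add: is_demag_field_def)
  moreover have "h x = - ((2 * f' (x \<bullet> x) * (x \<bullet> c)) *\<^sub>R x + f (x \<bullet> x) *\<^sub>R c)" if "x \<in> ball 0 R" for x
    using that ball[of x] by (simp add: h_def P_def P'_def)
  ultimately show thesis by (rule that)
qed

section \<open>The fields of a constant and of the competitor\<close>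

text \<open>The constant c splits into 2/3 c, the curl of c \<times> x / 3, and 1/3 c, the gradient
  of (x . c)/3; both profiles are 1/3 and match the dipole with \<kappa> = 1/3.\<close>

lemma demag_field_constant:
  fixes c :: "real^3"
  assumes R: "R > 0" and c: "norm c = 1"
  obtains h where "is_demag_field (ball 0 R) (\<lambda>x. c) h" "\<And>x. x \<in> ball 0 R \<Longrightarrow> h x = - (1/3) *\<^sub>R c"
proof (rule explicit_demag_field[OF R c, of "1/3" "\<lambda>_. 1/3" "\<lambda>_. 0" "\<lambda>_. 1/3" "\<lambda>_. 0" "\<lambda>_. 0" "\<lambda>_. 0" "\<lambda>x. c"])
  show "c = (2 * (1/3)) *\<^sub>R c + (2 * 0) *\<^sub>R ((x \<bullet> x) *\<^sub>R c - (x \<bullet> c) *\<^sub>R x) - (2 * 0) *\<^sub>R (c \<times> x)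
      + ((2 * 0 * (x \<bullet> c)) *\<^sub>R x + (1/3) *\<^sub>R c)" for x
    by (simp flip: scaleR_left.add)
qed (use c in \<open>auto intro: that\<close>)

text \<open>The formula depends on x/R alone, so a larger ball stretches the configuration without
  changing its shape. Only its values inside the ball matter.\<close>

definition vortex :: "real \<Rightarrow> real^3 \<Rightarrow> real^3 \<Rightarrow> real^3" where
  "vortex R c x = (1 - x \<bullet> x / R\<^sup>2) *\<^sub>R c + ((x \<bullet> c) / R\<^sup>2) *\<^sub>R x
     + (sqrt (2 - x \<bullet> x / R\<^sup>2) / R) *\<^sub>R (c \<times> x)"

text \<open>The profiles come from comparing coefficients. The x-term forces 2 f' - 2 q' = 1/R^2,
  the c-term forces 2 q + 2 s q' + f = 1 - s/R^2 with s = |x|^2, and f and q must agree at s = R^2,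
  where both are 1/5. The profile g is the antiderivative producing the azimuthal coefficient,
  normalised to vanish on the boundary.\<close>

lemma demag_field_vortex:
  fixes c :: "real^3"
  assumes R: "R > 0" and c: "norm c = 1"
  obtains h where "is_demag_field (ball 0 R) (vortex R c) h"
    "\<And>x. x \<in> ball 0 R \<Longrightarrow> h x = - (1/5) *\<^sub>R ((x \<bullet> x / R\<^sup>2) *\<^sub>R c + (2 * (x \<bullet> c) / R\<^sup>2) *\<^sub>R x)"
proof (rule explicit_demag_field[OF R c, of "1/5" "\<lambda>s. s / R\<^sup>2 / 5" "\<lambda>s. 1 / (5 * R\<^sup>2)"
      "\<lambda>s. (1 - 3 * (s / R\<^sup>2) / 5) / 2" "\<lambda>s. - 3 / (10 * R\<^sup>2)"
      "\<lambda>s. R / 3 * ((2 - s / R\<^sup>2) powr (3/2) - 1)" "\<lambda>s. - sqrt (2 - s / R\<^sup>2) / (2 * R)" "vortex R c"])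
  have pos: "2 - s / R\<^sup>2 > 0" if "s \<le> R\<^sup>2" for s
    using that R by (simp add: field_simps) (smt (verit) zero_less_power)
  show "((\<lambda>s. R / 3 * ((2 - s / R\<^sup>2) powr (3/2) - 1)) has_real_derivative - sqrt (2 - s / R\<^sup>2) / (2 * R)) (at s)"
    if "s \<le> R\<^sup>2" for s
    using pos[OF that] R
    by (auto intro!: derivative_eq_intros simp: powr_half_sqrt field_simps power2_eq_square)
  show "continuous_on {..R\<^sup>2} (\<lambda>s. - sqrt (2 - s / R\<^sup>2) / (2 * R))"
    using R by (auto intro!: continuous_intros)
  show "norm ((2 * (1 / (5 * R\<^sup>2)) * (x \<bullet> c)) *\<^sub>R x + (x \<bullet> x / R\<^sup>2 / 5) *\<^sub>R c) \<le> 1" if "x \<bullet> x \<le> R\<^sup>2" for x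
  proof -
    have "\<bar>x \<bullet> c\<bar> * norm x \<le> norm x * norm x"
      using Cauchy_Schwarz_ineq2[of x c] c by (intro mult_right_mono) auto
    also have "\<dots> \<le> R\<^sup>2" using that by (simp add: power2_norm_eq_inner flip: power2_eq_square)
    finally have 1: "2 * (\<bar>x \<bullet> c\<bar> * norm x) / (5 * R\<^sup>2) \<le> 2 / 5" using R by (simp add: field_simps)
    have 2: "x \<bullet> x / R\<^sup>2 / 5 \<le> 1/5" using that R by (simp add: field_simps)
    have "norm ((2 * (1 / (5 * R\<^sup>2)) * (x \<bullet> c)) *\<^sub>R x + (x \<bullet> x / R\<^sup>2 / 5) *\<^sub>R c)
       \<le> norm ((2 * (1 / (5 * R\<^sup>2)) * (x \<bullet> c)) *\<^sub>R x) + norm ((x \<bullet> x / R\<^sup>2 / 5) *\<^sub>R c)"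
      by (rule norm_triangle_ineq)
    also have "\<dots> = 2 * (\<bar>x \<bullet> c\<bar> * norm x) / (5 * R\<^sup>2) + x \<bullet> x / R\<^sup>2 / 5"
      using c by (simp add: abs_mult)
    also have "\<dots> \<le> 1" using 1 2 by linarith
    finally show ?thesis .
  qed
  show "vortex R c x = (2 * ((1 - 3 * (x \<bullet> x / R\<^sup>2) / 5) / 2)) *\<^sub>R c
      + (2 * (- 3 / (10 * R\<^sup>2))) *\<^sub>R ((x \<bullet> x) *\<^sub>R c - (x \<bullet> c) *\<^sub>R x) - (2 * (- sqrt (2 - x \<bullet> x / R\<^sup>2) / (2 * R))) *\<^sub>R (c \<times> x)
      + ((2 * (1 / (5 * R\<^sup>2)) * (x \<bullet> c)) *\<^sub>R x + (x \<bullet> x / R\<^sup>2 / 5) *\<^sub>R c)" for x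
  proof -
    \<comment> \<open>Naming the root hides it from simplification, so that the componentwise
      comparison is between rational expressions.\<close>
    define k where "k = sqrt (2 - x \<bullet> x / R\<^sup>2)"
    have "vortex R c x $ i = ((2 * ((1 - 3 * (x \<bullet> x / R\<^sup>2) / 5) / 2)) *\<^sub>R c
      + (2 * (- 3 / (10 * R\<^sup>2))) *\<^sub>R ((x \<bullet> x) *\<^sub>R c - (x \<bullet> c) *\<^sub>R x) - (2 * (- k / (2 * R))) *\<^sub>R (c \<times> x)
      + ((2 * (1 / (5 * R\<^sup>2)) * (x \<bullet> c)) *\<^sub>R x + (x \<bullet> x / R\<^sup>2 / 5) *\<^sub>R c)) $ i" for i
      unfolding vortex_def k_def[symmetric]
      using R by (simp add: field_simps)
    then show ?thesis unfolding k_def[symmetric] by (simp add: vec_eq_iff)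
  qed
  fix h assume "is_demag_field (ball 0 R) (vortex R c) h"
    "\<And>x. x \<in> ball 0 R \<Longrightarrow> h x = - ((2 * (1 / (5 * R\<^sup>2)) * (x \<bullet> c)) *\<^sub>R x + (x \<bullet> x / R\<^sup>2 / 5) *\<^sub>R c)"
  then show thesis by (intro that[of h]) (auto simp: algebra_simps)
qed (use R in \<open>auto intro!: derivative_eq_intros continuous_intros simp: power2_eq_square power4_eq_xxxx\<close>)

section \<open>Uniqueness of the demagnetizing field\<close>

lemma lborel_integral_affine:
  fixes f :: "'a::euclidean_space \<Rightarrow> real"
  assumes [measurable]: "f \<in> borel_measurable borel" and c: "c \<noteq> 0"
  shows "(LINT x|lborel. f x) = \<bar>c\<bar> ^ DIM('a) * (LINT x|lborel. f (a + c *\<^sub>R x))"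
proof -
  have "(LINT x|lborel. f x) = (LINT x|density (distr lborel borel (\<lambda>x. a + c *\<^sub>R x)) (\<lambda>_. ennreal (\<bar>c\<bar> ^ DIM('a))). f x)"
    using lborel_affine[OF c, of a] by simp
  also have "\<dots> = (LINT x|distr lborel borel (\<lambda>x. a + c *\<^sub>R x). \<bar>c\<bar> ^ DIM('a) *\<^sub>R f x)"
    by (rule integral_density) auto
  also have "\<dots> = (LINT x|lborel. \<bar>c\<bar> ^ DIM('a) *\<^sub>R f (a + c *\<^sub>R x))"
    by (rule integral_distr) auto
  finally show ?thesis by simp
qed

section \<open>Test fields built from radial profiles\<close>

lemma has_derivative_radial:
  fixes a :: "'a::euclidean_space"
  assumes "(H has_real_derivative H') (at ((x - a) \<bullet> (x - a)))"
  shows "((\<lambda>x. H ((x - a) \<bullet> (x - a))) has_derivative (\<lambda>u. 2 * H' * ((x - a) \<bullet> u))) (at x)"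
proof -
  have "((\<lambda>x. (x - a) \<bullet> (x - a)) has_derivative (\<lambda>u. (x - a) \<bullet> u + u \<bullet> (x - a))) (at x)"
    by (auto intro!: derivative_eq_intros)
  moreover have "(H has_derivative (\<lambda>u. H' * u)) (at ((x - a) \<bullet> (x - a)))"
    using assms by (simp add: has_field_derivative_def)
  ultimately have "((\<lambda>x. H ((x - a) \<bullet> (x - a))) has_derivative (\<lambda>u. H' * ((x - a) \<bullet> u + u \<bullet> (x - a)))) (at x)"
    by (rule has_derivative_compose)
  then show ?thesis by (simp add: inner_commute algebra_simps)
qed

lemma gradient_radial_linear:
  fixes a e :: "real^3"
  assumes "(H has_real_derivative H') (at ((x - a) \<bullet> (x - a)))"
  shows "gradient (\<lambda>x. H ((x - a) \<bullet> (x - a)) * ((x - a) \<bullet> e)) x =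
    H ((x - a) \<bullet> (x - a)) *\<^sub>R e + (2 * H' * ((x - a) \<bullet> e)) *\<^sub>R (x - a)"
proof -
  have "((\<lambda>x. (x - a) \<bullet> e) has_derivative (\<lambda>u. u \<bullet> e)) (at x)"
    by (auto intro!: derivative_eq_intros)
  from has_derivative_mult[OF has_derivative_radial[OF assms] this]
  have "frechet_derivative (\<lambda>x. H ((x - a) \<bullet> (x - a)) * ((x - a) \<bullet> e)) (at x) =
    (\<lambda>u. H ((x - a) \<bullet> (x - a)) * (u \<bullet> e) + 2 * H' * ((x - a) \<bullet> u) * ((x - a) \<bullet> e))"
    by (rule frechet_derivative_at[symmetric])
  then show ?thesis
    by (simp add: gradient_def vec_eq_iff inner_axis inner_axis')
qed

lemma bounded_linear_cross_left: "bounded_linear (\<lambda>u::real^3. u \<times> e)"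
  using bilinear_cross unfolding bilinear_def by (auto intro: linear_linear[THEN iffD2])

lemma curl_radial_cross:
  fixes a e :: "real^3"
  assumes "(H has_real_derivative H') (at ((x - a) \<bullet> (x - a)))"
  shows "curl (\<lambda>x. H ((x - a) \<bullet> (x - a)) *\<^sub>R ((x - a) \<times> e)) x =
    - (2 * H ((x - a) \<bullet> (x - a))) *\<^sub>R e
    + (2 * H') *\<^sub>R (((x - a) \<bullet> e) *\<^sub>R (x - a) - ((x - a) \<bullet> (x - a)) *\<^sub>R e)"
proof -
  have "((\<lambda>x. (x - a) \<times> e) has_derivative (\<lambda>u. u \<times> e)) (at x)"
    by (rule bounded_linear.has_derivative[OF bounded_linear_cross_left]) (auto intro!: derivative_eq_intros)
  from has_derivative_scaleR[OF has_derivative_radial[OF assms] this]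
  have *: "frechet_derivative (\<lambda>x. H ((x - a) \<bullet> (x - a)) *\<^sub>R ((x - a) \<times> e)) (at x) =
    (\<lambda>u. H ((x - a) \<bullet> (x - a)) *\<^sub>R (u \<times> e) + (2 * H' * ((x - a) \<bullet> u)) *\<^sub>R ((x - a) \<times> e))"
    by (rule frechet_derivative_at[symmetric])
  define y where "y = x - a"
  define h where "h = H (y \<bullet> y)"
  show ?thesis
    unfolding curl_def Let_def jacobian_def matrix_def * y_def[symmetric] h_def[symmetric]
    by (simp add: vec_eq_iff forall_3 inner_axis inner_axis' cross_components)
       (simp add: axis_def inner_vec_def sum_3 algebra_simps)
qed

text \<open>This is grad div - curl curl = Laplacian for the field \<Phi> e, where H y is the
  gradient of the radial function \<Phi>. The terms along y cancel, and the remaining factor is the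
  divergence of H(|y|^2) y.\<close>

lemma inner_radial_identity:
  fixes a e w :: "real^3"
  assumes "(H has_real_derivative H') (at ((x - a) \<bullet> (x - a)))"
  shows "w \<bullet> gradient (\<lambda>x. H ((x - a) \<bullet> (x - a)) * ((x - a) \<bullet> e)) x
    - w \<bullet> curl (\<lambda>x. H ((x - a) \<bullet> (x - a)) *\<^sub>R ((x - a) \<times> e)) x
    = (w \<bullet> e) * (3 * H ((x - a) \<bullet> (x - a)) + 2 * ((x - a) \<bullet> (x - a)) * H')"
  unfolding gradient_radial_linear[OF assms] curl_radial_cross[OF assms]
  by (simp add: inner_add_right inner_diff_right algebra_simps)

lemma L2_inner_integrable:
  assumes u: "u \<in> L2_space M" and v: "v \<in> L2_space M"
  shows "integrable M (\<lambda>x. u x \<bullet> v x)"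
proof (rule Bochner_Integration.integrable_bound)
  show "integrable M (\<lambda>x. (norm (u x))\<^sup>2 + (norm (v x))\<^sup>2)"
    using u v by (simp add: L2_space_def)
  have "u \<in> borel_measurable M" "v \<in> borel_measurable M" using u v by (auto simp: L2_space_def)
  then show "(\<lambda>x. u x \<bullet> v x) \<in> borel_measurable M" by (rule borel_measurable_inner)
  show "AE x in M. norm (u x \<bullet> v x) \<le> norm ((norm (u x))\<^sup>2 + (norm (v x))\<^sup>2)"
  proof (rule AE_I2)
    fix x
    have "\<bar>u x \<bullet> v x\<bar> \<le> norm (u x) * norm (v x)" by (rule Cauchy_Schwarz_ineq2)
    also have "2 * (norm (u x) * norm (v x)) \<le> (norm (u x))\<^sup>2 + (norm (v x))\<^sup>2"
      using sum_squares_bound[of "norm (u x)" "norm (v x)"] by simp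
    finally show "norm (u x \<bullet> v x) \<le> norm ((norm (u x))\<^sup>2 + (norm (v x))\<^sup>2)" by simp
  qed
qed

lemma L2_space_add: 
  assumes u: "u \<in> L2_space M" and v: "v \<in> L2_space M"
  shows "(\<lambda>x. u x + v x) \<in> L2_space M"
proof -
  have "integrable M (\<lambda>x. (norm (u x))\<^sup>2 + (norm (v x))\<^sup>2 + 2 * (u x \<bullet> v x))"
    using u v L2_inner_integrable[OF u v] by (simp add: L2_space_def)
  moreover have "(norm (u x + v x))\<^sup>2 = (norm (u x))\<^sup>2 + (norm (v x))\<^sup>2 + 2 * (u x \<bullet> v x)" for x
    by (simp add: power2_norm_eq_inner inner_add_left inner_add_right inner_commute)
  ultimately show ?thesis using u v by (simp add: L2_space_def borel_measurable_add)
qed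

lemma L2_space_uminus: "u \<in> L2_space M \<Longrightarrow> (\<lambda>x. - u x) \<in> L2_space M"
  by (simp add: L2_space_def)

lemma L2_space_continuous_bounded_support:
  fixes k :: "real^3 \<Rightarrow> real^3"
  assumes k: "continuous_on UNIV k" and supp: "\<And>x. norm x > r \<Longrightarrow> k x = 0"
  shows "k \<in> L2_space lebesgue"
proof -
  have m: "k \<in> borel_measurable borel" by (rule borel_measurable_continuous_onI[OF k])
  have "integrable lborel (\<lambda>x. (norm (k x))\<^sup>2)"
    by (rule integrable_continuous_bounded_support[where r=r]) (use supp in \<open>auto intro!: continuous_intros k\<close>)
  then show ?thesis using m by (simp add: L2_space_def integrable_completion measurable_completion)
qed

text \<open>Splitting the integrals in the field equations requires each part to be integrable, as
  the integral of a non-integrable function is 0 by convention. Square integrability of the test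
  gradient secures this for every L2 field.\<close>

lemma L2_gradient_test:
  assumes "test_function \<phi>" shows "gradient \<phi> \<in> L2_space lebesgue"
proof -
  obtain r where \<phi>: "\<And>x. (\<phi> has_derivative frechet_derivative \<phi> (at x)) (at x)"
    "\<And>v. continuous_on UNIV (\<lambda>x. frechet_derivative \<phi> (at x) v)" "\<And>x. norm x > r \<Longrightarrow> \<phi> x = 0"
    using assms by (rule test_functionD) (rule that)
  show ?thesis
  proof (rule L2_space_continuous_bounded_support)
    show "continuous_on UNIV (gradient \<phi>)"
      unfolding gradient_def[abs_def] by (intro continuous_on_vec_lambda \<phi>(2))
    show "gradient \<phi> x = 0" if "norm x > r" for x
      using bounded_support_derivative[OF \<phi>(1) \<phi>(3) that] by (simp add: gradient_def vec_eq_iff)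
  qed
qed

lemma L2_curl_test:
  assumes "test_function \<psi>" shows "curl \<psi> \<in> L2_space lebesgue"
proof -
  obtain r where \<psi>: "\<And>x. (\<psi> has_derivative frechet_derivative \<psi> (at x)) (at x)"
    "\<And>v. continuous_on UNIV (\<lambda>x. frechet_derivative \<psi> (at x) v)" "\<And>x. norm x > r \<Longrightarrow> \<psi> x = 0"
    using assms by (rule test_functionD) (rule that)
  let ?d = "\<lambda>x i k. frechet_derivative \<psi> (at x) (axis k 1) $ i"
  have c: "curl \<psi> = (\<lambda>x. (?d x 3 2 - ?d x 2 3) *\<^sub>R axis 1 1 + (?d x 1 3 - ?d x 3 1) *\<^sub>R axis 2 1
      + (?d x 2 1 - ?d x 1 2) *\<^sub>R axis 3 1)"
    by (simp add: fun_eq_iff vec_eq_iff forall_3 axis_def curl_def Let_def jacobian_def matrix_def)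
  show ?thesis
  proof (rule L2_space_continuous_bounded_support)
    show "continuous_on UNIV (curl \<psi>)"
      unfolding c by (intro continuous_intros \<psi>(2))
    show "curl \<psi> x = 0" if "norm x > r" for x
      using bounded_support_derivative[OF \<psi>(1) \<psi>(3) that] by (simp add: c vec_eq_iff)
  qed
qed

lemma flat_nonneg: "0 \<le> flat k u" by (simp add: flat_def)

lemma flat_0_le: "flat 0 u \<le> 1" by (simp add: flat_def)

lemma flat_2_le: "flat 2 u \<le> 2"
proof (cases "u > 0")
  case True
  define z where "z = inverse u"
  have z: "z > 0" using True by (simp add: z_def)
  have "z\<^sup>2 / 2 \<le> exp z" using exp_lower_Taylor_quadratic[of z] z by simp
  then have "exp (- z) * z\<^sup>2 \<le> 2" by (simp add: exp_minus field_simps)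
  then show ?thesis using True by (simp add: flat_def z_def)
qed (simp add: flat_def)

text \<open>H is the regularised kernel times a cutoff vanishing for |y| \<ge> R. The shift by
  \<open>\<epsilon>\<^sup>2\<close> keeps the base of the power positive at y = 0, so H(|y|^2) is
  smooth there. The second summand is the error from differentiating the cutoff.\<close>

lemma radial_cutoff_identity:
  fixes w :: "real^3 \<Rightarrow> real^3" and a e :: "real^3"
  assumes w: "w \<in> L2_space lebesgue" and div: "distr_div_zero w" and curl: "distr_curl_zero w"
    and \<epsilon>: "\<epsilon> > 0" and R: "R > 0"
  defines "s \<equiv> \<lambda>x. (x - a) \<bullet> (x - a)"
  shows "(LINT x|lebesgue. (w x \<bullet> e) * (3 * \<epsilon>\<^sup>2 * (s x + \<epsilon>\<^sup>2) powr (-5/2) * flat 0 (1 - s x / R\<^sup>2)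
     - 2 * s x * (s x + \<epsilon>\<^sup>2) powr (-3/2) * flat 2 (1 - s x / R\<^sup>2) / R\<^sup>2)) = 0"
proof -
  define H where "H t = (t + \<epsilon>\<^sup>2) powr (-3/2) * flat 0 (1 - t / R\<^sup>2)" for t
  define H' where "H' t = - (3/2) * (t + \<epsilon>\<^sup>2) powr (-5/2) * flat 0 (1 - t / R\<^sup>2)
      - (t + \<epsilon>\<^sup>2) powr (-3/2) * flat 2 (1 - t / R\<^sup>2) / R\<^sup>2" for t
  have s0: "s x \<ge> 0" for x by (simp add: s_def)
  have dH: "(H has_real_derivative H' t) (at t)" if "t \<ge> 0" for t
  proof -
    have pos: "t + \<epsilon>\<^sup>2 > 0" using that \<epsilon> by (simp add: add_nonneg_pos)
    \<comment> \<open>At index 0 the \<open>flat 1\<close> term has coefficient 0, so only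
      \<open>flat 2\<close> remains.\<close>
    have f: "(flat 0 has_real_derivative flat 2 (1 - t / R\<^sup>2)) (at (1 - t / R\<^sup>2))"
      using DERIV_flat[of 0 "1 - t / R\<^sup>2"] by (simp add: numeral_2_eq_2)
    have A: "((\<lambda>t. flat 0 (1 - t / R\<^sup>2)) has_real_derivative flat 2 (1 - t / R\<^sup>2) * - (1 / R\<^sup>2)) (at t)"
      by (rule DERIV_chain2[where f="flat 0" and g="\<lambda>t. 1 - t / R\<^sup>2", OF f])
         (use R in \<open>auto intro!: derivative_eq_intros simp: power2_eq_square\<close>)
    have B: "((\<lambda>t. (t + \<epsilon>\<^sup>2) powr (-3/2)) has_real_derivative (-3/2) * (t + \<epsilon>\<^sup>2) powr (-5/2)) (at t)"
      using pos by (auto intro!: derivative_eq_intros)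
    show ?thesis unfolding H_def[abs_def] H'_def
      by (rule DERIV_cong[OF DERIV_mult'[OF B A]]) (simp add: algebra_simps)
  qed
  have CH: "C_order k (\<lambda>x. H (s x))" for k
  proof -
    have cs: "C_order k s" unfolding s_def by (rule C_order_inner_shift)
    have "C_order k (\<lambda>x. (s x + \<epsilon>\<^sup>2) powr (-3/2))"
      by (rule C_order_powr) (use s0 \<epsilon> in \<open>simp add: add_nonneg_pos\<close>, intro C_order_add cs C_order_const)
    moreover have "C_order k (\<lambda>x. 1 + (- 1 / R\<^sup>2) * s x)"
      by (intro C_order_add C_order_const C_order_linear[OF bounded_linear_mult_right] cs)
    from C_order_flat[OF this, of 0] have "C_order k (\<lambda>x. flat 0 (1 - s x / R\<^sup>2))" by simp
    ultimately show ?thesis unfolding H_def by (rule C_order_bilinear[OF bounded_bilinear_mult])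
  qed
  have H0: "H (s x) = 0" if "norm x > norm a + R" for x
  proof -
    have "R \<le> norm (x - a)" using that norm_triangle_ineq2[of x a] by linarith
    then have "R\<^sup>2 \<le> s x" using R by (simp add: s_def power_mono flip: power2_norm_eq_inner)
    then have "1 - s x / R\<^sup>2 \<le> 0" using R by (simp add: field_simps)
    then show ?thesis by (simp add: H_def flat_def)
  qed
  let ?\<phi> = "\<lambda>x. H (s x) * ((x - a) \<bullet> e)" and ?\<psi> = "\<lambda>x. H (s x) *\<^sub>R ((x - a) \<times> e)"
  have t1: "test_function ?\<phi>"
    by (rule test_functionI[where r="norm a + R"])
       (rule C_order_bilinear[OF bounded_bilinear_mult CH C_order_linear[OF bounded_linear_inner_left C_order_shift]],
        simp add: H0)
  have t2: "test_function ?\<psi>"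
    by (rule test_functionI[where r="norm a + R"])
       (rule C_order_bilinear[OF bounded_bilinear_scaleR CH C_order_linear[OF bounded_linear_cross_left C_order_shift]],
        simp add: H0)
  have "(LINT x|lebesgue. w x \<bullet> gradient ?\<phi> x - w x \<bullet> curl ?\<psi> x) = 0"
    using div curl t1 t2 unfolding distr_div_zero_def distr_curl_zero_def
    by (subst Bochner_Integration.integral_diff[OF L2_inner_integrable[OF w L2_gradient_test[OF t1]]
          L2_inner_integrable[OF w L2_curl_test[OF t2]]]) simp
  moreover have "w x \<bullet> gradient ?\<phi> x - w x \<bullet> curl ?\<psi> x =
     (w x \<bullet> e) * (3 * \<epsilon>\<^sup>2 * (s x + \<epsilon>\<^sup>2) powr (-5/2) * flat 0 (1 - s x / R\<^sup>2)
     - 2 * s x * (s x + \<epsilon>\<^sup>2) powr (-3/2) * flat 2 (1 - s x / R\<^sup>2) / R\<^sup>2)" for x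
  proof -
    have pos: "s x + \<epsilon>\<^sup>2 > 0" using s0 \<epsilon> by (simp add: add_nonneg_pos)
    have p: "(s x + \<epsilon>\<^sup>2) powr (-3/2) = (s x + \<epsilon>\<^sup>2) * (s x + \<epsilon>\<^sup>2) powr (-5/2)"
      using pos powr_add[of "s x + \<epsilon>\<^sup>2" 1 "-5/2"] by simp
    define A where "A = (s x + \<epsilon>\<^sup>2) powr (-5/2)"
    define B where "B = (s x + \<epsilon>\<^sup>2) powr (-3/2)"
    have "3 * H (s x) + 2 * s x * H' (s x) = 3 * (B - s x * A) * flat 0 (1 - s x / R\<^sup>2)
        - 2 * s x * B * flat 2 (1 - s x / R\<^sup>2) / R\<^sup>2"
      unfolding H_def H'_def A_def B_def by (simp add: algebra_simps)
    \<comment> \<open>Only the regularisation survives here: for \<epsilon> = 0 the right side would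
      vanish, as 1/|y| is harmonic away from the origin.\<close>
    also have "B - s x * A = \<epsilon>\<^sup>2 * A" unfolding B_def p A_def by (simp add: algebra_simps)
    finally have "3 * H (s x) + 2 * s x * H' (s x) = 3 * \<epsilon>\<^sup>2 * A * flat 0 (1 - s x / R\<^sup>2)
        - 2 * s x * B * flat 2 (1 - s x / R\<^sup>2) / R\<^sup>2" by simp
    then show ?thesis
      using inner_radial_identity[OF dH[OF s0[of x], unfolded s_def], of "w x" e] unfolding s_def A_def B_def by simp
  qed
  ultimately show ?thesis by simp
qed

text \<open>In dimension three this weight is square integrable though not integrable. Paired with
  an L2 field it gives a majorant independent of the cutoff radius.\<close>

lemma L2_space_shifted_decay:
  fixes a e :: "real^3"
  shows "(\<lambda>x. (1 / (1 + (x - a) \<bullet> (x - a))) *\<^sub>R e) \<in> L2_space lebesgue"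
proof (rule L2_space_decay)
  show "(\<lambda>x. (1 / (1 + (x - a) \<bullet> (x - a))) *\<^sub>R e) \<in> borel_measurable borel" by measurable
  fix x :: "real^3"
  have "x \<bullet> x \<le> 2 * ((x - a) \<bullet> (x - a)) + 2 * (a \<bullet> a)"
  proof -
    \<comment> \<open>The difference of the two sides of the desired bound is exactly |x -
      2a|^2.\<close>
    have "0 \<le> (x - 2 *\<^sub>R a) \<bullet> (x - 2 *\<^sub>R a)" by simp
    then show ?thesis by (simp add: inner_diff_left inner_diff_right inner_commute algebra_simps)
  qed
  also have "\<dots> \<le> 2 * (1 + a \<bullet> a) * (1 + (x - a) \<bullet> (x - a)) - 2"
  proof -
    have "2 * s + 2 * t \<le> 2 * (1 + t) * (1 + s) - 2" if "0 \<le> s" "0 \<le> t" for s t :: real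
      using mult_nonneg_nonneg[OF that] by (simp add: algebra_simps)
    then show ?thesis by simp
  qed
  finally have "1 + x \<bullet> x \<le> 2 * (1 + a \<bullet> a) * (1 + (x - a) \<bullet> (x - a))" by linarith
  moreover have "0 < 1 + (x - a) \<bullet> (x - a)" "0 < 1 + x \<bullet> x" by (simp_all add: add_pos_nonneg)
  ultimately have "1 / (1 + (x - a) \<bullet> (x - a)) \<le> 2 * (1 + a \<bullet> a) / (1 + x \<bullet> x)"
    by (simp add: pos_divide_le_eq pos_le_divide_eq)
  then have "1 / (1 + (x - a) \<bullet> (x - a)) * norm e \<le> 2 * (1 + a \<bullet> a) / (1 + x \<bullet> x) * norm e"
    by (rule mult_right_mono) simp
  moreover have "norm ((1 / (1 + (x - a) \<bullet> (x - a))) *\<^sub>R e) = 1 / (1 + (x - a) \<bullet> (x - a)) * norm e"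
    by (simp add: abs_of_nonneg)
  ultimately show "norm ((1 / (1 + (x - a) \<bullet> (x - a))) *\<^sub>R e) \<le> (2 * (1 + a \<bullet> a) * norm e) / (1 + x \<bullet> x)"
    by simp
qed

text \<open>Up to the constant 3 \<open>\<epsilon>\<^sup>2\<close>, the kernel is minus the
  Laplacian of \<open>(|y|^2 + eps^2) powr (-1/2)\<close>, the Plummer density. The cutoff radius is
  sent to infinity with \<epsilon> fixed.\<close>

lemma poisson_kernel_orthogonal:
  fixes w :: "real^3 \<Rightarrow> real^3" and a e :: "real^3"
  assumes w: "w \<in> L2_space lebesgue" and div: "distr_div_zero w" and curl: "distr_curl_zero w"
    and \<epsilon>: "0 < \<epsilon>" "\<epsilon> \<le> 1"
  shows "(LINT x|lebesgue. (w x \<bullet> e) * ((x - a) \<bullet> (x - a) + \<epsilon>\<^sup>2) powr (-5/2)) = 0"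
proof -
  define s where "s x = (x - a) \<bullet> (x - a)" for x
  define q where "q x = s x + \<epsilon>\<^sup>2" for x
  define R where "R n = real (Suc n)" for n
  define T where "T n x = 3 * \<epsilon>\<^sup>2 * q x powr (-5/2) * flat 0 (1 - s x / (R n)\<^sup>2)
     - 2 * s x * q x powr (-3/2) * flat 2 (1 - s x / (R n)\<^sup>2) / (R n)\<^sup>2" for n x
  have s0: "0 \<le> s x" for x by (simp add: s_def)
  have q0: "\<epsilon>\<^sup>2 \<le> q x" "0 < q x" for x using s0[of x] \<epsilon> by (simp_all add: q_def add_nonneg_pos)
  have R: "1 \<le> R n" for n by (simp add: R_def)
  \<comment> \<open>11 = 3 + 8: the kernel term contributes 3, the cutoff error 8.\<close>
  have bound: "\<bar>T n x\<bar> \<le> 11 / \<epsilon> ^ 3 * (1 / (1 + s x))" for n x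
  proof -
    define r where "r = q x powr (-1/2)"
    have r: "0 < r" "r \<le> 1 / \<epsilon>"
    proof -
      show "0 < r" using q0[of x] by (simp add: r_def)
      have "r \<le> (\<epsilon>\<^sup>2) powr (-1/2)" unfolding r_def by (rule powr_mono2') (use q0[of x] \<epsilon> in auto)
      also have "\<dots> = inverse (sqrt (\<epsilon>\<^sup>2))"
        by (simp only: minus_divide_left[symmetric] powr_minus powr_half_sqrt[OF zero_le_power2])
      also have "\<dots> = 1 / \<epsilon>" using \<epsilon> by (simp add: inverse_eq_divide)
      finally show "r \<le> 1 / \<epsilon>" .
    qed
    have p3: "q x powr (-3/2) = r / q x"
      using q0[of x] powr_diff[of "q x" "-1/2" 1] by (simp add: r_def)
    have p5: "q x powr (-5/2) = r / q x / q x"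
      using q0[of x] powr_diff[of "q x" "-3/2" 1] p3 by simp
    have q1: "1 / q x \<le> 1 / \<epsilon>\<^sup>2 * (1 / (1 + s x))"
    proof -
      have "\<epsilon>\<^sup>2 * s x \<le> 1 * s x" using \<epsilon> s0[of x] by (intro mult_right_mono power_le_one) auto
      then have "\<epsilon>\<^sup>2 * (1 + s x) \<le> q x" by (simp add: q_def algebra_simps)
      moreover have "0 < \<epsilon>\<^sup>2 * (1 + s x)" using \<epsilon> s0[of x] by (intro mult_pos_pos) auto
      ultimately have "1 / q x \<le> 1 / (\<epsilon>\<^sup>2 * (1 + s x))" using q0[of x] by (intro divide_left_mono) auto
      then show ?thesis by simp
    qed
    have rq: "r / q x \<le> 1 / \<epsilon> ^ 3 * (1 / (1 + s x))"
    proof -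
      have "r * (1 / q x) \<le> 1 / \<epsilon> * (1 / \<epsilon>\<^sup>2 * (1 / (1 + s x)))"
        using r q1 q0[of x] \<epsilon> by (intro mult_mono) auto
      then show ?thesis by (simp add: power3_eq_cube power2_eq_square)
    qed
    have 1: "\<bar>3 * \<epsilon>\<^sup>2 * q x powr (-5/2) * flat 0 (1 - s x / (R n)\<^sup>2)\<bar> \<le> 3 * (r / q x)"
    proof -
      have "\<epsilon>\<^sup>2 * q x powr (-5/2) = (r / q x) * (\<epsilon>\<^sup>2 / q x)" unfolding p5 by simp
      also have "\<dots> \<le> (r / q x) * 1" using r q0[of x] by (intro mult_left_mono) auto
      finally have "\<epsilon>\<^sup>2 * q x powr (-5/2) * flat 0 (1 - s x / (R n)\<^sup>2) \<le> (r / q x) * 1"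
        using r q0[of x] by (intro mult_mono flat_0_le flat_nonneg) auto
      moreover have "0 \<le> \<epsilon>\<^sup>2 * q x powr (-5/2) * flat 0 (1 - s x / (R n)\<^sup>2)" by (simp add: flat_nonneg)
      ultimately show ?thesis by (simp add: mult.assoc)
    qed
    \<comment> \<open>The cutoff error lives on s < R^2, where q \<le> 2 R^2; thus 1/R^2 becomes
      decay in x, uniformly in n. The constant is 2 * 2 * 2: the prefactor, the bound for
      \<open>flat 2\<close>, and this comparison.\<close>
    have 2: "\<bar>2 * s x * q x powr (-3/2) * flat 2 (1 - s x / (R n)\<^sup>2) / (R n)\<^sup>2\<bar> \<le> 8 * (r / q x)"
    proof (cases "s x < (R n)\<^sup>2")
      case True
      have "\<epsilon>\<^sup>2 \<le> 1" using \<epsilon> by (simp add: power_le_one)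
      moreover have "1 \<le> (R n)\<^sup>2" using R[of n] by (simp add: one_le_power)
      ultimately have "q x \<le> 2 * (R n)\<^sup>2" using True by (simp add: q_def)
      then have R2: "1 / (R n)\<^sup>2 \<le> 2 / q x" using R[of n] q0[of x] by (simp add: field_simps)
      have "s x * q x powr (-3/2) = r * (s x / q x)" unfolding p3 by simp
      also have "\<dots> \<le> r * 1" using r q0[of x] s0[of x] by (intro mult_left_mono) (auto simp: q_def)
      finally have sp: "s x * q x powr (-3/2) \<le> r * 1" .
      have "s x * q x powr (-3/2) * flat 2 (1 - s x / (R n)\<^sup>2) * (1 / (R n)\<^sup>2) \<le> r * 1 * 2 * (2 / q x)"
        by (rule mult_mono[OF mult_mono[OF sp flat_2_le] R2]) (use r s0[of x] in \<open>simp_all add: flat_nonneg\<close>)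
      moreover have "0 \<le> s x * q x powr (-3/2) * flat 2 (1 - s x / (R n)\<^sup>2) * (1 / (R n)\<^sup>2)"
        using s0[of x] by (simp add: flat_nonneg)
      ultimately show ?thesis by (simp add: mult.assoc)
    next
      case False
      then have "1 - s x / (R n)\<^sup>2 \<le> 0" using R[of n] by (simp add: field_simps)
      then show ?thesis using r q0[of x] by (simp add: flat_def)
    qed
    have "\<bar>T n x\<bar> \<le> 11 * (r / q x)" unfolding T_def using 1 2 by linarith
    also have "\<dots> \<le> 11 * (1 / \<epsilon> ^ 3 * (1 / (1 + s x)))" using rq by (intro mult_left_mono) auto
    finally show ?thesis by simp
  qed
  \<comment> \<open>The cutoff tends to \<open>flat 0 1\<close>, which is exp(-1) and not 1; the
    harmless factor is divided out at the end.\<close>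
  have lim: "(\<lambda>n. T n x) \<longlonglongrightarrow> 3 * \<epsilon>\<^sup>2 * exp (-1) * q x powr (-5/2)" for x
  proof -
    have i: "(\<lambda>n. 1 / (R n)\<^sup>2) \<longlonglongrightarrow> 0"
      using tendsto_power[OF LIMSEQ_inverse_real_of_nat, of 2]
      by (simp add: R_def inverse_eq_divide power_one_over del: of_nat_Suc)
    have "(\<lambda>n. 1 - s x * (1 / (R n)\<^sup>2)) \<longlonglongrightarrow> 1 - s x * 0"
      by (intro tendsto_intros i)
    then have u: "(\<lambda>n. 1 - s x / (R n)\<^sup>2) \<longlonglongrightarrow> 1" by simp
    have f: "(\<lambda>n. flat k (1 - s x / (R n)\<^sup>2)) \<longlonglongrightarrow> flat k 1" for k
      by (rule isCont_tendsto_compose[OF DERIV_isCont[OF DERIV_flat] u])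
    have "(\<lambda>n. 3 * \<epsilon>\<^sup>2 * q x powr (-5/2) * flat 0 (1 - s x / (R n)\<^sup>2)
     - 2 * s x * q x powr (-3/2) * flat 2 (1 - s x / (R n)\<^sup>2) * (1 / (R n)\<^sup>2)) \<longlonglongrightarrow>
       3 * \<epsilon>\<^sup>2 * q x powr (-5/2) * flat 0 1 - 2 * s x * q x powr (-3/2) * flat 2 1 * 0"
      by (intro tendsto_intros f i)
    then show ?thesis by (simp add: T_def flat_def mult_ac)
  qed
  have wm: "(\<lambda>x. w x \<bullet> e) \<in> borel_measurable lebesgue"
    using w by (auto simp: L2_space_def)
  have sm: "s \<in> borel_measurable borel" unfolding s_def[abs_def] by measurable
  have flatm: "flat k \<in> borel_measurable borel" for k
    by (intro borel_measurable_continuous_onI continuous_at_imp_continuous_on ballI DERIV_isCont[OF DERIV_flat])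
  have Tm: "T n \<in> borel_measurable lebesgue" for n
  proof -
    note [measurable] = sm flatm
    have "T n \<in> borel_measurable borel" unfolding T_def[abs_def] q_def[abs_def] by measurable
    then show ?thesis by (intro measurable_completion) simp
  qed
  have qm: "(\<lambda>x. 3 * \<epsilon>\<^sup>2 * exp (-1) * q x powr (-5/2)) \<in> borel_measurable lebesgue"
    by (rule borel_measurable_LIMSEQ_real[OF lim Tm])
  have "(\<lambda>n. LINT x|lebesgue. (w x \<bullet> e) * T n x) \<longlonglongrightarrow>
     (LINT x|lebesgue. (w x \<bullet> e) * (3 * \<epsilon>\<^sup>2 * exp (-1) * q x powr (-5/2)))"
  proof (rule integral_dominated_convergence[where w="\<lambda>x. 11 / \<epsilon> ^ 3 * norm (w x \<bullet> ((1 / (1 + s x)) *\<^sub>R e))"])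
    show "integrable lebesgue (\<lambda>x. 11 / \<epsilon> ^ 3 * norm (w x \<bullet> ((1 / (1 + s x)) *\<^sub>R e)))"
      using L2_inner_integrable[OF w L2_space_shifted_decay[of a e]] unfolding s_def
      by (intro integrable_mult_right integrable_norm)
    show "AE x in lebesgue. (\<lambda>n. (w x \<bullet> e) * T n x) \<longlonglongrightarrow> (w x \<bullet> e) * (3 * \<epsilon>\<^sup>2 * exp (-1) * q x powr (-5/2))"
      by (intro AE_I2 tendsto_mult_left lim)
    show "AE x in lebesgue. norm ((w x \<bullet> e) * T n x) \<le> 11 / \<epsilon> ^ 3 * norm (w x \<bullet> ((1 / (1 + s x)) *\<^sub>R e))" for n
    proof (rule AE_I2)
      fix x
      have "\<bar>w x \<bullet> e\<bar> * \<bar>T n x\<bar> \<le> \<bar>w x \<bullet> e\<bar> * (11 / \<epsilon> ^ 3 * (1 / (1 + s x)))"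
        by (intro mult_left_mono bound) simp
      also have "\<dots> = 11 / \<epsilon> ^ 3 * norm (w x \<bullet> ((1 / (1 + s x)) *\<^sub>R e))"
        using s0[of x] by (simp add: abs_mult)
      finally show "norm ((w x \<bullet> e) * T n x) \<le> 11 / \<epsilon> ^ 3 * norm (w x \<bullet> ((1 / (1 + s x)) *\<^sub>R e))"
        by (simp add: abs_mult)
    qed
  qed (intro borel_measurable_times wm Tm qm)+
  moreover have "(LINT x|lebesgue. (w x \<bullet> e) * T n x) = 0" for n
    unfolding T_def q_def s_def using radial_cutoff_identity[OF w div curl \<epsilon>(1), of "R n" e a] R[of n] by simp
  ultimately have "(LINT x|lebesgue. (w x \<bullet> e) * (3 * \<epsilon>\<^sup>2 * exp (-1) * q x powr (-5/2))) = 0"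
    by (simp add: LIMSEQ_const_iff)
  moreover have "(\<lambda>x. (w x \<bullet> e) * (3 * \<epsilon>\<^sup>2 * exp (-1) * q x powr (-5/2)))
     = (\<lambda>x. (3 * \<epsilon>\<^sup>2 * exp (-1)) * ((w x \<bullet> e) * q x powr (-5/2)))"
    by (simp add: fun_eq_iff)
  ultimately have "(3 * \<epsilon>\<^sup>2 * exp (-1)) * (LINT x|lebesgue. (w x \<bullet> e) * q x powr (-5/2)) = 0"
    by simp
  then show ?thesis using \<epsilon> by (simp add: q_def s_def)
qed

section \<open>From kernel orthogonality to uniqueness\<close>

text \<open>Let J(t) be the pairing of g with W shifted by t. Fubini turns the hypothesis into: the
  integral of k(y) J(\<epsilon> y) vanishes for every small \<epsilon>. Continuity of J at 0 lets
  \<epsilon> tend to 0, leaving J(0) times the integral of k.\<close>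

lemma approximate_identity_orthogonal:
  fixes W k g :: "'a::euclidean_space \<Rightarrow> real"
  assumes W[measurable]: "W \<in> borel_measurable borel" and W2: "integrable lborel (\<lambda>x. (W x)\<^sup>2)"
    and k[measurable]: "k \<in> borel_measurable borel" and kpos: "\<And>y. k y > 0" and kint: "integrable lborel k"
    and ortho: "\<And>a \<epsilon>. 0 < \<epsilon> \<Longrightarrow> \<epsilon> \<le> 1 \<Longrightarrow> (LINT y|lborel. W (a + \<epsilon> *\<^sub>R y) * k y) = 0"
    and g[measurable]: "g \<in> borel_measurable borel" and gB: "\<And>x. \<bar>g x\<bar> \<le> B"
    and gsupp: "\<And>x. norm x > r \<Longrightarrow> g x = 0" and gcont: "AE x in lborel. isCont g x"
  shows "(LINT x|lborel. W x * g x) = 0"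
proof -
  have B0: "0 \<le> B" using gB[of 0] by linarith
  have g2: "integrable lborel (\<lambda>x. (g x)\<^sup>2)"
  proof (rule Bochner_Integration.integrable_bound)
    show "integrable lborel (\<lambda>x::'a. B\<^sup>2 * indicator (cball 0 r) x :: real)"
      by (intro integrable_mult_right integrable_real_indicator)
         (auto simp: emeasure_lborel_cball_finite[unfolded infinity_ennreal_def])
    have "norm ((g x)\<^sup>2) \<le> norm (B\<^sup>2 * indicator (cball 0 r) x :: real)" for x
      using gsupp[of x] power_mono[OF gB[of x], of 2] by (cases "norm x \<le> r") auto
    then show "AE x in lborel. norm ((g x)\<^sup>2) \<le> norm (B\<^sup>2 * indicator (cball 0 r) x :: real)" by simp
  qed simp
  have prod: "\<bar>x * y\<bar> \<le> x\<^sup>2 + y\<^sup>2" for x y :: real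
  proof -
    have "2 * (\<bar>x\<bar> * \<bar>y\<bar>) \<le> x\<^sup>2 + y\<^sup>2" using sum_squares_bound[of "\<bar>x\<bar>" "\<bar>y\<bar>"] by simp
    moreover have "0 \<le> \<bar>x\<bar> * \<bar>y\<bar>" by simp
    ultimately show ?thesis unfolding abs_mult by linarith
  qed
  define C where "C = (LINT x|lborel. (g x)\<^sup>2) + (LINT x|lborel. (W x)\<^sup>2)"
  have Wt2: "integrable lborel (\<lambda>x. (W (x + t))\<^sup>2)" for t
    by (rule lborel_integrable_translate[OF W2])
  have int_gW: "integrable lborel (\<lambda>x. g x * W (x + t))" for t
    by (rule Bochner_Integration.integrable_bound[OF Bochner_Integration.integrable_add[OF g2 Wt2[of t]]])
       (use prod in auto)
  \<comment> \<open>Translation preserves the L2 norm of W, so one constant bounds the pairing for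
    every shift; it serves both Fubini and the final dominated convergence.\<close>
  have C: "(LINT x|lborel. \<bar>g x * W (x + t)\<bar>) \<le> C" for t
  proof -
    have "(LINT x|lborel. \<bar>g x * W (x + t)\<bar>) \<le> (LINT x|lborel. (g x)\<^sup>2 + (W (x + t))\<^sup>2)"
      by (rule integral_mono) (use prod in \<open>auto intro!: int_gW g2 Wt2\<close>)
    also have "\<dots> = C"
      using lborel_integral_translate[of "\<lambda>x. (W x)\<^sup>2" t] by (simp add: C_def g2 Wt2)
    finally show ?thesis .
  qed
  define J where "J t = (LINT x|lborel. g x * W (x + t))" for t
  have JC: "\<bar>J t\<bar> \<le> C" for t
    unfolding J_def using integral_abs_bound[of lborel "\<lambda>x. g x * W (x + t)"] C[of t] by linarith
  have Jm[measurable]: "J \<in> borel_measurable borel"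
    unfolding J_def[abs_def] by measurable
  have Jint: "(LINT y|lborel. k y * J (\<epsilon> *\<^sub>R y)) = 0" if \<epsilon>: "0 < \<epsilon>" "\<epsilon> \<le> 1" for \<epsilon>
  proof -
    define F where "F y x = k y * (g x * W (x + \<epsilon> *\<^sub>R y))" for y x
    have "integrable (lborel \<Otimes>\<^sub>M lborel) (case_prod F)"
    proof (rule lborel_pair.Fubini_integrable)
      show "case_prod F \<in> borel_measurable (lborel \<Otimes>\<^sub>M lborel)" unfolding F_def by measurable
      have "integrable lborel (\<lambda>y. k y * (LINT x|lborel. \<bar>g x * W (x + \<epsilon> *\<^sub>R y)\<bar>))"
      proof (rule Bochner_Integration.integrable_bound)
        show "integrable lborel (\<lambda>y. k y * C)" using kint by simp
        have "norm (k y * (LINT x|lborel. \<bar>g x * W (x + \<epsilon> *\<^sub>R y)\<bar>)) \<le> norm (k y * C)" for y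
        proof -
          have "0 \<le> (LINT x|lborel. \<bar>g x * W (x + \<epsilon> *\<^sub>R y)\<bar>)" by (rule Bochner_Integration.integral_nonneg) simp
          then show ?thesis using C[of "\<epsilon> *\<^sub>R y"] kpos[of y] by (simp add: abs_mult)
        qed
        then show "AE y in lborel. norm (k y * (LINT x|lborel. \<bar>g x * W (x + \<epsilon> *\<^sub>R y)\<bar>)) \<le> norm (k y * C)" by simp
      qed measurable
      moreover have "(LINT x|lborel. norm (F y x)) = k y * (LINT x|lborel. \<bar>g x * W (x + \<epsilon> *\<^sub>R y)\<bar>)" for y
        using kpos[of y] by (simp add: F_def abs_mult)
      ultimately show "integrable lborel (\<lambda>y. LINT x|lborel. norm (case_prod F (y, x)))" by simp
      show "AE y in lborel. integrable lborel (\<lambda>x. case_prod F (y, x))"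
        unfolding F_def by (simp add: int_gW)
    qed
    then have "(LINT x|lborel. LINT y|lborel. F y x) = (LINT y|lborel. LINT x|lborel. F y x)"
      by (rule lborel_pair.Fubini_integral)
    moreover have "(LINT y|lborel. F y x) = 0" for x
    proof -
      have "(LINT y|lborel. F y x) = g x * (LINT y|lborel. W (x + \<epsilon> *\<^sub>R y) * k y)"
        unfolding F_def by (simp flip: integral_mult_right_zero add: mult_ac)
      then show ?thesis using ortho[OF \<epsilon>] by simp
    qed
    moreover have "(LINT x|lborel. F y x) = k y * J (\<epsilon> *\<^sub>R y)" for y
      unfolding F_def J_def by simp
    ultimately show ?thesis by simp
  qed
  have Jlim: "(\<lambda>n. J (t n)) \<longlonglongrightarrow> J 0" if t: "t \<longlonglongrightarrow> 0" "\<And>n. norm (t n) \<le> T" for t T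
  proof -
    \<comment> \<open>The shift is moved from W to g: W is merely square integrable, whereas g is
      bounded and continuous almost everywhere, so its shifts converge pointwise almost everywhere
      under a fixed majorant.\<close>
    have sub: "J u = (LINT x|lborel. g (x - u) * W x)" for u
      using lborel_integral_translate[of "\<lambda>x. g (x - u) * W x" u] by (simp add: J_def)
    show ?thesis
      unfolding sub
    proof (rule integral_dominated_convergence[where w="\<lambda>x. (W x)\<^sup>2 + B\<^sup>2 * indicator (cball 0 (r + T)) x"])
      show "integrable lborel (\<lambda>x. (W x)\<^sup>2 + B\<^sup>2 * indicator (cball 0 (r + T)) x)"
        by (intro Bochner_Integration.integrable_add W2 integrable_mult_right integrable_real_indicator)
           (auto simp: emeasure_lborel_cball_finite[unfolded infinity_ennreal_def])
      show "AE x in lborel. (\<lambda>n. g (x - t n) * W x) \<longlonglongrightarrow> g (x - 0) * W x"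
        using gcont
      proof eventually_elim
        case (elim x)
        have "(\<lambda>n. x - t n) \<longlonglongrightarrow> x - 0" by (intro tendsto_intros t(1))
        then have "(\<lambda>n. g (x - t n)) \<longlonglongrightarrow> g x"
          using isCont_tendsto_compose[OF elim] by simp
        then show ?case by (simp add: tendsto_mult_right)
      qed
      show "AE x in lborel. norm (g (x - t n) * W x) \<le> (W x)\<^sup>2 + B\<^sup>2 * indicator (cball 0 (r + T)) x" for n
      proof (rule AE_I2)
        fix x
        show "norm (g (x - t n) * W x) \<le> (W x)\<^sup>2 + B\<^sup>2 * indicator (cball 0 (r + T)) x"
        proof (cases "norm x \<le> r + T")
          case True
          have "\<bar>g (x - t n) * W x\<bar> \<le> (g (x - t n))\<^sup>2 + (W x)\<^sup>2" by (rule prod)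
          moreover have "(g (x - t n))\<^sup>2 \<le> B\<^sup>2" using power_mono[OF gB[of "x - t n"], of 2] by simp
          ultimately show ?thesis using True by simp
        next
          case False
          then have "norm (x - t n) > r" using norm_triangle_ineq2[of x "t n"] t(2)[of n] by linarith
          then show ?thesis using False by (simp add: gsupp)
        qed
      qed
    qed measurable
  qed
  define \<epsilon> where "\<epsilon> n = inverse (real (Suc n))" for n
  have \<epsilon>: "0 < \<epsilon> n" "\<epsilon> n \<le> 1" "\<epsilon> \<longlonglongrightarrow> 0" for n
    unfolding \<epsilon>_def using LIMSEQ_inverse_real_of_nat by (auto simp: inverse_eq_divide)
  have "(\<lambda>n. LINT y|lborel. k y * J (\<epsilon> n *\<^sub>R y)) \<longlonglongrightarrow> (LINT y|lborel. k y * J 0)"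
  proof (rule integral_dominated_convergence[where w="\<lambda>y. k y * C"])
    show "AE y in lborel. (\<lambda>n. k y * J (\<epsilon> n *\<^sub>R y)) \<longlonglongrightarrow> k y * J 0"
    proof (intro AE_I2 tendsto_mult_left Jlim)
      fix y :: 'a
      show "(\<lambda>n. \<epsilon> n *\<^sub>R y) \<longlonglongrightarrow> 0" using tendsto_scaleR[OF \<epsilon>(3) tendsto_const[of y]] by simp
      show "norm (\<epsilon> n *\<^sub>R y) \<le> norm y" for n
        using mult_right_mono[OF \<epsilon>(2)[of n], of "norm y"] \<epsilon>(1)[of n] by simp
    qed
    show "AE y in lborel. norm (k y * J (\<epsilon> n *\<^sub>R y)) \<le> k y * C" for n
      using JC kpos by (intro AE_I2) (simp add: abs_mult less_imp_le)
  qed (use kint in auto)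
  then have "(LINT y|lborel. k y * J 0) = 0" using Jint[OF \<epsilon>(1,2)] by (simp add: LIMSEQ_const_iff)
  then have "(LINT y|lborel. k y) * J 0 = 0" by simp
  \<comment> \<open>A positive function with zero integral would make the whole space a null
    set.\<close>
  moreover have "(LINT y|lborel. k y) \<noteq> 0"
  proof
    assume "(LINT y|lborel. k y) = 0"
    then have "AE y in lborel. k y = 0"
      using integral_nonneg_eq_0_iff_AE[OF kint] kpos by (simp add: less_imp_le)
    then have "AE y::'a in lborel. False" by eventually_elim (use kpos in \<open>metis less_irrefl\<close>)
    then show False by (auto simp: eventually_ae_filter null_sets_def dest!: subset_antisym[OF subset_UNIV])
  qed
  ultimately show ?thesis by (simp add: J_def mult.commute)
qed

text \<open>An L2 field is only Lebesgue measurable. Translations, dilations and Fubini on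
  \<open>lborel\<close> call for a Borel representative, taken separately for each direction
  e.\<close>

lemma completion_ex_borel_inner:
  fixes w :: "real^3 \<Rightarrow> real^3"
  assumes "w \<in> borel_measurable lebesgue"
  obtains W where "W \<in> borel_measurable borel" "AE x in lborel. w x \<bullet> e = W x"
proof -
  have "(\<lambda>x. w x \<bullet> e) \<in> borel_measurable lebesgue" using assms by auto
  then obtain W where "W \<in> borel_measurable lborel" "AE x in lborel. w x \<bullet> e = W x"
    using completion_ex_borel_measurable_real[of "\<lambda>x. w x \<bullet> e" lborel] by blast
  then show thesis by (intro that[of W]) auto
qed

lemma L2_div_curl_free_orthogonal:
  fixes w :: "real^3 \<Rightarrow> real^3" and g :: "real^3 \<Rightarrow> real"
  assumes w: "w \<in> L2_space lebesgue" and div: "distr_div_zero w" and curl: "distr_curl_zero w"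
    and g: "g \<in> borel_measurable borel" "\<And>x. \<bar>g x\<bar> \<le> B" "\<And>x. norm x > r \<Longrightarrow> g x = 0"
      "AE x in lborel. isCont g x"
  shows "(LINT x|lebesgue. (w x \<bullet> e) * g x) = 0"
proof -
  have wm: "w \<in> borel_measurable lebesgue" using w by (simp add: L2_space_def)
  obtain W where W[measurable]: "W \<in> borel_measurable borel" and WA: "AE x in lborel. w x \<bullet> e = W x"
    using completion_ex_borel_inner[OF wm] .
  have WL: "AE x in lebesgue. w x \<bullet> e = W x" by (rule AE_completion[OF WA])
  have we: "(\<lambda>x. w x \<bullet> e) \<in> borel_measurable lebesgue" using wm by auto
  have WmL: "W \<in> borel_measurable lebesgue" by (rule measurable_completion) simp
  have transfer: "(LINT x|lebesgue. (w x \<bullet> e) * f x) = (LINT x|lborel. W x * f x)"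
    if f[measurable]: "f \<in> borel_measurable borel" for f
  proof -
    have fL: "f \<in> borel_measurable lebesgue" by (rule measurable_completion) simp
    have "(LINT x|lebesgue. (w x \<bullet> e) * f x) = (LINT x|lebesgue. W x * f x)"
      by (rule integral_cong_AE[OF borel_measurable_times[OF we fL] borel_measurable_times[OF WmL fL]])
         (use WL in eventually_elim, simp)
    also have "\<dots> = (LINT x|lborel. W x * f x)" by (rule integral_completion) simp
    finally show ?thesis .
  qed
  define k where "k y = (1 + y \<bullet> y) powr (-5/2)" for y :: "real^3"
  have km[measurable]: "k \<in> borel_measurable borel" unfolding k_def[abs_def] by measurable
  have pos: "0 < 1 + y \<bullet> y" for y :: "real^3" by (simp add: add_pos_nonneg)
  have "(LINT x|lborel. W x * g x) = 0"
  proof (rule approximate_identity_orthogonal[where k=k, OF W _ km _ _ _ g])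
    show "integrable lborel (\<lambda>x. (W x)\<^sup>2)"
    proof -
      have ie: "integrable lebesgue (\<lambda>x. (norm e)\<^sup>2 * (norm (w x))\<^sup>2)" using w by (simp add: L2_space_def)
      have ae: "AE x in lebesgue. norm ((W x)\<^sup>2) \<le> norm ((norm e)\<^sup>2 * (norm (w x))\<^sup>2)"
        using WL
      proof eventually_elim
        case (elim x)
        have "\<bar>W x\<bar> \<le> norm (w x) * norm e" using Cauchy_Schwarz_ineq2[of "w x" e] elim by simp
        then show ?case using power_mono[of "\<bar>W x\<bar>" "norm (w x) * norm e" 2] by (simp add: power_mult_distrib mult.commute)
      qed
      have "integrable lebesgue (\<lambda>x. (W x)\<^sup>2)"
        by (rule Bochner_Integration.integrable_bound[OF ie _ ae]) (use WmL in simp)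
      then show ?thesis by (subst (asm) integrable_completion) auto
    qed
    show "k y > 0" for y using pos[of y] by (simp add: k_def)
    show "integrable lborel k"
    proof (rule Bochner_Integration.integrable_bound[OF integrable_inverse_quartic])
      show "AE y in lborel. norm (k y) \<le> norm (1 / (1 + y \<bullet> y)\<^sup>2)"
      proof (rule AE_I2)
        fix y :: "real^3"
        have "k y \<le> (1 + y \<bullet> y) powr (-2)" unfolding k_def by (rule powr_mono) auto
        also have "\<dots> = 1 / (1 + y \<bullet> y)\<^sup>2" using pos[of y] by (simp add: powr_minus divide_inverse)
        finally show "norm (k y) \<le> norm (1 / (1 + y \<bullet> y)\<^sup>2)" by (simp add: k_def)
      qed
    qed simp
    show "(LINT y|lborel. W (a + \<epsilon> *\<^sub>R y) * k y) = 0" if \<epsilon>: "0 < \<epsilon>" "\<epsilon> \<le> 1" for a \<epsilon>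
    proof -
      define f where "f x = ((x - a) \<bullet> (x - a) + \<epsilon>\<^sup>2) powr (-5/2)" for x
      have f[measurable]: "f \<in> borel_measurable borel" unfolding f_def[abs_def] by measurable
      have fe: "f (a + \<epsilon> *\<^sub>R y) = (\<epsilon>\<^sup>2) powr (-5/2) * k y" for y
      proof -
        have "(a + \<epsilon> *\<^sub>R y - a) \<bullet> (a + \<epsilon> *\<^sub>R y - a) + \<epsilon>\<^sup>2 = \<epsilon>\<^sup>2 * (1 + y \<bullet> y)"
          by (simp add: power2_eq_square algebra_simps)
        then show ?thesis using pos[of y] by (simp only: f_def k_def powr_mult)
      qed
      have "0 = (LINT x|lborel. W x * f x)"
        using poisson_kernel_orthogonal[OF w div curl \<epsilon>, of e a] transfer[OF f] by (simp add: f_def)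
      \<comment> \<open>The substitution x = a + \<epsilon> y turns the kernel at scale \<epsilon>
        around a into a multiple of the fixed kernel k; the powers of \<epsilon> are nonzero and
        drop out.\<close>
      also have "\<dots> = \<epsilon> ^ 3 * (LINT y|lborel. W (a + \<epsilon> *\<^sub>R y) * f (a + \<epsilon> *\<^sub>R y))"
        using lborel_integral_affine[of "\<lambda>x. W x * f x" \<epsilon> a] \<epsilon> by simp
      also have "\<dots> = \<epsilon> ^ 3 * (LINT y|lborel. W (a + \<epsilon> *\<^sub>R y) * ((\<epsilon>\<^sup>2) powr (-5/2) * k y))"
        unfolding fe ..
      also have "(LINT y|lborel. W (a + \<epsilon> *\<^sub>R y) * ((\<epsilon>\<^sup>2) powr (-5/2) * k y))
          = (\<epsilon>\<^sup>2) powr (-5/2) * (LINT y|lborel. W (a + \<epsilon> *\<^sub>R y) * k y)"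
        by (subst integral_mult_right_zero[symmetric]) (simp only: mult_ac)
      finally show ?thesis using \<epsilon> by simp
    qed
  qed
  then show ?thesis using transfer[OF g(1)] by simp
qed

lemma L2_space_bounded_support:
  fixes k :: "real^3 \<Rightarrow> real^3"
  assumes m[measurable]: "k \<in> borel_measurable borel"
    and B: "\<And>x. norm (k x) \<le> B" and supp: "\<And>x. norm x > r \<Longrightarrow> k x = 0"
  shows "k \<in> L2_space lebesgue"
proof -
  have "integrable lborel (\<lambda>x. (norm (k x))\<^sup>2)"
  proof (rule Bochner_Integration.integrable_bound)
    show "integrable lborel (\<lambda>x::real^3. B\<^sup>2 * indicator (cball 0 r) x :: real)"
      by (intro integrable_mult_right integrable_real_indicator)
         (auto simp: emeasure_lborel_cball_finite[unfolded infinity_ennreal_def])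
    have "norm ((norm (k x))\<^sup>2) \<le> norm (B\<^sup>2 * indicator (cball 0 r) x :: real)" for x
      using supp[of x] power_mono[OF B[of x], of 2] by (cases "norm x \<le> r") auto
    then show "AE x in lborel. norm ((norm (k x))\<^sup>2) \<le> norm (B\<^sup>2 * indicator (cball 0 r) x :: real)" by simp
  qed simp
  then show ?thesis using m by (simp add: L2_space_def integrable_completion measurable_completion)
qed

lemma L2_div_curl_free_orthogonal_vector:
  fixes w g :: "real^3 \<Rightarrow> real^3"
  assumes w: "w \<in> L2_space lebesgue" "distr_div_zero w" "distr_curl_zero w"
    and g[measurable]: "g \<in> borel_measurable borel" and B: "\<And>x. norm (g x) \<le> B"
    and supp: "\<And>x. norm x > r \<Longrightarrow> g x = 0" and cont: "AE x in lborel. isCont g x"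
  shows "(LINT x|lebesgue. w x \<bullet> g x) = 0"
proof -
  have gm: "(\<lambda>x. g x $ i) \<in> borel_measurable borel" for i
    using borel_measurable_inner[OF g borel_measurable_const[of "axis i 1"]] by (simp add: cart_eq_inner_axis)
  have gB: "\<bar>g x $ i\<bar> \<le> B" for x i using component_le_norm_cart[of "g x" i] B[of x] by linarith
  have z: "(LINT x|lebesgue. (w x \<bullet> axis i 1) * g x $ i) = 0" for i
  proof (rule L2_div_curl_free_orthogonal[OF w gm gB, where r=r])
    show "AE x in lborel. isCont (\<lambda>x. g x $ i) x"
      using cont by eventually_elim (rule isCont_vec_nth)
  qed (use supp in simp)
  have "integrable lebesgue (\<lambda>x. w x \<bullet> (g x $ i *\<^sub>R axis i 1))" for i
  proof (rule L2_inner_integrable[OF w(1)])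
    show "(\<lambda>x. g x $ i *\<^sub>R axis i 1) \<in> L2_space lebesgue"
      by (rule L2_space_bounded_support[where B=B and r=r])
         (use gm gB supp in \<open>auto intro!: borel_measurable_scaleR\<close>)
  qed
  then have int: "integrable lebesgue (\<lambda>x. (w x \<bullet> axis i 1) * g x $ i)" for i
    by (simp add: mult.commute)
  have "(LINT x|lebesgue. w x \<bullet> g x) = (LINT x|lebesgue. (\<Sum>i\<in>UNIV. (w x \<bullet> axis i 1) * g x $ i))"
    unfolding cart_eq_inner_axis[symmetric] by (simp add: inner_vec_def)
  also have "\<dots> = (\<Sum>i\<in>UNIV. LINT x|lebesgue. (w x \<bullet> axis i 1) * g x $ i)"
    by (rule Bochner_Integration.integral_sum) (rule int)
  also have "\<dots> = 0" by (simp add: z)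
  finally show ?thesis .
qed

lemma L2_space_extend_zero:
  assumes "m \<in> L2_space (lebesgue_on \<Omega>)" "\<Omega> \<in> sets lebesgue"
  shows "(\<lambda>x. indicat_real \<Omega> x *\<^sub>R m x) \<in> L2_space lebesgue"
proof -
  have \<Omega>: "\<Omega> \<inter> space lebesgue \<in> sets lebesgue" using assms by simp
  have "(\<lambda>x. indicat_real \<Omega> x *\<^sub>R m x) \<in> borel_measurable lebesgue"
    using assms(1) borel_measurable_restrict_space_iff[OF \<Omega>, of m] by (simp add: L2_space_def)
  moreover have "integrable lebesgue (\<lambda>x. indicat_real \<Omega> x *\<^sub>R (norm (m x))\<^sup>2)"
    using assms(1) integrable_restrict_space[OF \<Omega>, of "\<lambda>x. (norm (m x))\<^sup>2"] by (simp add: L2_space_def)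
  moreover have "(norm (indicat_real \<Omega> x *\<^sub>R m x))\<^sup>2 = indicat_real \<Omega> x *\<^sub>R (norm (m x))\<^sup>2" for x
    by (auto simp: indicator_def)
  ultimately show ?thesis by (simp add: L2_space_def)
qed

text \<open>The difference w of the two fields is divergence and curl free, and the energy sees it
  only through its pairing with the magnetization. It is therefore enough that w be orthogonal to
  the one field m' cut off at the ball. Two magnetizations occur because a minimizer is constant
  only almost everywhere.\<close>

lemma demag_field_integral_unique:
  fixes m m' h h' :: "real^3 \<Rightarrow> real^3"
  assumes h: "is_demag_field (ball 0 R) m h" and h': "is_demag_field (ball 0 R) m' h'"
    and m: "m \<in> L2_space (lebesgue_on (ball 0 R))" and m': "m' \<in> L2_space (lebesgue_on (ball 0 R))"
    and eq: "AE x in lebesgue_on (ball 0 R). m x = m' x"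
    and cont: "continuous_on (ball 0 R) m'" and bound: "\<And>x. x \<in> ball 0 R \<Longrightarrow> norm (m' x) \<le> 1"
  shows "(LINT x|lebesgue_on (ball 0 R). h x \<bullet> m x) = (LINT x|lebesgue_on (ball 0 R). h' x \<bullet> m' x)"
proof -
  let ?\<Omega> = "ball (0::real^3) R"
  let ?i = "indicat_real ?\<Omega>"
  have \<Omega>: "?\<Omega> \<inter> space lebesgue \<in> sets lebesgue" by simp
  have eqL: "AE x in lebesgue. ?i x *\<^sub>R m x = ?i x *\<^sub>R m' x"
    using eq unfolding AE_restrict_space_iff[OF \<Omega>] by eventually_elim (auto simp: indicator_def)
  have hL: "h \<in> L2_space lebesgue" "h' \<in> L2_space lebesgue" using h h' by (simp_all add: is_demag_field_def)
  have mL: "(\<lambda>x. ?i x *\<^sub>R m x) \<in> L2_space lebesgue" "(\<lambda>x. ?i x *\<^sub>R m' x) \<in> L2_space lebesgue"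
    by (rule L2_space_extend_zero; use m m' in simp)+
  define w where "w x = h x + - h' x" for x
  have w: "w \<in> L2_space lebesgue"
    unfolding w_def[abs_def] by (intro L2_space_add L2_space_uminus hL)
  have int: "integrable lebesgue (\<lambda>x. u x \<bullet> v x)" if "u \<in> L2_space lebesgue" "v \<in> L2_space lebesgue" for u v :: "real^3 \<Rightarrow> real^3"
    by (rule L2_inner_integrable[OF that])
  have div: "distr_div_zero w"
    unfolding distr_div_zero_def
  proof (intro allI impI)
    fix \<phi> :: "real^3 \<Rightarrow> real" assume \<phi>: "test_function \<phi>"
    note G = L2_gradient_test[OF \<phi>]
    have "AE x in lebesgue. w x \<bullet> gradient \<phi> x =
       (?i x *\<^sub>R m x + h x) \<bullet> gradient \<phi> x - (?i x *\<^sub>R m' x + h' x) \<bullet> gradient \<phi> x"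
      using eqL by eventually_elim (auto simp: w_def inner_add_left inner_diff_left)
    moreover have i: "integrable lebesgue (\<lambda>x. (?i x *\<^sub>R m x + h x) \<bullet> gradient \<phi> x)"
      "integrable lebesgue (\<lambda>x. (?i x *\<^sub>R m' x + h' x) \<bullet> gradient \<phi> x)"
      by (intro int L2_space_add mL hL G)+
    ultimately have "(LINT x|lebesgue. w x \<bullet> gradient \<phi> x) = (LINT x|lebesgue.
       (?i x *\<^sub>R m x + h x) \<bullet> gradient \<phi> x - (?i x *\<^sub>R m' x + h' x) \<bullet> gradient \<phi> x)"
      by (intro integral_cong_AE borel_measurable_diff borel_measurable_integrable[OF int[OF w G]]
          borel_measurable_integrable[OF i(1)] borel_measurable_integrable[OF i(2)])
    also have "\<dots> = 0"
      using h h' \<phi> by (subst Bochner_Integration.integral_diff[OF i]) (simp add: is_demag_field_def distr_div_zero_def)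
    finally show "(LINT x|lebesgue. w x \<bullet> gradient \<phi> x) = 0" .
  qed
  have curl: "distr_curl_zero w"
    unfolding distr_curl_zero_def
  proof (intro allI impI)
    fix \<psi> :: "real^3 \<Rightarrow> real^3" assume \<psi>: "test_function \<psi>"
    note C = L2_curl_test[OF \<psi>]
    have "(LINT x|lebesgue. w x \<bullet> curl \<psi> x) = (LINT x|lebesgue. h x \<bullet> curl \<psi> x - h' x \<bullet> curl \<psi> x)"
      by (simp add: w_def inner_diff_left)
    also have "\<dots> = 0"
      using h h' \<psi> by (subst Bochner_Integration.integral_diff[OF int[OF hL(1) C] int[OF hL(2) C]])
        (simp add: is_demag_field_def distr_curl_zero_def)
    finally show "(LINT x|lebesgue. w x \<bullet> curl \<psi> x) = 0" .
  qed
  have "(LINT x|lebesgue. w x \<bullet> (?i x *\<^sub>R m' x)) = 0"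
  proof (rule L2_div_curl_free_orthogonal_vector[OF w div curl, where B=1 and r=R])
    have "(\<lambda>x. if x \<in> ?\<Omega> then m' x else 0) \<in> borel_measurable borel"
      by (rule borel_measurable_continuous_on_if) (auto intro: cont)
    then show "(\<lambda>x. ?i x *\<^sub>R m' x) \<in> borel_measurable borel"
      by (rule back_subst[where P="\<lambda>f. f \<in> borel_measurable borel"]) (auto simp: fun_eq_iff indicator_def)
    show "norm (?i x *\<^sub>R m' x) \<le> 1" for x using bound[of x] by (auto simp: indicator_def)
    show "?i x *\<^sub>R m' x = 0" if "norm x > R" for x using that by (simp add: indicator_def)
    \<comment> \<open>Cutting m' off can create jumps only on the boundary sphere, a null set; this
      is why orthogonality was proved for functions continuous almost everywhere.\<close>
    show "AE x in lborel. isCont (\<lambda>x. ?i x *\<^sub>R m' x) x"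
      using AE_lborel_not_sphere[of R]
    proof eventually_elim
      case (elim x)
      then have "norm x < R \<or> norm x > R" by auto
      then consider "x \<in> ?\<Omega>" | "x \<in> - cball 0 R" by fastforce
      then show ?case
      proof cases
        case 1
        have "continuous_on ?\<Omega> (\<lambda>x. ?i x *\<^sub>R m' x)"
          by (rule continuous_on_eq[OF cont]) (simp add: indicator_def)
        then show ?thesis using 1 by (simp add: continuous_on_eq_continuous_at)
      next
        case 2
        have "continuous_on (- cball 0 R) (\<lambda>x. ?i x *\<^sub>R m' x)"
          by (rule continuous_on_eq[OF continuous_on_const[of _ 0]]) (auto simp: indicator_def)
        then show ?thesis using 2 by (simp add: continuous_on_eq_continuous_at open_Compl)
      qed
    qed
  qed
  moreover have "w x \<bullet> (?i x *\<^sub>R m' x) = h x \<bullet> (?i x *\<^sub>R m' x) - h' x \<bullet> (?i x *\<^sub>R m' x)" for x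
    by (simp add: w_def inner_add_left algebra_simps)
  ultimately have *: "(LINT x|lebesgue. h x \<bullet> (?i x *\<^sub>R m' x)) = (LINT x|lebesgue. h' x \<bullet> (?i x *\<^sub>R m' x))"
    using Bochner_Integration.integral_diff[OF int[OF hL(1) mL(2)] int[OF hL(2) mL(2)]] by simp
  have "(LINT x|lebesgue_on ?\<Omega>. h x \<bullet> m x) = (LINT x|lebesgue. h x \<bullet> (?i x *\<^sub>R m x))"
    by (simp add: integral_restrict_space[OF \<Omega>])
  also have "\<dots> = (LINT x|lebesgue. h x \<bullet> (?i x *\<^sub>R m' x))"
    by (rule integral_cong_AE[OF borel_measurable_integrable[OF int[OF hL(1) mL(1)]]
          borel_measurable_integrable[OF int[OF hL(1) mL(2)]]]) (use eqL in eventually_elim, simp only:)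
  also have "\<dots> = (LINT x|lebesgue_on ?\<Omega>. h' x \<bullet> m' x)"
    unfolding * by (simp add: integral_restrict_space[OF \<Omega>])
  finally show ?thesis .
qed

section \<open>Energies of the competitor and of constants\<close>

text \<open>With t = x . c, the polynomial part has squared length (1 - s)^2 + (2 - s) t^2/R^2. The
  azimuthal part is orthogonal to it and, by |c \<times> x|^2 = |x|^2 - t^2, adds (2 - s)(s -
  t^2/R^2). The radicand 2 - s is the one for which t cancels, and (1 - s)^2 + s (2 - s) =
  1.\<close>

lemma norm_vortex:
  fixes c x :: "real^3"
  assumes R: "R > 0" and c: "norm c = 1" and x: "x \<in> ball 0 R"
  shows "norm (vortex R c x) = 1"
proof -
  have cc: "c \<bullet> c = 1" using c by (simp add: norm_eq_1)
  define s where "s = x \<bullet> x / R\<^sup>2"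
  define t where "t = x \<bullet> c"
  have t: "x \<bullet> c = t" "c \<bullet> x = t" by (simp_all add: t_def inner_commute)
  have s: "x \<bullet> x = s * R\<^sup>2" using R by (simp add: s_def)
  have "x \<bullet> x < R\<^sup>2" using x by (simp add: norm_lt_square)
  then have "s < 1" using R by (simp add: s_def)
  then have k: "(sqrt (2 - s))\<^sup>2 = 2 - s" by simp
  have "(norm (c \<times> x))\<^sup>2 + (c \<bullet> x)\<^sup>2 = (norm c * norm x)\<^sup>2" by (rule norm_cross_dot)
  then have cr: "(c \<times> x) \<bullet> (c \<times> x) = x \<bullet> x - t\<^sup>2"
    using c by (simp add: t_def power2_norm_eq_inner power_mult_distrib inner_commute)
  define q where "q = sqrt (2 - s)"
  define X where "X = (c \<times> x) \<bullet> (c \<times> x)"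
  have "vortex R c x \<bullet> vortex R c x = (1 - s)\<^sup>2 + 2 * (1 - s) * t * (t / R\<^sup>2) + (t / R\<^sup>2)\<^sup>2 * (x \<bullet> x)
      + q\<^sup>2 / R\<^sup>2 * X"
    unfolding vortex_def s_def[symmetric] t_def[symmetric] q_def[symmetric]
    using R by (simp add: inner_add_left inner_add_right dot_cross_self cc t X_def[symmetric])
       (simp add: field_simps power2_eq_square)
  also have "\<dots> = 1" unfolding k[folded q_def] cr[folded X_def] s using R by (simp add: field_simps power2_eq_square)
  finally show ?thesis by (simp add: norm_eq_1)
qed

lemma loc_lipschitz_scaleR_const:
  fixes f :: "'a::real_normed_vector \<Rightarrow> real"
  assumes "loc_lipschitz f" shows "loc_lipschitz (\<lambda>x. f x *\<^sub>R b)"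
  using loc_lipschitz_compose[OF loc_lipschitz_linear[OF bounded_linear_scaleR_left[of b]] assms] .

lemma loc_lipschitz_componentwise:
  fixes f :: "'a::real_normed_vector \<Rightarrow> 'b::euclidean_space"
  assumes "\<And>b. b \<in> Basis \<Longrightarrow> loc_lipschitz (\<lambda>x. f x \<bullet> b)"
  shows "loc_lipschitz f"
proof -
  have "loc_lipschitz (\<lambda>x. \<Sum>b\<in>Basis. (f x \<bullet> b) *\<^sub>R b)"
    by (intro loc_lipschitz_sum loc_lipschitz_scaleR_const assms finite_Basis)
  then show ?thesis by (simp add: euclidean_representation)
qed

text \<open>All these fields are dilations of one field v on the unit ball, so a single K serves
  every radius and the Lipschitz constant decays like 1/R.\<close>

lemma vortex_lipschitz:
  obtains K where "K \<ge> 0"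
    "\<And>R x y. R > 0 \<Longrightarrow> x \<in> ball 0 R \<Longrightarrow> y \<in> ball 0 R \<Longrightarrow> norm (vortex R c x - vortex R c y) \<le> K / R * norm (x - y)"
proof -
  \<comment> \<open>Beyond s = 1 the root is frozen at its value 1, before its derivative blows up
    at s = 2; v then becomes locally Lipschitz on the whole space without changing on the unit
    ball.\<close>
  define \<beta> where "\<beta> s = (if s \<le> 1 then sqrt (2 - s) else 1)" for s :: real
  have \<beta>: "loc_lipschitz \<beta>"
    unfolding \<beta>_def[abs_def]
  proof (rule loc_lipschitz_piecewise_C1[where p'="\<lambda>s. - inverse (sqrt (2 - s)) / 2" and q'="\<lambda>_. 0"])
    show "((\<lambda>s. sqrt (2 - s)) has_real_derivative - inverse (sqrt (2 - s)) / 2) (at s)" if "s \<le> 1" for s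
    proof (rule DERIV_cong[OF DERIV_chain2[where f=sqrt and g="\<lambda>s. 2 - s"]])
      show "(sqrt has_real_derivative inverse (sqrt (2 - s)) / 2) (at (2 - s))"
        by (rule DERIV_real_sqrt) (use that in simp)
      show "((\<lambda>s. 2 - s) has_real_derivative - 1) (at s)" by (auto intro!: derivative_eq_intros)
    qed simp
    show "continuous_on {..1} (\<lambda>s. - inverse (sqrt (2 - s)) / 2 :: real)"
      by (intro continuous_intros) auto
  qed (simp_all add: continuous_on_const)
  define v where "v x = (1 - x \<bullet> x) *\<^sub>R c + (x \<bullet> c) *\<^sub>R x + \<beta> (x \<bullet> x) *\<^sub>R (c \<times> x)" for x
  have "loc_lipschitz v"
  proof (rule loc_lipschitz_componentwise)
    fix b :: "real^3"
    have "bounded_linear (\<lambda>x. (c \<times> x) \<bullet> b)"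
      using bilinear_cross unfolding bilinear_def
      by (intro bounded_linear_compose[OF bounded_linear_inner_left]) (auto intro: linear_linear[THEN iffD2])
    then have "loc_lipschitz (\<lambda>x. (1 + (-1) * (x \<bullet> x)) * (c \<bullet> b) + ((x \<bullet> c) * (x \<bullet> b) + \<beta> (x \<bullet> x) * ((c \<times> x) \<bullet> b)))"
      by (intro loc_lipschitz_add loc_lipschitz_mult loc_lipschitz_const loc_lipschitz_inner_self
          loc_lipschitz_compose[OF \<beta>] loc_lipschitz_linear bounded_linear_inner_left)
    then show "loc_lipschitz (\<lambda>x. v x \<bullet> b)"
      by (simp add: v_def inner_add_left add.assoc)
  qed
  then obtain K where K: "K-lipschitz_on (cball 0 1) v" unfolding loc_lipschitz_def by blast
  show thesis
  proof (rule that)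
    show "K \<ge> 0" by (rule lipschitz_on_nonneg[OF K])
    fix R :: real and x y :: "real^3"
    assume R: "R > 0" and xy: "x \<in> ball 0 R" "y \<in> ball 0 R"
    have sc: "vortex R c z = v (z /\<^sub>R R)" if z: "z \<in> ball 0 R" for z
    proof -
      have "z \<bullet> z < R\<^sup>2" using z by (simp add: norm_lt_square)
      then have "z \<bullet> z / R\<^sup>2 \<le> 1" using R by simp
      then show ?thesis using R
        by (simp add: v_def vortex_def \<beta>_def divide_inverse power2_eq_square mult_ac cross_mult_right)
    qed
    have "z /\<^sub>R R \<in> cball 0 1" if "z \<in> ball 0 R" for z :: "real^3"
      using that R by (simp add: field_simps)
    from lipschitz_onD[OF K this[OF xy(1)] this[OF xy(2)]]
    have "norm (v (x /\<^sub>R R) - v (y /\<^sub>R R)) \<le> K * norm (x /\<^sub>R R - y /\<^sub>R R)" by (simp add: dist_norm)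
    also have "\<dots> = K / R * norm (x - y)"
      using R by (simp add: divide_inverse flip: scaleR_diff_right)
    finally show "norm (vortex R c x - vortex R c y) \<le> K / R * norm (x - y)"
      by (simp add: sc[OF xy(1)] sc[OF xy(2)])
  qed
qed

section \<open>Smallness of the nonlocal energy\<close>

text \<open>Enlarging the inner integration from \<Omega> to the whole space makes it independent of
  x; the outer integration then contributes only the volume of \<Omega>.\<close>

lemma nn_integral_convolution_kernel_le:
  fixes F :: "real^3 \<Rightarrow> ennreal"
  assumes F[measurable]: "F \<in> borel_measurable borel" and even: "\<And>z. F (- z) = F z"
    and \<Omega>: "\<Omega> \<in> lmeasurable"
  shows "(\<integral>\<^sup>+(x, y). F (x - y) \<partial>(lebesgue_on \<Omega> \<Otimes>\<^sub>M lebesgue_on \<Omega>))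
     \<le> (\<integral>\<^sup>+z. F z \<partial>lborel) * emeasure lebesgue \<Omega>"
proof -
  let ?M = "lebesgue_on \<Omega>"
  interpret finite_measure ?M by (rule finite_measure_lebesgue_on[OF \<Omega>])
  have id: "(\<lambda>x. x) \<in> borel_measurable ?M"
    by (rule measurable_restrict_space1) (simp add: measurable_completion)
  have "(\<lambda>p. fst p - snd p) \<in> borel_measurable (?M \<Otimes>\<^sub>M ?M)"
    by (intro borel_measurable_diff measurable_compose[OF measurable_fst id] measurable_compose[OF measurable_snd id])
  from measurable_compose[OF this F] have m: "(\<lambda>(x, y). F (x - y)) \<in> borel_measurable (?M \<Otimes>\<^sub>M ?M)"
    by (simp add: case_prod_beta')
  have "(\<integral>\<^sup>+(x, y). F (x - y) \<partial>(?M \<Otimes>\<^sub>M ?M)) = (\<integral>\<^sup>+x. \<integral>\<^sup>+y. F (x - y) \<partial>?M \<partial>?M)"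
    using nn_integral_fst[OF m] by simp
  also have "\<dots> \<le> (\<integral>\<^sup>+x. (\<integral>\<^sup>+z. F z \<partial>lborel) \<partial>?M)"
  proof (rule nn_integral_mono)
    fix x
    have "(\<integral>\<^sup>+y. F (x - y) \<partial>?M) = (\<integral>\<^sup>+y. F (x - y) * indicator \<Omega> y \<partial>lebesgue)"
      using \<Omega> by (intro nn_integral_restrict_space) (simp add: fmeasurableD)
    also have "\<dots> \<le> (\<integral>\<^sup>+y. F (x - y) \<partial>lebesgue)"
      by (intro nn_integral_mono) (simp add: indicator_def)
    also have "\<dots> = (\<integral>\<^sup>+y. F (- x + y) \<partial>lborel)"
      using even[of "x - y" for y] by (simp add: nn_integral_completion)
    also have "\<dots> = (\<integral>\<^sup>+z. F z \<partial>distr lborel borel (\<lambda>y. - x + y))"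
      by (rule nn_integral_distr[symmetric]) auto
    also have "\<dots> = (\<integral>\<^sup>+z. F z \<partial>lborel)" by (simp only: lborel_distr_plus)
    finally show "(\<integral>\<^sup>+y. F (x - y) \<partial>?M) \<le> (\<integral>\<^sup>+z. F z \<partial>lborel)" .
  qed
  also have "\<dots> = (\<integral>\<^sup>+z. F z \<partial>lborel) * emeasure lebesgue \<Omega>"
    using \<Omega> by (simp add: emeasure_restrict_space fmeasurableD)
  finally show ?thesis .
qed

lemma truncated_kernel_integral_tendsto_0:
  fixes j :: "real^3 \<Rightarrow> ennreal"
  assumes j[measurable]: "j \<in> borel_measurable borel"
    and fin: "(\<integral>\<^sup>+ z. ennreal (min 1 ((norm z)\<^sup>2)) * j z \<partial>lborel) < \<infinity>"
  shows "(\<lambda>n. \<integral>\<^sup>+z. j z * ennreal (min 4 ((K / real (Suc n) * norm z)\<^sup>2)) \<partial>lborel) \<longlonglongrightarrow> 0"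
proof -
  let ?u = "\<lambda>n z. j z * ennreal (min 4 ((K / real (Suc n) * norm z)\<^sup>2))"
  have "(\<lambda>n. \<integral>\<^sup>+z. ?u n z \<partial>lborel) \<longlonglongrightarrow> nn_integral lborel (\<lambda>z::real^3. 0)"
  proof (rule nn_integral_dominated_convergence[where w="\<lambda>z. ennreal (4 + K\<^sup>2) * (ennreal (min 1 ((norm z)\<^sup>2)) * j z)"])
    show "AE z in lborel. ?u n z \<le> ennreal (4 + K\<^sup>2) * (ennreal (min 1 ((norm z)\<^sup>2)) * j z)" for n
    proof (rule AE_I2)
      fix z :: "real^3"
      have "(K / real (Suc n) * norm z)\<^sup>2 \<le> K\<^sup>2 * (norm z)\<^sup>2"
      proof -
        have "(K / real (Suc n))\<^sup>2 \<le> K\<^sup>2"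
        proof -
          have "K\<^sup>2 / (real (Suc n))\<^sup>2 \<le> K\<^sup>2 / 1"
            by (rule divide_left_mono) (auto intro: one_le_power)
          then show ?thesis by (simp add: power_divide)
        qed
        then show ?thesis unfolding power_mult_distrib[of "K / real (Suc n)"] by (rule mult_right_mono) simp
      qed
      then have "min 4 ((K / real (Suc n) * norm z)\<^sup>2) \<le> (4 + K\<^sup>2) * min 1 ((norm z)\<^sup>2)"
      proof (cases "(norm z)\<^sup>2 \<le> 1")
        case True
        have "min 4 ((K / real (Suc n) * norm z)\<^sup>2) \<le> K\<^sup>2 * (norm z)\<^sup>2"
          using \<open>(K / real (Suc n) * norm z)\<^sup>2 \<le> K\<^sup>2 * (norm z)\<^sup>2\<close> by (rule min.coboundedI2)
        also have "\<dots> \<le> (4 + K\<^sup>2) * (norm z)\<^sup>2" by (rule mult_right_mono) auto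
        finally show ?thesis using True by simp
      next
        case False
        have "min 4 ((K / real (Suc n) * norm z)\<^sup>2) \<le> 4 + K\<^sup>2" by (rule min.coboundedI1) simp
        then show ?thesis using False by simp
      qed
      then have "ennreal (min 4 ((K / real (Suc n) * norm z)\<^sup>2)) \<le> ennreal (4 + K\<^sup>2) * ennreal (min 1 ((norm z)\<^sup>2))"
        by (subst ennreal_mult[symmetric]) (auto intro: ennreal_leI)
      from mult_left_mono[OF this, of "j z"]
      show "?u n z \<le> ennreal (4 + K\<^sup>2) * (ennreal (min 1 ((norm z)\<^sup>2)) * j z)"
        by (simp add: mult_ac)
    qed
    show "(\<integral>\<^sup>+z. ennreal (4 + K\<^sup>2) * (ennreal (min 1 ((norm z)\<^sup>2)) * j z) \<partial>lborel) < \<infinity>"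
      using fin by (subst nn_integral_cmult) (auto simp: ennreal_mult_less_top)
    have "AE z in lborel. ennreal (min 1 ((norm z)\<^sup>2)) * j z \<noteq> \<infinity>"
      by (rule nn_integral_PInf_AE) (use fin in auto)
    then show "AE z in lborel. (\<lambda>n. ?u n z) \<longlonglongrightarrow> 0"
    proof eventually_elim
      case (elim z)
      show ?case
      \<comment> \<open>The weight vanishes at the origin, so finiteness of the weighted kernel says
        nothing about j there. But the truncated square is zero at z = 0 for every n, and infinity
        times 0 is 0. Elsewhere j is finite almost everywhere.\<close>
      proof (cases "z = 0")
        case False
        then have "ennreal (min 1 ((norm z)\<^sup>2)) \<noteq> 0" by (simp add: min_def)
        then have jz: "j z \<noteq> \<infinity>" using elim by (auto simp: ennreal_mult_eq_top_iff)
        have i: "(\<lambda>n. K * norm z * inverse (real (Suc n))) \<longlonglongrightarrow> K * norm z * 0"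
          by (intro tendsto_mult_left LIMSEQ_inverse_real_of_nat)
        have "(\<lambda>n. min 4 ((K * norm z * inverse (real (Suc n)))\<^sup>2)) \<longlonglongrightarrow> min 4 ((K * norm z * 0)\<^sup>2)"
          by (intro tendsto_min tendsto_const tendsto_power i)
        then have "(\<lambda>n. ennreal (min 4 ((K / real (Suc n) * norm z)\<^sup>2))) \<longlonglongrightarrow> ennreal 0"
          by (intro tendsto_ennrealI) (simp add: divide_inverse mult_ac)
        from ennreal_tendsto_cmult[OF _ this, of "j z"] jz show ?thesis by (simp add: less_top)
      qed simp
    qed
  qed measurable
  then show ?thesis by simp
qed

lemma continuous_on_vortex: "R > 0 \<Longrightarrow> continuous_on (ball 0 R) (vortex R c)"
  unfolding vortex_def[abs_def] by (auto intro!: continuous_intros continuous_on_cross)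

lemma L2_space_continuous_sphere:
  fixes m :: "real^3 \<Rightarrow> real^3"
  assumes cont: "continuous_on (ball 0 R) m" and norm: "\<And>x. x \<in> ball 0 R \<Longrightarrow> norm (m x) = 1"
  shows "m \<in> L2_space (lebesgue_on (ball 0 R))"
proof -
  have "m \<in> borel_measurable (lebesgue_on (ball 0 R))"
    by (rule continuous_imp_measurable_on_sets_lebesgue[OF cont]) simp
  moreover have "integrable (lebesgue_on (ball 0 R)) (\<lambda>x::real^3. 1::real)"
    by (intro finite_measure.integrable_const finite_measure_lebesgue_on) simp
  then have "integrable (lebesgue_on (ball 0 R)) (\<lambda>x. (norm (m x))\<^sup>2)"
    by (rule Bochner_Integration.integrable_cong[THEN iffD1, OF refl, rotated]) (simp add: norm)
  ultimately show ?thesis by (simp add: L2_space_def)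
qed

lemma nonlocal_energy_vortex_le:
  assumes j: "j \<in> borel_measurable borel" and even: "\<And>z. j (- z) = j z"
    and R: "R > 0" and c: "norm c = 1"
    and K: "\<And>x y. x \<in> ball 0 R \<Longrightarrow> y \<in> ball 0 R \<Longrightarrow> norm (vortex R c x - vortex R c y) \<le> L * norm (x - y)"
  shows "nonlocal_energy j (ball 0 R) (vortex R c)
    \<le> (\<integral>\<^sup>+z. j z * ennreal (min 4 ((L * norm z)\<^sup>2)) \<partial>lborel) * emeasure lebesgue (ball (0::real^3) R)"
proof -
  let ?F = "\<lambda>z. j z * ennreal (min 4 ((L * norm z)\<^sup>2))"
  have "nonlocal_energy j (ball 0 R) (vortex R c)
     \<le> (\<integral>\<^sup>+(x, y). ?F (x - y) \<partial>(lebesgue_on (ball 0 R) \<Otimes>\<^sub>M lebesgue_on (ball 0 R)))"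
    unfolding nonlocal_energy_def
  proof (rule nn_integral_mono, clarsimp simp: space_pair_measure)
    fix x y :: "real^3" assume xy: "norm x < R" "norm y < R"
    let ?d = "norm (vortex R c x - vortex R c y)"
    have "?d \<le> 1 + 1"
      using norm_triangle_ineq4[of "vortex R c x" "vortex R c y"] norm_vortex[OF R c, of x] norm_vortex[OF R c, of y] xy
      by simp
    then have "?d\<^sup>2 \<le> 2\<^sup>2" by (intro power_mono) auto
    moreover have "?d\<^sup>2 \<le> (L * norm (x - y))\<^sup>2" by (intro power_mono K) (use xy in auto)
    ultimately show "j (x - y) * ennreal (?d\<^sup>2) \<le> j (x - y) * ennreal (min 4 ((L * norm (x - y))\<^sup>2))"
      by (intro mult_left_mono ennreal_leI) auto
  qed
  also have "\<dots> \<le> (\<integral>\<^sup>+z. ?F z \<partial>lborel) * emeasure lebesgue (ball (0::real^3) R)"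
    using j even by (intro nn_integral_convolution_kernel_le) auto
  finally show ?thesis .
qed

section \<open>Magnetostatic energies and the comparison\<close>

lemma demag_field_is_demag_field:
  assumes "is_demag_field \<Omega> m h" shows "is_demag_field \<Omega> m (demag_field \<Omega> m)"
  unfolding demag_field_def by (rule someI[of "is_demag_field \<Omega> m", OF assms])

text \<open>\<open>demag_field\<close> chooses a field for the given representative m. The choice is
  meaningful only once a field is known for m itself and not just for the constant it equals almost
  everywhere.\<close>

lemma is_demag_field_cong_AE:
  assumes h: "is_demag_field \<Omega> m' h" and \<Omega>: "\<Omega> \<in> sets lebesgue"
    and m: "m \<in> L2_space (lebesgue_on \<Omega>)" and m': "m' \<in> L2_space (lebesgue_on \<Omega>)"
    and eq: "AE x in lebesgue_on \<Omega>. m x = m' x"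
  shows "is_demag_field \<Omega> m h"
proof -
  have eqL: "AE x in lebesgue. indicat_real \<Omega> x *\<^sub>R m x + h x = indicat_real \<Omega> x *\<^sub>R m' x + h x"
    using eq \<Omega> by (subst (asm) AE_restrict_space_iff) (auto simp: indicator_def elim!: eventually_mono)
  have hL: "h \<in> L2_space lebesgue" using h by (simp add: is_demag_field_def)
  have L: "(\<lambda>x. indicat_real \<Omega> x *\<^sub>R u x + h x) \<in> L2_space lebesgue" if "u \<in> L2_space (lebesgue_on \<Omega>)" for u
    by (intro L2_space_add hL L2_space_extend_zero[OF that \<Omega>])
  have "distr_div_zero (\<lambda>x. indicat_real \<Omega> x *\<^sub>R m x + h x)"
    unfolding distr_div_zero_def
  proof (intro allI impI)
    fix \<phi> :: "real^3 \<Rightarrow> real" assume \<phi>: "test_function \<phi>"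
    note G = L2_gradient_test[OF \<phi>]
    have "(LINT x|lebesgue. (indicat_real \<Omega> x *\<^sub>R m x + h x) \<bullet> gradient \<phi> x)
        = (LINT x|lebesgue. (indicat_real \<Omega> x *\<^sub>R m' x + h x) \<bullet> gradient \<phi> x)"
      by (rule integral_cong_AE[OF borel_measurable_integrable[OF L2_inner_integrable[OF L[OF m] G]]
            borel_measurable_integrable[OF L2_inner_integrable[OF L[OF m'] G]]])
         (use eqL in eventually_elim, simp only:)
    also have "\<dots> = 0" using h \<phi> by (simp add: is_demag_field_def distr_div_zero_def)
    finally show "(LINT x|lebesgue. (indicat_real \<Omega> x *\<^sub>R m x + h x) \<bullet> gradient \<phi> x) = 0" .
  qed
  then show ?thesis using h by (simp add: is_demag_field_def)
qed

lemma demag_integral_constant: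
  assumes R: "R > 0" and c: "norm c = 1" and m: "m \<in> L2_space (lebesgue_on (ball 0 R))"
    and eq: "AE x in lebesgue_on (ball 0 R). m x = c"
  shows "(LINT x|lebesgue_on (ball 0 R). demag_field (ball 0 R) m x \<bullet> m x)
    = - (1/3) * measure lebesgue (ball (0::real^3) R)"
proof -
  let ?\<Omega> = "ball (0::real^3) R"
  obtain h where h: "is_demag_field ?\<Omega> (\<lambda>x. c) h" "\<And>x. x \<in> ?\<Omega> \<Longrightarrow> h x = - (1/3) *\<^sub>R c"
    by (rule demag_field_constant[OF R c]) (rule that)
  have cL: "(\<lambda>x. c) \<in> L2_space (lebesgue_on ?\<Omega>)"
    by (rule L2_space_continuous_sphere) (use c in auto)
  have "is_demag_field ?\<Omega> m h" by (rule is_demag_field_cong_AE[OF h(1) _ m cL eq]) simp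
  then have "(LINT x|lebesgue_on ?\<Omega>. demag_field ?\<Omega> m x \<bullet> m x) = (LINT x|lebesgue_on ?\<Omega>. h x \<bullet> c)"
    by (rule demag_field_integral_unique[OF demag_field_is_demag_field h(1) m cL eq]) (use c in auto)
  also have "\<dots> = (LINT x|lebesgue_on ?\<Omega>. - (1/3))"
    by (rule Bochner_Integration.integral_cong) (use h(2) c in \<open>auto simp: norm_eq_1\<close>)
  also have "\<dots> = - (1/3) * measure lebesgue ?\<Omega>" by (simp add: measure_restrict_space)
  finally show ?thesis .
qed

text \<open>f is the magnetostatic density -h . m. The field h lies in the span of c and x, so the
  azimuthal part, orthogonal to both, does not enter.\<close>

lemma demag_integral_vortex:
  assumes R: "R > 0" and c: "norm c = 1"
  defines "f \<equiv> \<lambda>x::real^3. (1/5) * (x \<bullet> x / R\<^sup>2 - (x \<bullet> x / R\<^sup>2)\<^sup>2 + (x \<bullet> x / R\<^sup>2 + 2) * ((x \<bullet> c)\<^sup>2 / R\<^sup>2))"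
  shows "integrable (lebesgue_on (ball 0 R)) f"
    and "(LINT x|lebesgue_on (ball 0 R). demag_field (ball 0 R) (vortex R c) x \<bullet> vortex R c x)
      = - (LINT x|lebesgue_on (ball 0 R). f x)"
proof -
  let ?\<Omega> = "ball (0::real^3) R"
  have cc: "c \<bullet> c = 1" using c by (simp add: norm_eq_1)
  obtain h where h: "is_demag_field ?\<Omega> (vortex R c) h"
    "\<And>x. x \<in> ?\<Omega> \<Longrightarrow> h x = - (1/5) *\<^sub>R ((x \<bullet> x / R\<^sup>2) *\<^sub>R c + (2 * (x \<bullet> c) / R\<^sup>2) *\<^sub>R x)"
    by (rule demag_field_vortex[OF R c]) (rule that)
  note cont = continuous_on_vortex[OF R, of c]
  note norm = norm_vortex[OF R c]
  have vL: "vortex R c \<in> L2_space (lebesgue_on ?\<Omega>)" by (rule L2_space_continuous_sphere[OF cont norm])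
  have hf: "h x \<bullet> vortex R c x = - f x" if x: "x \<in> ?\<Omega>" for x
  proof -
    define t where "t = x \<bullet> c"
    have t: "x \<bullet> c = t" "c \<bullet> x = t" by (simp_all add: t_def inner_commute)
    define s where "s = x \<bullet> x / R\<^sup>2"
    have s: "x \<bullet> x = s * R\<^sup>2" using R by (simp add: s_def)
    show "h x \<bullet> vortex R c x = - f x"
      unfolding h(2)[OF x] vortex_def f_def t s_def[symmetric]
      using R by (simp add: inner_add_left inner_add_right dot_cross_self cc t s)
        (simp add: field_simps power2_eq_square)
  qed
  have "integrable lebesgue (\<lambda>x. h x \<bullet> (indicat_real ?\<Omega> x *\<^sub>R vortex R c x))"
    using h(1) by (intro L2_inner_integrable L2_space_extend_zero vL) (simp_all add: is_demag_field_def)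
  then have "integrable (lebesgue_on ?\<Omega>) (\<lambda>x. h x \<bullet> vortex R c x)"
    by (subst integrable_restrict_space) simp_all
  then have "integrable (lebesgue_on ?\<Omega>) (\<lambda>x. - f x)"
    by (rule Bochner_Integration.integrable_cong[THEN iffD1, OF refl, rotated]) (simp add: hf)
  then show "integrable (lebesgue_on ?\<Omega>) f" by simp
  have "(LINT x|lebesgue_on ?\<Omega>. demag_field ?\<Omega> (vortex R c) x \<bullet> vortex R c x)
     = (LINT x|lebesgue_on ?\<Omega>. h x \<bullet> vortex R c x)"
    by (rule demag_field_integral_unique[OF demag_field_is_demag_field[OF h(1)] h(1) vL vL _ cont])
       (use norm in auto)
  also have "\<dots> = (LINT x|lebesgue_on ?\<Omega>. - f x)"
    by (rule Bochner_Integration.integral_cong[OF refl]) (simp add: hf)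
  also have "\<dots> = - (LINT x|lebesgue_on ?\<Omega>. f x)" by simp
  finally show "(LINT x|lebesgue_on ?\<Omega>. demag_field ?\<Omega> (vortex R c) x \<bullet> vortex R c x)
      = - (LINT x|lebesgue_on ?\<Omega>. f x)" .
qed

lemma X_space_vortex:
  assumes R: "R > 0" and c: "norm c = 1" and fin: "nonlocal_energy j (ball 0 R) (vortex R c) < \<infinity>"
  shows "vortex R c \<in> X_space j (ball 0 R)"
proof -
  have "vortex R c \<in> L2_space (lebesgue_on (ball 0 R))"
    by (rule L2_space_continuous_sphere[OF continuous_on_vortex[OF R] norm_vortex[OF R c]])
  moreover have "AE x in lebesgue_on (ball 0 R). vortex R c x \<in> sphere 0 1"
    by (rule AE_I2) (simp add: norm_vortex[OF R c])
  ultimately show ?thesis using fin by (simp add: X_space_def L2_sphere_def)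
qed

text \<open>Summing over the coordinate axes replaces \<open>(x \<cdot> c)\<^sup>2\<close> by \<open>|x|\<^sup>2\<close>, so no symmetry of the integral over the
  ball is needed.\<close>

lemma vortex_axes_density_le:
  fixes x :: "real^3"
  assumes R: "R > 0" and x: "x \<in> ball 0 R"
  shows "(\<Sum>i\<in>UNIV. (1/5) * (x \<bullet> x / R\<^sup>2 - (x \<bullet> x / R\<^sup>2)\<^sup>2 + (x \<bullet> x / R\<^sup>2 + 2) * ((x \<bullet> axis i 1)\<^sup>2 / R\<^sup>2))) \<le> 3/5"
proof -
  define u where "u = x \<bullet> x / R\<^sup>2"
  have "x \<bullet> x < R\<^sup>2" using x by (simp add: norm_lt_square)
  then have u: "0 \<le> u" "u \<le> 1" using R by (simp_all add: u_def)
  have x2: "(\<Sum>i\<in>UNIV. (x \<bullet> axis i 1)\<^sup>2) = x \<bullet> x"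
    unfolding cart_eq_inner_axis[symmetric] by (simp add: inner_vec_def power2_eq_square)
  have "(\<Sum>i\<in>UNIV. (1/5) * (u - u\<^sup>2 + (u + 2) * ((x \<bullet> axis i (1::real))\<^sup>2 / R\<^sup>2)))
      = (1/5) * (3 * (u - u\<^sup>2) + (u + 2) * ((\<Sum>i\<in>UNIV. (x \<bullet> axis i 1)\<^sup>2) / R\<^sup>2))"
    by (simp add: sum_3 add_divide_distrib algebra_simps)
  also have "\<dots> = u - (2/5) * u\<^sup>2" unfolding x2 u_def[symmetric] by (simp add: power2_eq_square algebra_simps)
  also have "\<dots> \<le> 3/5"
  proof -
    \<comment> \<open>The maximum over [0, 1] is attained at the boundary u = 1, whence the factor 1
      - u.\<close>
    have "0 \<le> (1 - u) * (3 - 2 * u)" using u by (intro mult_nonneg_nonneg) auto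
    then show ?thesis by (simp add: power2_eq_square algebra_simps)
  qed
  finally show ?thesis by (simp add: u_def)
qed

text \<open>The threshold 1/10 fits into the gap between the constant's energy and the averaged
  magnetostatic energy of the competitors: 1/10 + 1/5 = 3/10 < 1/3.\<close>

lemma constant_not_minimizer:
  assumes j: "j \<in> borel_measurable borel" and even: "\<And>z. j (- z) = j z"
    and R: "R > 0" and min: "minimizer j (ball 0 R) m" and const: "\<not> non_constant (ball 0 R) m"
    and K: "\<And>i x y. x \<in> ball 0 R \<Longrightarrow> y \<in> ball 0 R \<Longrightarrow>
        norm (vortex R (axis i 1) x - vortex R (axis i 1) y) \<le> L * norm (x - y)"
  shows "\<not> (\<integral>\<^sup>+z. j z * ennreal (min 4 ((L * norm z)\<^sup>2)) \<partial>lborel) \<le> ennreal (1/10)"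
proof
  let ?\<Omega> = "ball (0::real^3) R"
  define \<mu> where "\<mu> = measure lebesgue ?\<Omega>"
  have \<mu>: "emeasure lebesgue ?\<Omega> = ennreal \<mu>"
    unfolding \<mu>_def by (rule emeasure_eq_measure2) simp
  have \<mu>0: "\<mu> > 0" unfolding \<mu>_def using content_ball_pos[OF R, of "0::real^3"] by simp
  assume small: "(\<integral>\<^sup>+z. j z * ennreal (min 4 ((L * norm z)\<^sup>2)) \<partial>lborel) \<le> ennreal (1/10)"
  obtain c where c: "AE x in lebesgue_on ?\<Omega>. m x = c" using const by (auto simp: non_constant_def)
  have mX: "m \<in> X_space j ?\<Omega>" using min by (simp add: minimizer_def)
  then have mL: "m \<in> L2_space (lebesgue_on ?\<Omega>)" and sph: "AE x in lebesgue_on ?\<Omega>. m x \<in> sphere 0 1"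
    by (auto simp: X_space_def L2_sphere_def)
  have "norm c = 1"
  proof -
    \<comment> \<open>The ball has positive measure, so a statement about c alone that holds almost
      everywhere is true.\<close>
    have "ae_filter (lebesgue_on ?\<Omega>) \<noteq> bot"
      using \<mu> \<mu>0 by (simp add: ae_filter_eq_bot_iff emeasure_restrict_space)
    moreover have "AE x in lebesgue_on ?\<Omega>. norm c = 1"
      using c sph by eventually_elim auto
    ultimately show ?thesis by (simp add: eventually_const)
  qed
  note const_int = demag_integral_constant[OF R this mL c]
  define f where "f i x = (1/5) * (x \<bullet> x / R\<^sup>2 - (x \<bullet> x / R\<^sup>2)\<^sup>2 + (x \<bullet> x / R\<^sup>2 + 2) * ((x \<bullet> axis i 1)\<^sup>2 / R\<^sup>2))"
    for i and x :: "real^3"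
  note vort = demag_integral_vortex(2)[OF R norm_axis_1, folded f_def]
  have fint: "integrable (lebesgue_on ?\<Omega>) (f i)" for i
    unfolding f_def[abs_def] by (rule demag_integral_vortex(1)[OF R norm_axis_1])
  have ineq: "\<mu> / 3 \<le> \<mu> / 10 + (LINT x|lebesgue_on ?\<Omega>. f i x)" for i
  proof -
    let ?v = "vortex R (axis i 1)"
    have "nonlocal_energy j ?\<Omega> ?v \<le> (\<integral>\<^sup>+z. j z * ennreal (min 4 ((L * norm z)\<^sup>2)) \<partial>lborel) * emeasure lebesgue ?\<Omega>"
      by (rule nonlocal_energy_vortex_le[OF j even R norm_axis_1 K])
    also have "\<dots> \<le> ennreal (1/10) * ennreal \<mu>" unfolding \<mu> by (intro mult_right_mono small) simp
    also have "\<dots> = ennreal (\<mu> / 10)" using \<mu>0 by (simp flip: ennreal_mult)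
    finally have nl: "nonlocal_energy j ?\<Omega> ?v \<le> ennreal (\<mu> / 10)" .
    then have "nonlocal_energy j ?\<Omega> ?v < \<infinity>" by (rule le_less_trans) simp
    then have "?v \<in> X_space j ?\<Omega>" by (rule X_space_vortex[OF R norm_axis_1])
    then have "energy j ?\<Omega> m \<le> energy j ?\<Omega> ?v" using min by (simp add: minimizer_def)
    also have "\<dots> = enn2ereal (nonlocal_energy j ?\<Omega> ?v) + ereal (LINT x|lebesgue_on ?\<Omega>. f i x)"
      by (simp add: energy_def vort minus_ereal_def)
    also have "\<dots> \<le> ereal (\<mu> / 10) + ereal (LINT x|lebesgue_on ?\<Omega>. f i x)"
      using nl \<mu>0 by (intro add_right_mono) (simp add: less_eq_ennreal.rep_eq enn2ereal_ennreal)
    finally have up: "energy j ?\<Omega> m \<le> ereal (\<mu> / 10 + (LINT x|lebesgue_on ?\<Omega>. f i x))" by simp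
    \<comment> \<open>For the lower bound on the energy of m, nonnegativity of the nonlocal part is
      enough.\<close>
    have "ereal (\<mu> / 3) = 0 + ereal (\<mu> / 3)" by simp
    also have "\<dots> \<le> enn2ereal (nonlocal_energy j ?\<Omega> m) + ereal (\<mu> / 3)"
      by (intro add_right_mono) simp
    also have "\<dots> = energy j ?\<Omega> m"
      by (simp add: energy_def const_int \<mu>_def minus_ereal_def)
    also note up
    finally show ?thesis by simp
  qed
  have "(LINT x|lebesgue_on ?\<Omega>. (\<Sum>i\<in>UNIV. f i x)) \<le> (LINT x|lebesgue_on ?\<Omega>. 3/5)"
  proof (rule integral_mono)
    show "integrable (lebesgue_on ?\<Omega>) (\<lambda>x. \<Sum>i\<in>UNIV. f i x)"
      by (intro Bochner_Integration.integrable_sum) (rule fint)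
    show "integrable (lebesgue_on ?\<Omega>) (\<lambda>x. 3/5 :: real)"
      by (intro finite_measure.integrable_const finite_measure_lebesgue_on) simp
    show "(\<Sum>i\<in>UNIV. f i x) \<le> 3/5" if "x \<in> space (lebesgue_on ?\<Omega>)" for x
      unfolding f_def by (rule vortex_axes_density_le[OF R]) (use that in simp)
  qed
  also have "(LINT x|lebesgue_on ?\<Omega>. (\<Sum>i\<in>UNIV. f i x)) = (\<Sum>i\<in>UNIV. LINT x|lebesgue_on ?\<Omega>. f i x)"
    by (intro Bochner_Integration.integral_sum) (rule fint)
  also have "(LINT x|lebesgue_on ?\<Omega>. 3/5 :: real) = 3/5 * \<mu>"
    by (simp add: \<mu>_def measure_restrict_space)
  finally have "(\<Sum>i\<in>UNIV. LINT x|lebesgue_on ?\<Omega>. f i x) \<le> 3/5 * \<mu>" .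
  \<comment> \<open>Summed over the three axes, minimality would give \<mu> \<le> (3/10 + 3/5) \<mu>
    = (9/10) \<mu>.\<close>
  moreover have "(\<Sum>i\<in>(UNIV::3 set). \<mu> / 3) \<le> (\<Sum>i\<in>UNIV. \<mu> / 10 + (LINT x|lebesgue_on ?\<Omega>. f i x))"
    by (intro sum_mono ineq)
  ultimately show False using \<mu>0 by (simp add: sum.distrib)
qed

theorem theorem2p12:
  fixes j :: "real^3 \<Rightarrow> ennreal"
  assumes "j \<in> borel_measurable borel"
    and "\<And>z. j (- z) = j z"
    and "(\<integral>\<^sup>+ z. ennreal (min 1 ((norm z)\<^sup>2)) * j z \<partial>lborel) < \<infinity>"
    and "\<And>R. R > 0 \<Longrightarrow> \<not> (\<integral>\<^sup>+ z \<in> ball 0 R. j z \<partial>lborel) < \<infinity>"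
  shows "\<exists>R0>0. \<forall>R\<ge>R0. \<forall>m. minimizer j (ball 0 R) m \<longrightarrow> non_constant (ball 0 R) m"
proof -
  have "\<exists>K\<ge>0. \<forall>R x y. R > 0 \<longrightarrow> x \<in> ball 0 R \<longrightarrow> y \<in> ball 0 R \<longrightarrow>
      norm (vortex R (axis i 1) x - vortex R (axis i 1) y) \<le> K / R * norm (x - y)" for i
    by (rule vortex_lipschitz[of "axis i 1"]) blast
  then obtain k where k: "\<And>i. k i \<ge> 0" "\<And>i R x y. R > 0 \<Longrightarrow> x \<in> ball 0 R \<Longrightarrow> y \<in> ball 0 R \<Longrightarrow>
      norm (vortex R (axis i 1) x - vortex R (axis i 1) y) \<le> k i / R * norm (x - y)"
    by metis
  \<comment> \<open>The three axes may come with different constants; their sum dominates each of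
    them.\<close>
  define K where "K = (\<Sum>i\<in>UNIV. k i)"
  have K0: "K \<ge> 0" unfolding K_def using k(1) by (intro sum_nonneg) auto
  have kK: "k i \<le> K" for i unfolding K_def using k(1) by (intro member_le_sum) auto
  have "(\<lambda>n. \<integral>\<^sup>+z. j z * ennreal (min 4 ((K / real (Suc n) * norm z)\<^sup>2)) \<partial>lborel) \<longlonglongrightarrow> 0"
    by (rule truncated_kernel_integral_tendsto_0[OF assms(1,3)])
  then have "\<forall>\<^sub>F n in sequentially. (\<integral>\<^sup>+z. j z * ennreal (min 4 ((K / real (Suc n) * norm z)\<^sup>2)) \<partial>lborel) < ennreal (1/10)"
    by (rule order_tendstoD) simp
  then obtain n where n: "(\<integral>\<^sup>+z. j z * ennreal (min 4 ((K / real (Suc n) * norm z)\<^sup>2)) \<partial>lborel) < ennreal (1/10)"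
    unfolding eventually_sequentially by blast
  show ?thesis
  \<comment> \<open>The constant K/R decreases with R, so smallness of the kernel integral at the
    single radius n + 1 serves all larger radii.\<close>
  proof (intro exI[of _ "real (Suc n)"] conjI allI impI)
    fix R m assume R: "real (Suc n) \<le> R" and min: "minimizer j (ball 0 R) m"
    have R0: "R > 0" using R by (rule less_le_trans[rotated]) simp
    have KR: "K / R \<le> K / real (Suc n)" using R K0 R0 by (intro divide_left_mono) auto
    show "non_constant (ball 0 R) m"
    proof (rule ccontr)
      assume const: "\<not> non_constant (ball 0 R) m"
      have "norm (vortex R (axis i 1) x - vortex R (axis i 1) y) \<le> K / real (Suc n) * norm (x - y)"
        if "x \<in> ball 0 R" "y \<in> ball 0 R" for i x y
      proof -
        have "k i / R \<le> K / R" using kK R0 by (intro divide_right_mono) auto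
        also note KR
        finally show ?thesis using k(2)[OF R0 that, of i] by (meson mult_right_mono norm_ge_zero order_trans)
      qed
      from constant_not_minimizer[OF assms(1,2) R0 min const this] n show False by simp
    qed
  qed simp
qed

end
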